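(* Let $k\in\mathbb{N}$, $\gamma>0$, $\lambda>0$ and let $R$ be the hyperbolic Bessel process $$R_t=\operatorname{arcosh}(\gamma/\lambda)+B_t+k\int_0^t\coth R_u\,du.$$ For $\lambda>0$, we have $$\mathbb{E}\exp(-\lambda\cosh R_t)=(-1)^k e^{\frac{k^2}{2}t}\,\frac{\partial^{k}p(\gamma,\lambda)}{\partial\gamma^k},$$ where $$p(\gamma,\lambda)=\mathbb{E}\,e^{-\lambda\cosh(\operatorname{arcosh}(\gamma/\lambda)+B_t)}.$$
   Context: $B$ is a standard Brownian motion and $t$ is a fixed (deterministic) time. $\operatorname{arcosh}$ denotes the inverse function of $\cosh$, $\operatorname{arcosh}(y)=\ln\bigl(y+\sqrt{y^2-1}\bigr)$. A hyperbolic Bessel process of index $\alpha>-\frac12$ starting from $x\ge0$ is the nonnegative diffusion $R$ with $R_t=x+B_t+(\alpha+\frac12)\int_0^t\coth R_u\,du$ (for $\alpha\in(-\frac12,0)$ the point $0$ is instantaneously reflecting); for $\alpha=-\frac12$ it is defined as $R_t=|x+B_t|$. The process in the claim has index $\alpha=k-\frac12$.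
   Formalization: The factor e^{k²t/2} is corrected to e^{-k²t/2}: with the printed sign, for k=1, t>0, γ=λcosh x, λ→0, the left side tends to 1 but the right side to e^t. Also γ≥λ is made explicit so that arcosh(γ/λ) is defined; at γ=λ the derivative is one-sided. *)

theory Defs
  imports "HOL-Probability.Probability"
begin

text \<open>Time runs over \<open>{0..}\<close>; the values of \<open>F t\<close>, \<open>B t\<close> and \<open>R t\<close> at negative \<open>t\<close> play no role.\<close>

definition filtered_prob_space :: "'a measure \<Rightarrow> (real \<Rightarrow> 'a measure) \<Rightarrow> bool" where
  "filtered_prob_space M F \<longleftrightarrow>
     prob_space M \<and> filtration (space M) F \<and> (\<forall>t\<ge>0. subalgebra M (F t))"

definition standard_brownian_motion ::
  "'a measure \<Rightarrow> (real \<Rightarrow> 'a measure) \<Rightarrow> (real \<Rightarrow> 'a \<Rightarrow> real) \<Rightarrow> bool" where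
  "standard_brownian_motion M F B \<longleftrightarrow>
     (\<forall>t\<ge>0. B t \<in> borel_measurable (F t)) \<and>
     (AE \<omega> in M. B 0 \<omega> = 0) \<and>
     (AE \<omega> in M. continuous_on {0..} (\<lambda>t. B t \<omega>)) \<and>
     (\<forall>s\<ge>0. \<forall>t>s.
        distributed M lborel (\<lambda>\<omega>. B t \<omega> - B s \<omega>) (normal_density 0 (sqrt (t - s))) \<and>
        prob_space.indep_set M (sets (F s))
          (sets (vimage_algebra (space M) (\<lambda>\<omega>. B t \<omega> - B s \<omega>) borel)))"

definition coth :: "real \<Rightarrow> real" where
  "coth r = cosh r / sinh r"

text \<open>
  For \<open>\<alpha> > -1/2\<close> the process is a nonnegative adapted continuous solution of
  \<open>R\<^sub>t = x + B\<^sub>t + (\<alpha> + 1/2) \<integral>\<^sub>0\<^sup>t coth R\<^sub>u du\<close>.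
  The mathematical \<open>coth\<close> is infinite at \<open>0+\<close>, so the integral can be finite only if \<open>R\<close> spends
  Lebesgue-null time at \<open>0\<close>.  As \<open>cosh 0 / sinh 0 = 0\<close> here, this is required explicitly; for
  \<open>\<alpha> \<in> (-1/2, 0)\<close> it says that \<open>0\<close> is instantaneously reflecting.
\<close>

definition hyperbolic_bessel_process ::
  "'a measure \<Rightarrow> (real \<Rightarrow> 'a measure) \<Rightarrow> (real \<Rightarrow> 'a \<Rightarrow> real) \<Rightarrow> real \<Rightarrow> real
     \<Rightarrow> (real \<Rightarrow> 'a \<Rightarrow> real) \<Rightarrow> bool" where
  "hyperbolic_bessel_process M F B \<alpha> x R \<longleftrightarrow>
     \<alpha> \<ge> - 1 / 2 \<and> x \<ge> 0 \<and>
     (\<forall>t\<ge>0. R t \<in> borel_measurable (F t)) \<and>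
     (AE \<omega> in M. continuous_on {0..} (\<lambda>t. R t \<omega>)) \<and>
     (AE \<omega> in M. \<forall>t\<ge>0. R t \<omega> \<ge> 0) \<and>
     (if \<alpha> = - 1 / 2 then AE \<omega> in M. \<forall>t\<ge>0. R t \<omega> = \<bar>x + B t \<omega>\<bar>
      else AE \<omega> in M.
        (AE u in lborel. u \<ge> 0 \<longrightarrow> R u \<omega> \<noteq> 0) \<and>
        (\<forall>t\<ge>0. set_integrable lborel {0..t} (\<lambda>u. coth (R u \<omega>)) \<and>
               R t \<omega> = x + B t \<omega> + (\<alpha> + 1 / 2) * (LINT u:{0..t}|lborel. coth (R u \<omega>))))"

text \<open>\<open>X\<close> is the random variable \<open>B\<^sub>t\<close>.\<close>

definition p_fun :: "'a measure \<Rightarrow> ('a \<Rightarrow> real) \<Rightarrow> real \<Rightarrow> real \<Rightarrow> real" where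
  "p_fun M X \<gamma> lam = (LINT \<omega>|M. exp (- lam * cosh (arcosh (\<gamma> / lam) + X \<omega>)))"

text \<open>
  With \<open>lam\<close> fixed and \<open>\<gamma> = lam * cosh x\<close>, \<open>p_fun\<close> solves
  \<open>\<partial>\<^sub>t p = 1/2 (\<gamma>\<^sup>2 - lam\<^sup>2) p'' + 1/2 \<gamma> p'\<close>.  Differentiating \<open>k\<close> times in \<open>\<gamma>\<close> gives, for \<open>w = p\<^sup>(\<^sup>k\<^sup>)\<close>,
  \<open>\<partial>\<^sub>t w = 1/2 (\<gamma>\<^sup>2 - lam\<^sup>2) w'' + (k + 1/2) \<gamma> w' + (k\<^sup>2/2) w\<close>, i.e. the backward equation of the
  process of index \<open>k - 1/2\<close> plus a zeroth-order term.  Hence the factor relating \<open>w\<close> to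
  \<open>E exp (- lam * cosh R\<^sub>t)\<close> is \<open>exp (- k\<^sup>2 t / 2)\<close>.  The source prints it with the opposite sign in
  the exponent, which is a misprint: for \<open>k = 1\<close> and \<open>\<gamma> = lam \<rightarrow> 0\<close> the expectation tends to \<open>1\<close>,
  whereas \<open>- \<partial>p/\<partial>\<gamma>\<close> tends to \<open>E cosh B\<^sub>t = exp (t / 2)\<close>.
\<close>

text \<open>
  Iterated derivative relative to \<open>S\<close>, needed because \<open>\<gamma> \<mapsto> p_fun M X \<gamma> lam\<close> is meaningful
  only on \<open>{lam..}\<close>:
  it is the usual \<open>n\<close>-th derivative at interior points and one-sided at the end point \<open>lam\<close>.
\<close>

primrec nth_deriv_on :: "real set \<Rightarrow> nat \<Rightarrow> (real \<Rightarrow> real) \<Rightarrow> real \<Rightarrow> real" where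
  "nth_deriv_on S 0 f = f"
| "nth_deriv_on S (Suc n) f = (\<lambda>x. vector_derivative (nth_deriv_on S n f) (at x within S))"

definition times_differentiable_on :: "nat \<Rightarrow> (real \<Rightarrow> real) \<Rightarrow> real set \<Rightarrow> bool" where
  "times_differentiable_on n f S \<longleftrightarrow> (\<forall>j<n. nth_deriv_on S j f differentiable_on S)"

lemma nth_deriv_on_interior:
  assumes "x \<in> interior S"
  shows "nth_deriv_on S n f x = (deriv ^^ n) f x"
  using assms
proof (induction n arbitrary: x)
  case 0
  show ?case by simp
next
  case (Suc n)
  have ev: "\<forall>\<^sub>F y in nhds x. nth_deriv_on S n f y = (deriv ^^ n) f y"
    by (rule eventually_mono[OF eventually_nhds_in_open[OF open_interior Suc.prems]]) (rule Suc.IH)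
  have "nth_deriv_on S (Suc n) f x = vector_derivative (nth_deriv_on S n f) (at x)"
    by (simp only: nth_deriv_on.simps at_within_interior[OF Suc.prems])
  also have "\<dots> = deriv (nth_deriv_on S n f) x"
    unfolding vector_derivative_def deriv_def has_real_derivative_iff_has_vector_derivative by (rule refl)
  also have "\<dots> = deriv ((deriv ^^ n) f) x"
    by (rule deriv_cong_ev[OF ev refl])
  finally show ?case by (simp only: funpow.simps comp_apply)
qed

end

theory Submission
  imports Defs "HOL-Real_Asymp.Real_Asymp"
begin

text \<open>
  Put \<open>c = \<gamma> / lam = cosh x\<close>, where \<open>x\<close> is the starting point, let \<open>lam = exp y\<close>, and let \<open>y\<close> vary
  while \<open>c\<close> is kept fixed.  Both sides of the claim, multiplied by \<open>exp (k\<^sup>2 s / 2) lam\<^sup>k\<close> and regarded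
  as functions of time \<open>s\<close> and of \<open>y\<close>, solve the same equation
  \<open>\<partial>\<^sub>s v = 1/2 \<partial>\<^sub>y\<^sup>2 v - 1/2 exp (2 y) v\<close> with the same initial value \<open>lam\<^sup>k exp (- lam c)\<close>.  A maximum
  principle then identifies them.

  For the left side, Dynkin's formula is applied to the single function \<open>f r = exp (- lam cosh r)\<close>.
  Its derivatives are bounded and the singular drift is harmless, because
  \<open>f' r coth r = - lam cosh r f r\<close> extends continuously to \<open>r = 0\<close>.  The generator turns \<open>f\<close> into a
  combination of \<open>(lam cosh r)\<^sup>j f r\<close> with \<open>j \<le> 2\<close>, and these are \<open>y\<close>-derivatives of \<open>f\<close>; this is the
  equation above.  Differentiating in \<open>lam\<close> rather than in the starting point means that only one
  starting point enters, and that the delicate behaviour of the process as a function of the starting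
  point, in particular near \<open>x = 0\<close>, is avoided.

  Dynkin's formula is obtained from a discretisation of time.  The Brownian increments are treated
  by a Taylor expansion and independence.  The drift \<open>D\<^sub>s = R\<^sub>s - x - B\<^sub>s\<close> is a nondecreasing path, and
  its contribution converges path by path to a Lebesgue integral.  As \<open>D\<^sub>t\<close> is not known to be
  integrable beforehand, it is first capped at a level \<open>K\<close>; the resulting error is a constant times
  the probability of \<open>D\<^sub>t > K\<close>, which vanishes as \<open>K\<close> grows.

  For the right side, symmetry of \<open>B\<^sub>t\<close> allows \<open>p\<close> to be written as the mean of
  \<open>exp (- lam c cosh b) cosh (lam sqrt (c\<^sup>2 - 1) sinh b)\<close> at \<open>b = B\<^sub>t\<close>.  This is smooth in \<open>c\<close> up to and
  including \<open>c = 1\<close>, since \<open>cosh (sqrt z)\<close> is an entire function of \<open>z\<close>.  The function satisfies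
  \<open>\<partial>\<^sub>b\<^sup>2 = \<partial>\<^sub>y\<^sup>2 - exp (2 y)\<close>, and no \<open>c\<close> occurs in this relation, so that all its \<open>c\<close>-derivatives satisfy it
  as well.  Taking Gaussian means replaces \<open>1/2 \<partial>\<^sub>b\<^sup>2\<close> by \<open>\<partial>\<^sub>s\<close>.
\<close>

section \<open>Integrals with a parameter and Gaussian integrals\<close>

lemma continuous_on_integral_dominated:
  fixes f :: "'b::metric_space \<Rightarrow> 'a \<Rightarrow> real"
  assumes meas: "\<And>y. y \<in> S \<Longrightarrow> f y \<in> borel_measurable M"
    and cont: "AE \<omega> in M. continuous_on S (\<lambda>y. f y \<omega>)"
    and bound: "\<And>y. y \<in> S \<Longrightarrow> AE \<omega> in M. \<bar>f y \<omega>\<bar> \<le> g \<omega>"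
    and int: "integrable M g"
  shows "continuous_on S (\<lambda>y. LINT \<omega>|M. f y \<omega>)"
  unfolding continuous_on_sequentially comp_def
proof (intro allI ballI impI, elim conjE)
  fix x a assume a: "a \<in> S" and x: "\<forall>n. x n \<in> S" and lim: "x \<longlonglongrightarrow> a"
  show "(\<lambda>n. LINT \<omega>|M. f (x n) \<omega>) \<longlonglongrightarrow> (LINT \<omega>|M. f a \<omega>)"
  proof (rule integral_dominated_convergence[where w=g])
    show "AE \<omega> in M. (\<lambda>n. f (x n) \<omega>) \<longlonglongrightarrow> f a \<omega>"
      using cont
    proof eventually_elim
      case (elim \<omega>)
      then show ?case
        using a x lim unfolding continuous_on_sequentially comp_def by blast
    qed
  qed (use a x meas bound int in auto)
qed

text \<open>
  The set \<open>S\<close> may be a half-open interval, so that one-sided derivatives at an end point are covered: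
  the mean value inequality on the convex set \<open>S\<close> bounds the difference quotients by \<open>g\<close>.
\<close>

lemma has_real_derivative_integral_dominated:
  fixes f f' :: "real \<Rightarrow> 'a \<Rightarrow> real"
  assumes S: "convex S" "y0 \<in> S"
    and int: "\<And>y. y \<in> S \<Longrightarrow> integrable M (f y)"
    and meas: "f' y0 \<in> borel_measurable M"
    and der: "\<And>\<omega> y. y \<in> S \<Longrightarrow> ((\<lambda>y. f y \<omega>) has_real_derivative f' y \<omega>) (at y within S)"
    and bound: "\<And>\<omega> y. y \<in> S \<Longrightarrow> \<bar>f' y \<omega>\<bar> \<le> g \<omega>"
    and g: "integrable M g"
  shows "((\<lambda>y. LINT \<omega>|M. f y \<omega>) has_real_derivative (LINT \<omega>|M. f' y0 \<omega>)) (at y0 within S)"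
  unfolding has_field_derivative_iff tendsto_at_iff_sequentially comp_def
proof (intro allI impI)
  fix x assume x: "\<forall>n. x n \<in> S - {y0}" and lim: "x \<longlonglongrightarrow> y0"
  have xS: "x n \<in> S" and xn: "x n \<noteq> y0" for n using x by auto
  have "(\<lambda>n. LINT \<omega>|M. (f (x n) \<omega> - f y0 \<omega>) / (x n - y0)) \<longlonglongrightarrow> (LINT \<omega>|M. f' y0 \<omega>)"
  proof (rule integral_dominated_convergence[where w=g])
    show "AE \<omega> in M. (\<lambda>n. (f (x n) \<omega> - f y0 \<omega>) / (x n - y0)) \<longlonglongrightarrow> f' y0 \<omega>"
    proof (rule AE_I2)
      fix \<omega>
      show "(\<lambda>n. (f (x n) \<omega> - f y0 \<omega>) / (x n - y0)) \<longlonglongrightarrow> f' y0 \<omega>"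
        using der[OF S(2), of \<omega>] x lim
        unfolding has_field_derivative_iff tendsto_at_iff_sequentially comp_def by blast
    qed
    show "AE \<omega> in M. norm ((f (x n) \<omega> - f y0 \<omega>) / (x n - y0)) \<le> g \<omega>" for n
    proof (rule AE_I2)
      fix \<omega>
      have "norm (f (x n) \<omega> - f y0 \<omega>) \<le> g \<omega> * norm (x n - y0)"
        by (rule field_differentiable_bound[OF S(1) der _ xS S(2)]) (use bound in auto)
      then show "norm ((f (x n) \<omega> - f y0 \<omega>) / (x n - y0)) \<le> g \<omega>"
        using xn[of n] by (simp add: divide_simps)
    qed
  qed (use meas g in \<open>auto intro!: borel_measurable_integrable int xS S borel_measurable_diff borel_measurable_divide\<close>)
  also have "(\<lambda>n. LINT \<omega>|M. (f (x n) \<omega> - f y0 \<omega>) / (x n - y0)) =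
      (\<lambda>n. ((LINT \<omega>|M. f (x n) \<omega>) - (LINT \<omega>|M. f y0 \<omega>)) / (x n - y0))"
    by (intro ext) (simp add: int xS S)
  finally show "(\<lambda>n. ((LINT \<omega>|M. f (x n) \<omega>) - (LINT \<omega>|M. f y0 \<omega>)) / (x n - y0))
      \<longlonglongrightarrow> (LINT \<omega>|M. f' y0 \<omega>)" .
qed

text \<open>
  All integrands below grow at most exponentially; completing the square shows that the normal
  density absorbs this growth.
\<close>

lemma integrable_std_normal_exp_abs:
  "integrable lborel (\<lambda>z. std_normal_density z * exp (a * \<bar>z\<bar>))"
proof -
  have *: "integrable lborel (\<lambda>z. std_normal_density z * exp (b * z))" for b
  proof -
    have "(\<lambda>z. std_normal_density z * exp (b * z)) = (\<lambda>z. exp (b\<^sup>2 / 2) * normal_density b 1 z)"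
      by (intro ext) (simp add: normal_density_def exp_add[symmetric] power2_eq_square field_simps)
    then show ?thesis by (simp add: integrable_normal_density)
  qed
  show ?thesis
  proof (rule Bochner_Integration.integrable_bound)
    show "integrable lborel (\<lambda>z. std_normal_density z * exp (a * z) + std_normal_density z * exp ((-a) * z))"
      by (intro Bochner_Integration.integrable_add *)
    show "AE z in lborel. norm (std_normal_density z * exp (a * \<bar>z\<bar>)) \<le>
      norm (std_normal_density z * exp (a * z) + std_normal_density z * exp ((-a) * z))"
    proof (rule AE_I2)
      fix z :: real
      have nn: "0 \<le> std_normal_density z * exp (b * z)" for b
        by (intro mult_nonneg_nonneg normal_density_nonneg) (rule exp_ge_zero)
      have "std_normal_density z * exp (a * \<bar>z\<bar>) \<le>
          std_normal_density z * exp (a * z) + std_normal_density z * exp ((-a) * z)"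
      proof (cases "0 \<le> z")
        case True
        then have "std_normal_density z * exp (a * \<bar>z\<bar>) = std_normal_density z * exp (a * z)" by simp
        then show ?thesis using nn[of "-a"] by linarith
      next
        case False
        then have "std_normal_density z * exp (a * \<bar>z\<bar>) = std_normal_density z * exp ((-a) * z)" by simp
        then show ?thesis using nn[of a] by linarith
      qed
      moreover have "0 \<le> std_normal_density z * exp (a * \<bar>z\<bar>)"
        by (intro mult_nonneg_nonneg normal_density_nonneg) (rule exp_ge_zero)
      ultimately show "norm (std_normal_density z * exp (a * \<bar>z\<bar>)) \<le>
          norm (std_normal_density z * exp (a * z) + std_normal_density z * exp ((-a) * z))"
        unfolding real_norm_def by linarith
    qed
  qed simp
qed

lemma integrable_std_normal_exp_bound:
  assumes "\<phi> \<in> borel_measurable borel" "\<And>z. \<bar>\<phi> z\<bar> \<le> A * exp (a * \<bar>z\<bar>)"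
  shows "integrable lborel (\<lambda>z. std_normal_density z * \<phi> z)"
proof (rule Bochner_Integration.integrable_bound)
  show "integrable lborel (\<lambda>z. A * (std_normal_density z * exp (a * \<bar>z\<bar>)))"
    by (intro integrable_mult_right integrable_std_normal_exp_abs)
  show "AE z in lborel. norm (std_normal_density z * \<phi> z) \<le> norm (A * (std_normal_density z * exp (a * \<bar>z\<bar>)))"
  proof (rule AE_I2)
    fix z :: real
    have "norm (std_normal_density z * \<phi> z) \<le> std_normal_density z * (A * exp (a * \<bar>z\<bar>))"
      using assms(2)[of z] by (simp add: abs_mult mult_left_mono)
    also have "\<dots> \<le> norm (A * (std_normal_density z * exp (a * \<bar>z\<bar>)))"
      by (simp add: mult.left_commute)
    finally show "norm (std_normal_density z * \<phi> z) \<le> norm (A * (std_normal_density z * exp (a * \<bar>z\<bar>)))" .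
  qed
qed (use assms in measurable)

lemma std_normal_exp_tendsto_0:
  "((\<lambda>z. std_normal_density z * exp (a * \<bar>z\<bar>)) \<longlongrightarrow> 0) at_top"
  "((\<lambda>z. std_normal_density z * exp (a * \<bar>z\<bar>)) \<longlongrightarrow> 0) at_bot"
proof -
  have "((\<lambda>z. (1 / sqrt (2 * pi)) * exp (- z\<^sup>2 / 2 + a * z)) \<longlongrightarrow> 0) at_top"
    by real_asymp
  moreover have "eventually (\<lambda>z. (1 / sqrt (2 * pi)) * exp (- z\<^sup>2 / 2 + a * z) =
       std_normal_density z * exp (a * \<bar>z\<bar>)) at_top"
    using eventually_ge_at_top[of 0]
    by eventually_elim (simp add: normal_density_def mult_exp_exp)
  ultimately show top: "((\<lambda>z. std_normal_density z * exp (a * \<bar>z\<bar>)) \<longlongrightarrow> 0) at_top"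
    by (rule Lim_transform_eventually)
  show "((\<lambda>z. std_normal_density z * exp (a * \<bar>z\<bar>)) \<longlongrightarrow> 0) at_bot"
    unfolding filterlim_at_bot_mirror using top by (simp add: normal_density_def)
qed

lemma std_normal_density_has_derivative:
  "(std_normal_density has_real_derivative - z * std_normal_density z) (at z)"
proof -
  have *: "std_normal_density = (\<lambda>z. (1 / sqrt (2 * pi)) * exp (- (z * z) / 2))"
    by (intro ext) (simp add: normal_density_def power2_eq_square)
  have "((\<lambda>z. exp (- (z * z) / 2)) has_real_derivative exp (- (z * z) / 2) * (- z)) (at z)"
    by (rule derivative_eq_intros refl | simp)+
  from DERIV_cmult[OF this, of "1 / sqrt (2 * pi)"] show ?thesis
    unfolding * by (simp add: mult_ac)
qed

text \<open>
  Since the density \<open>\<rho>\<close> satisfies \<open>\<rho>' z = - z \<rho> z\<close>, the difference of the two integrands is the derivative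
  of \<open>- \<rho> \<psi>\<close>, which vanishes at both ends.
\<close>

lemma std_normal_integration_by_parts:
  fixes \<psi> \<psi>' :: "real \<Rightarrow> real"
  assumes der: "\<And>z. (\<psi> has_real_derivative \<psi>' z) (at z)"
    and cont: "continuous_on UNIV \<psi>'"
    and b: "\<And>z. \<bar>\<psi> z\<bar> \<le> A * exp (a * \<bar>z\<bar>)"
    and b': "\<And>z. \<bar>\<psi>' z\<bar> \<le> A' * exp (a' * \<bar>z\<bar>)"
  shows "(LINT z|lborel. std_normal_density z * (z * \<psi> z)) = (LINT z|lborel. std_normal_density z * \<psi>' z)"
proof -
  have A: "0 \<le> A" using b[of 0] by simp
  have cont\<psi>: "continuous_on UNIV \<psi>" by (rule DERIV_continuous_on) (rule der)
  have m[measurable]: "\<psi> \<in> borel_measurable borel" "\<psi>' \<in> borel_measurable borel"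
    using cont cont\<psi> by (auto intro: borel_measurable_continuous_onI)
  have int1: "integrable lborel (\<lambda>z. std_normal_density z * (z * \<psi> z))"
  proof (rule integrable_std_normal_exp_bound[where A=A and a="a + 1"])
    fix z :: real
    have "\<bar>z\<bar> \<le> exp \<bar>z\<bar>" using exp_ge_add_one_self[of "\<bar>z\<bar>"] by linarith
    then have "\<bar>z\<bar> * \<bar>\<psi> z\<bar> \<le> exp \<bar>z\<bar> * (A * exp (a * \<bar>z\<bar>))"
      by (intro mult_mono b) auto
    also have "\<dots> = A * exp ((a + 1) * \<bar>z\<bar>)" by (simp add: exp_add algebra_simps)
    finally show "\<bar>z * \<psi> z\<bar> \<le> A * exp ((a + 1) * \<bar>z\<bar>)" by (simp add: abs_mult)
  qed measurable
  have int2: "integrable lborel (\<lambda>z. std_normal_density z * \<psi>' z)"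
    by (rule integrable_std_normal_exp_bound[OF _ b']) measurable
  define G where "G z = - (std_normal_density z * \<psi> z)" for z
  define g where "g z = std_normal_density z * (z * \<psi> z) - std_normal_density z * \<psi>' z" for z
  have intg: "integrable lborel g" unfolding g_def by (intro Bochner_Integration.integrable_diff int1 int2)
  have lim: "((\<lambda>z. G z) \<longlongrightarrow> 0) F" if "((\<lambda>z. std_normal_density z * exp (a * \<bar>z\<bar>)) \<longlongrightarrow> 0) F" for F
  proof (rule Lim_null_comparison[OF always_eventually])
    show "((\<lambda>z. A * (std_normal_density z * exp (a * \<bar>z\<bar>))) \<longlongrightarrow> 0) F"
      using tendsto_mult_left[OF that, of A] by simp
    show "\<forall>z. norm (G z) \<le> A * (std_normal_density z * exp (a * \<bar>z\<bar>))"
      unfolding G_def using mult_left_mono[OF b normal_density_nonneg]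
      by (simp add: abs_mult mult.left_commute)
  qed
  have "(LBINT z=-\<infinity>..\<infinity>. g z) = 0 - 0"
  proof (rule interval_integral_FTC_integrable[where F=G])
    fix z :: real
    show "(G has_vector_derivative g z) (at z)"
      unfolding has_real_derivative_iff_has_vector_derivative[symmetric] G_def g_def
      by (auto intro!: derivative_eq_intros der std_normal_density_has_derivative simp: algebra_simps)
    show "isCont g z" unfolding g_def normal_density_def
      using cont cont\<psi> by (auto intro!: continuous_intros simp: continuous_on_eq_continuous_at)
    show "set_integrable lborel (einterval (-\<infinity>) \<infinity>) g"
      using intg by (simp add: set_integrable_def)
    have "((\<lambda>z. G z) \<longlongrightarrow> 0) at_bot" "((\<lambda>z. G z) \<longlongrightarrow> 0) at_top"
      by (intro lim std_normal_exp_tendsto_0)+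
    then show "((G \<circ> real_of_ereal) \<longlongrightarrow> 0) (at_right (-\<infinity>))" "((G \<circ> real_of_ereal) \<longlongrightarrow> 0) (at_left \<infinity>)"
      by (simp_all add: ereal_tendsto_simps1)
  qed simp
  then have "(LINT z|lborel. g z) = 0"
    by (simp add: interval_lebesgue_integral_def set_lebesgue_integral_def)
  then show ?thesis unfolding g_def using int1 int2 by simp
qed

section \<open>The derivatives of cosh of a square root\<close>

text \<open>
  Coefficients of the entire function \<open>z \<mapsto> cosh (sqrt z)\<close>.
\<close>

definition cosh_sqrt_coeff :: "nat \<Rightarrow> real" where "cosh_sqrt_coeff m = 1 / fact (2 * m)"

definition cosh_sqrt_deriv :: "nat \<Rightarrow> real \<Rightarrow> real" where
  "cosh_sqrt_deriv n z = (\<Sum>m. (diffs ^^ n) cosh_sqrt_coeff m * z ^ m)"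

lemma diffs_cosh_sqrt_coeff: "(diffs ^^ n) cosh_sqrt_coeff m = fact (m + n) / (fact m * fact (2 * (m + n)))"
proof (induction n arbitrary: m)
  case 0
  show ?case by (simp add: cosh_sqrt_coeff_def)
next
  case (Suc n)
  have "(diffs ^^ Suc n) cosh_sqrt_coeff m = real (Suc m) * (diffs ^^ n) cosh_sqrt_coeff (Suc m)"
    by (simp add: diffs_def)
  also have "\<dots> = real (Suc m) * (fact (m + Suc n) / (real (Suc m) * fact m * fact (2 * (m + Suc n))))"
    unfolding Suc by (simp only: fact_Suc add_Suc add_Suc_right of_nat_mult of_nat_fact)
  also have "\<dots> = fact (m + Suc n) / (fact m * fact (2 * (m + Suc n)))"
    by (simp only: times_divide_eq_right mult.assoc) (rule mult_divide_mult_cancel_left, simp)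
  finally show ?case .
qed

lemma diffs_cosh_sqrt_coeff_nonneg: "0 \<le> (diffs ^^ n) cosh_sqrt_coeff m"
  by (simp add: diffs_cosh_sqrt_coeff)

text \<open>
  Differentiation does not increase the coefficients of \<open>cosh (sqrt z)\<close>: this is why every derivative is
  dominated by \<open>cosh (sqrt z)\<close> itself for \<open>z \<ge> 0\<close>.
\<close>

lemma fact_quotient_le: "fact (m + n) * fact (2 * m) \<le> fact m * (fact (2 * (m + n)) :: real)"
proof (induction n)
  case 0
  show ?case by simp
next
  case (Suc n)
  have "fact (m + Suc n) * fact (2 * m) = real (Suc (m + n)) * (fact (m + n) * fact (2 * m))" by simp
  also have "\<dots> \<le> (real (2 * (m + n) + 2) * real (2 * (m + n) + 1)) * (fact m * fact (2 * (m + n)))"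
  proof (rule mult_mono[OF _ Suc])
    have "real (Suc (m + n)) * 1 \<le> real (2 * (m + n) + 2) * real (2 * (m + n) + 1)"
      by (intro mult_mono) auto
    then show "real (Suc (m + n)) \<le> real (2 * (m + n) + 2) * real (2 * (m + n) + 1)" by simp
  qed auto
  also have "\<dots> = fact m * fact (2 * (m + Suc n))"
    by (simp add: algebra_simps)
  finally show ?case .
qed

lemma diffs_cosh_sqrt_coeff_le: "(diffs ^^ n) cosh_sqrt_coeff m \<le> cosh_sqrt_coeff m"
  using fact_quotient_le[of m n] by (simp add: diffs_cosh_sqrt_coeff cosh_sqrt_coeff_def divide_simps mult.commute)

lemma cosh_sqrt_coeff_sums_cosh: "(\<lambda>m. cosh_sqrt_coeff m * w ^ (2 * m)) sums cosh w"
proof -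
  have "(\<lambda>n. if even n then w ^ n /\<^sub>R fact n else 0) sums cosh w" by (rule cosh_converges)
  from sums_group[OF this, of 2]
  have "(\<lambda>m. \<Sum>n = m * 2..<m * 2 + 2. if even n then w ^ n /\<^sub>R fact n else 0) sums cosh w" by simp
  moreover have "{m * 2..<m * 2 + 2} = {2 * m, 2 * m + 1}" for m :: nat by auto
  ultimately show ?thesis by (simp add: cosh_sqrt_coeff_def divide_inverse mult.commute)
qed

lemma summable_cosh_sqrt_coeff: "summable (\<lambda>m. (diffs ^^ n) cosh_sqrt_coeff m * z ^ m)"
proof (rule summable_comparison_test')
  show "summable (\<lambda>m. cosh_sqrt_coeff m * (sqrt \<bar>z\<bar>) ^ (2 * m))"
    using cosh_sqrt_coeff_sums_cosh[of "sqrt \<bar>z\<bar>"] by (rule sums_summable)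
  show "norm ((diffs ^^ n) cosh_sqrt_coeff m * z ^ m) \<le> cosh_sqrt_coeff m * (sqrt \<bar>z\<bar>) ^ (2 * m)" for m
    using diffs_cosh_sqrt_coeff_le[of n m] diffs_cosh_sqrt_coeff_nonneg[of n m]
    by (simp add: abs_mult power_mult power_abs mult_right_mono)
qed

lemma cosh_sqrt_deriv_has_derivative:
  "(cosh_sqrt_deriv n has_real_derivative cosh_sqrt_deriv (Suc n) z) (at z)"
  using termdiffs_strong_converges_everywhere[OF summable_cosh_sqrt_coeff[of n], of z]
  unfolding cosh_sqrt_deriv_def[abs_def] by simp

lemma cosh_sqrt_deriv_0_square: "cosh_sqrt_deriv 0 (w\<^sup>2) = cosh w"
  using cosh_sqrt_coeff_sums_cosh[of w] unfolding cosh_sqrt_deriv_def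
  by (simp add: power_mult sums_iff)

lemma cosh_sqrt_deriv_bound:
  assumes "0 \<le> w"
  shows "\<bar>cosh_sqrt_deriv n (w\<^sup>2)\<bar> \<le> exp w"
proof -
  have "0 \<le> cosh_sqrt_deriv n (w\<^sup>2)"
    unfolding cosh_sqrt_deriv_def by (intro suminf_nonneg summable_cosh_sqrt_coeff) (simp add: diffs_cosh_sqrt_coeff_nonneg)
  moreover have "cosh_sqrt_deriv n (w\<^sup>2) \<le> cosh_sqrt_deriv 0 (w\<^sup>2)"
    unfolding cosh_sqrt_deriv_def
    by (intro suminf_le summable_cosh_sqrt_coeff) (simp add: diffs_cosh_sqrt_coeff_le mult_right_mono)
  moreover have "cosh w \<le> exp w" using assms by (simp add: cosh_def)
  ultimately show ?thesis by (simp add: cosh_sqrt_deriv_0_square)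
qed

text \<open>
  The differential equation of \<open>cosh (sqrt z)\<close>, read off from the coefficients
  \<open>(2 m + 2) (2 m + 1) / (2 m + 2)! = 1 / (2 m)!\<close>.
\<close>

lemma cosh_sqrt_deriv_ode:
  "4 * z * cosh_sqrt_deriv 2 z + 2 * cosh_sqrt_deriv 1 z = cosh_sqrt_deriv 0 z"
proof -
  let ?c = "\<lambda>n m. (diffs ^^ n) cosh_sqrt_coeff m"
  have s2: "(\<lambda>m. ?c 2 m * z ^ m) sums cosh_sqrt_deriv 2 z"
    and s1: "(\<lambda>m. ?c 1 m * z ^ m) sums cosh_sqrt_deriv 1 z"
    and s0: "(\<lambda>m. ?c 0 m * z ^ m) sums cosh_sqrt_deriv 0 z"
    unfolding cosh_sqrt_deriv_def by (intro summable_sums summable_cosh_sqrt_coeff)+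
  have "(\<lambda>m. real m * ?c 1 m * z ^ m) sums (z * cosh_sqrt_deriv 2 z)"
  proof -
    have "(\<lambda>m. real (Suc m) * ?c 1 (Suc m) * z ^ Suc m) = (\<lambda>m. z * (?c 2 m * z ^ m))"
      by (intro ext) (simp add: diffs_def numeral_2_eq_2 algebra_simps)
    with sums_mult[OF s2, of z]
    have "(\<lambda>m. real (Suc m) * ?c 1 (Suc m) * z ^ Suc m) sums (z * cosh_sqrt_deriv 2 z)"
      by simp
    then show ?thesis by (subst (asm) sums_Suc_iff) simp
  qed
  from sums_add[OF sums_mult[OF this, of 4] sums_mult[OF s1, of 2]]
  have "(\<lambda>m. 4 * (real m * ?c 1 m * z ^ m) + 2 * (?c 1 m * z ^ m)) sums
      (4 * (z * cosh_sqrt_deriv 2 z) + 2 * cosh_sqrt_deriv 1 z)" .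
  also have "(\<lambda>m. 4 * (real m * ?c 1 m * z ^ m) + 2 * (?c 1 m * z ^ m)) = (\<lambda>m. ?c 0 m * z ^ m)"
  proof (rule ext)
    fix m
    have "(4 * real m + 2) * ?c 1 m = ?c 0 m"
      by (simp add: diffs_def cosh_sqrt_coeff_def divide_simps) (simp add: algebra_simps)
    then show "4 * (real m * ?c 1 m * z ^ m) + 2 * (?c 1 m * z ^ m) = ?c 0 m * z ^ m"
      by (metis (no_types, lifting) distrib_right mult.assoc)
  qed
  finally show ?thesis using s0 sums_unique2 by fastforce
qed

section \<open>Iterated derivatives of the symmetrised integrand\<close>

text \<open>
  Polynomials in \<open>lam = exp y\<close> (\<open>VL\<close>), \<open>c\<close> (\<open>VC\<close>), \<open>cosh b\<close>, \<open>sinh b\<close> and the functions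
  \<open>H n = exp (- lam c cosh b) h\<^sub>n (lam\<^sup>2 (c\<^sup>2 - 1) sinh\<^sup>2 b)\<close>, where \<open>h\<^sub>n\<close> is the \<open>n\<close>-th derivative of
  \<open>cosh (sqrt z)\<close>.  This family contains the symmetrised integrand \<open>H 0\<close> and is closed under
  differentiation in \<open>c\<close>, \<open>y\<close> and \<open>b\<close>.  The syntactic form gives derivatives of all orders at once, and
  bounds and commutation of derivatives follow by induction on expressions.
\<close>

datatype hyp_expr = Cst real | VL | VC | Ch | Sh | H nat | Add hyp_expr hyp_expr | Mul hyp_expr hyp_expr

primrec ev :: "hyp_expr \<Rightarrow> real \<Rightarrow> real \<Rightarrow> real \<Rightarrow> real" where
  "ev (Cst a) y c b = a"
| "ev VL y c b = exp y"
| "ev VC y c b = c"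
| "ev Ch y c b = cosh b"
| "ev Sh y c b = sinh b"
| "ev (H n) y c b = exp (- (exp y * c * cosh b)) * cosh_sqrt_deriv n ((exp y)\<^sup>2 * (c\<^sup>2 - 1) * (sinh b)\<^sup>2)"
| "ev (Add p q) y c b = ev p y c b + ev q y c b"
| "ev (Mul p q) y c b = ev p y c b * ev q y c b"

primrec dC :: "hyp_expr \<Rightarrow> hyp_expr" where
  "dC (Cst a) = Cst 0"
| "dC VL = Cst 0"
| "dC VC = Cst 1"
| "dC Ch = Cst 0"
| "dC Sh = Cst 0"
| "dC (H n) = Add (Mul (Mul (Cst (-1)) (Mul VL Ch)) (H n))
      (Mul (Mul (Cst 2) (Mul (Mul VL VL) (Mul VC (Mul Sh Sh)))) (H (Suc n)))"
| "dC (Add p q) = Add (dC p) (dC q)"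
| "dC (Mul p q) = Add (Mul (dC p) q) (Mul p (dC q))"

primrec dY :: "hyp_expr \<Rightarrow> hyp_expr" where
  "dY (Cst a) = Cst 0"
| "dY VL = VL"
| "dY VC = Cst 0"
| "dY Ch = Cst 0"
| "dY Sh = Cst 0"
| "dY (H n) = Add (Mul (Mul (Cst (-1)) (Mul VL (Mul VC Ch))) (H n))
      (Mul (Mul (Cst 2) (Mul (Mul VL VL) (Mul (Add (Mul VC VC) (Cst (-1))) (Mul Sh Sh)))) (H (Suc n)))"
| "dY (Add p q) = Add (dY p) (dY q)"
| "dY (Mul p q) = Add (Mul (dY p) q) (Mul p (dY q))"

primrec dB :: "hyp_expr \<Rightarrow> hyp_expr" where
  "dB (Cst a) = Cst 0"
| "dB VL = Cst 0"
| "dB VC = Cst 0"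
| "dB Ch = Sh"
| "dB Sh = Ch"
| "dB (H n) = Add (Mul (Mul (Cst (-1)) (Mul VL (Mul VC Sh))) (H n))
      (Mul (Mul (Cst 2) (Mul (Mul VL VL) (Mul (Add (Mul VC VC) (Cst (-1))) (Mul Sh Ch)))) (H (Suc n)))"
| "dB (Add p q) = Add (dB p) (dB q)"
| "dB (Mul p q) = Add (Mul (dB p) q) (Mul p (dB q))"

lemmas cosh_sqrt_deriv_chain = DERIV_chain2[OF cosh_sqrt_deriv_has_derivative]

lemma dC_correct: "((\<lambda>c. ev p y c b) has_real_derivative ev (dC p) y c b) (at c)"
  by (induction p)
    (auto intro!: derivative_eq_intros cosh_sqrt_deriv_chain simp: algebra_simps power2_eq_square)

lemma dY_correct: "((\<lambda>y. ev p y c b) has_real_derivative ev (dY p) y c b) (at y)"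
  by (induction p)
    (auto intro!: derivative_eq_intros cosh_sqrt_deriv_chain simp: algebra_simps power2_eq_square)

lemma dB_correct: "((\<lambda>b. ev p y c b) has_real_derivative ev (dB p) y c b) (at b)"
  by (induction p)
    (auto intro!: derivative_eq_intros cosh_sqrt_deriv_chain simp: algebra_simps power2_eq_square)

lemma dC_dB_commute: "ev (dC (dB p)) y c b = ev (dB (dC p)) y c b"
  by (induction p) (simp_all add: algebra_simps power2_eq_square)

lemma dC_dY_commute: "ev (dC (dY p)) y c b = ev (dY (dC p)) y c b"
  by (induction p) (simp_all add: algebra_simps power2_eq_square)

text \<open>
  The operations \<open>dC\<close>, \<open>dY\<close>, \<open>dB\<close> respect equality of values although they act on syntax, because a
  derivative is determined by the function.
\<close>

lemma ev_dC_cong: "ev p = ev q \<Longrightarrow> ev (dC p) = ev (dC q)"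
  by (intro ext) (metis DERIV_unique dC_correct)

lemma ev_dY_cong: "ev p = ev q \<Longrightarrow> ev (dY p) = ev (dY q)"
  by (intro ext) (rule DERIV_unique[OF dY_correct], insert dY_correct[of q], simp)

lemma ev_dB_cong: "ev p = ev q \<Longrightarrow> ev (dB p) = ev (dB q)"
  by (intro ext) (rule DERIV_unique[OF dB_correct], insert dB_correct[of q], simp)

text \<open>
  The operator \<open>\<partial>\<^sub>y\<^sup>2 - exp (2 y)\<close>.
\<close>

abbreviation schroedinger :: "hyp_expr \<Rightarrow> hyp_expr" where
  "schroedinger p \<equiv> Add (dY (dY p)) (Mul (Mul (Cst (-1)) (Mul VL VL)) p)"

text \<open>
  For \<open>c = cosh \<xi>\<close> the function \<open>H 0\<close> is the mean of \<open>exp (- w)\<close> over the two choices of sign in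
  \<open>w = lam cosh (\<xi> \<plusminus> b)\<close>.  As \<open>\<partial>\<^sub>y w = w\<close> and \<open>(\<partial>\<^sub>b w)\<^sup>2 = w\<^sup>2 - lam\<^sup>2\<close>, one has
  \<open>\<partial>\<^sub>y\<^sup>2 exp (- w) = (w\<^sup>2 - w) exp (- w)\<close> and \<open>\<partial>\<^sub>b\<^sup>2 exp (- w) = (w\<^sup>2 - lam\<^sup>2 - w) exp (- w)\<close>.  For arbitrary
  real \<open>c\<close> the identity reduces to the equation of \<open>cosh (sqrt z)\<close> and \<open>cosh\<^sup>2 b = 1 + sinh\<^sup>2 b\<close>.
\<close>

lemma H0_equation: "ev (dB (dB (H 0))) = ev (schroedinger (H 0))"
proof (intro ext)
  fix y c b :: real
  define l where "l = exp y"
  define C where "C = cosh b"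
  define S where "S = sinh b"
  define z where "z = l\<^sup>2 * (c\<^sup>2 - 1) * S\<^sup>2"
  define e where "e = exp (- (l * c * C))"
  have CS: "C\<^sup>2 = S\<^sup>2 + 1" unfolding C_def S_def by (rule cosh_square_eq)
  have ode: "cosh_sqrt_deriv 0 z = 4 * z * cosh_sqrt_deriv (Suc (Suc 0)) z + 2 * cosh_sqrt_deriv (Suc 0) z"
    using cosh_sqrt_deriv_ode[of z] by (simp add: numeral_2_eq_2)
  define h1 where "h1 = cosh_sqrt_deriv (Suc 0) z"
  define h2 where "h2 = cosh_sqrt_deriv (Suc (Suc 0)) z"
  have "ev (dB (dB (H 0))) y c b - ev (schroedinger (H 0)) y c b = 0"
    apply (simp add: l_def[symmetric] C_def[symmetric] S_def[symmetric])
    apply (simp add: z_def[symmetric] e_def[symmetric] ode h1_def[symmetric] h2_def[symmetric])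
    using CS z_def by algebra
  then show "ev (dB (dB (H 0))) y c b = ev (schroedinger (H 0)) y c b" by simp
qed

text \<open>
  The operators \<open>\<partial>\<^sub>b\<^sup>2\<close> and \<open>\<partial>\<^sub>y\<^sup>2 - exp (2 y)\<close> do not involve \<open>c\<close>, hence they commute with \<open>\<partial>\<^sub>c\<close>.
\<close>

lemma dC_H0_equation: "ev (dB (dB ((dC ^^ k) (H 0)))) = ev (schroedinger ((dC ^^ k) (H 0)))"
proof (induction k)
  case 0
  show ?case by (simp add: H0_equation del: dB.simps dY.simps ev.simps)
next
  case (Suc k)
  let ?p = "(dC ^^ k) (H 0)"
  have "ev (dB (dB (dC ?p))) = ev (dB (dC (dB ?p)))"
    by (rule ev_dB_cong) (intro ext, rule dC_dB_commute[symmetric])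
  also have "\<dots> = ev (dC (dB (dB ?p)))"
    by (intro ext) (rule dC_dB_commute[symmetric])
  also have "\<dots> = ev (dC (schroedinger ?p))" by (rule ev_dC_cong) (rule Suc)
  also have "\<dots> = ev (schroedinger (dC ?p))"
  proof (intro ext)
    fix y c b
    have "ev (dC (dY (dY ?p))) y c b = ev (dY (dC (dY ?p))) y c b" by (rule dC_dY_commute)
    also have "\<dots> = ev (dY (dY (dC ?p))) y c b"
      by (rule fun_cong[OF fun_cong[OF fun_cong[OF ev_dY_cong]]]) (intro ext, rule dC_dY_commute)
    finally show "ev (dC (schroedinger ?p)) y c b = ev (schroedinger (dC ?p)) y c b" by simp
  qed
  finally show ?case by simp
qed

lemma abs_sinh_le_cosh: "\<bar>sinh b\<bar> \<le> cosh (b :: real)"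
  using cosh_plus_sinh[of b] cosh_minus_sinh[of b] exp_gt_zero[of b] exp_gt_zero[of "-b"]
  by linarith

lemma cosh_le_exp_abs: "cosh b \<le> exp \<bar>b :: real\<bar>"
  by (cases "0 \<le> b") (auto simp: cosh_def)

text \<open>
  The exponential wins against the growth of \<open>cosh (sqrt z)\<close> because
  \<open>sqrt (c\<^sup>2 - 1) \<bar>sinh b\<bar> \<le> c cosh b\<close>.
\<close>

lemma ev_H_bound:
  assumes "1 \<le> c"
  shows "\<bar>ev (H n) y c b\<bar> \<le> 1"
proof -
  define w where "w = exp y * sqrt (c\<^sup>2 - 1) * \<bar>sinh b\<bar>"
  have c2: "1 \<le> c\<^sup>2" using assms by simp
  have w2: "w\<^sup>2 = (exp y)\<^sup>2 * (c\<^sup>2 - 1) * (sinh b)\<^sup>2"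
    using c2 by (simp add: w_def power_mult_distrib)
  have w0: "0 \<le> w" unfolding w_def using c2 by (intro mult_nonneg_nonneg) auto
  have "sqrt (c\<^sup>2 - 1) * \<bar>sinh b\<bar> \<le> c * cosh b"
  proof (intro mult_mono)
    show "sqrt (c\<^sup>2 - 1) \<le> c" using assms by (intro real_le_lsqrt) auto
    show "\<bar>sinh b\<bar> \<le> cosh b" by (rule abs_sinh_le_cosh)
  qed (use assms in auto)
  then have "exp y * (sqrt (c\<^sup>2 - 1) * \<bar>sinh b\<bar>) \<le> exp y * (c * cosh b)" by (intro mult_left_mono) auto
  then have "w \<le> exp y * c * cosh b" by (simp add: w_def mult.assoc)
  then have "exp (- (exp y * c * cosh b)) * exp w \<le> 1" by (simp add: exp_add[symmetric])
  moreover have "\<bar>ev (H n) y c b\<bar> \<le> exp (- (exp y * c * cosh b)) * exp w"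
    using cosh_sqrt_deriv_bound[OF w0, of n] by (simp add: w2 abs_mult)
  ultimately show ?thesis by linarith
qed

lemma ev_bound: "\<exists>A\<ge>0. \<exists>a\<ge>0. \<forall>y c b. 1 \<le> c \<longrightarrow> \<bar>ev p y c b\<bar> \<le> A * exp (a * (\<bar>y\<bar> + c + \<bar>b\<bar>))"
proof (induction p)
  case (Cst x)
  then show ?case by (intro exI[of _ "\<bar>x\<bar>"] exI[of _ 0] conjI) auto
next
  case VL
  show ?case by (intro exI[of _ 1] conjI) auto
next
  case VC
  have "\<bar>c\<bar> \<le> exp (\<bar>y\<bar> + c + \<bar>b\<bar>)" if "1 \<le> c" for y c b :: real
    using exp_ge_add_one_self[of "\<bar>y\<bar> + c + \<bar>b\<bar>"] that by linarith
  then show ?case by (intro exI[of _ 1] conjI) auto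
next
  case Ch
  have "\<bar>cosh b\<bar> \<le> exp (\<bar>y\<bar> + c + \<bar>b\<bar>)" if "1 \<le> c" for y c b :: real
  proof -
    have "cosh b \<le> exp \<bar>b\<bar>" by (rule cosh_le_exp_abs)
    also have "\<dots> \<le> exp (\<bar>y\<bar> + c + \<bar>b\<bar>)" using that by simp
    finally show ?thesis by simp
  qed
  then show ?case by (intro exI[of _ 1] conjI) auto
next
  case Sh
  have "\<bar>sinh b\<bar> \<le> exp (\<bar>y\<bar> + c + \<bar>b\<bar>)" if "1 \<le> c" for y c b :: real
  proof -
    have "\<bar>sinh b\<bar> \<le> exp \<bar>b\<bar>"
      using abs_sinh_le_cosh[of b] cosh_le_exp_abs[of b] by linarith
    also have "\<dots> \<le> exp (\<bar>y\<bar> + c + \<bar>b\<bar>)" using that by simp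
    finally show ?thesis by simp
  qed
  then show ?case by (intro exI[of _ 1] conjI) auto
next
  case (H n)
  show ?case using ev_H_bound[of _ n] by (intro exI[of _ 1] conjI exI[of _ 0]) (auto simp del: ev.simps)
next
  case (Add p q)
  then obtain A a B b' where A: "A \<ge> 0" "a \<ge> 0" "\<And>y c b. 1 \<le> c \<Longrightarrow> \<bar>ev p y c b\<bar> \<le> A * exp (a * (\<bar>y\<bar> + c + \<bar>b\<bar>))"
    and B: "B \<ge> 0" "b' \<ge> 0" "\<And>y c b. 1 \<le> c \<Longrightarrow> \<bar>ev q y c b\<bar> \<le> B * exp (b' * (\<bar>y\<bar> + c + \<bar>b\<bar>))" by metis
  have "\<bar>ev (Add p q) y c b\<bar> \<le> (A + B) * exp ((a + b') * (\<bar>y\<bar> + c + \<bar>b\<bar>))" if c: "1 \<le> c" for y c b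
  proof -
    let ?r = "\<bar>y\<bar> + c + \<bar>b\<bar>"
    have "A * exp (a * ?r) \<le> A * exp ((a + b') * ?r)" "B * exp (b' * ?r) \<le> B * exp ((a + b') * ?r)"
      using A B c by (auto intro!: mult_left_mono mult_right_mono)
    with A(3)[OF c, of y b] B(3)[OF c, of y b] show ?thesis
      by (simp add: distrib_right) linarith
  qed
  then show ?case using A B by (intro exI[of _ "A + B"] exI[of _ "a + b'"] conjI) auto
next
  case (Mul p q)
  then obtain A a B b' where A: "A \<ge> 0" "a \<ge> 0" "\<And>y c b. 1 \<le> c \<Longrightarrow> \<bar>ev p y c b\<bar> \<le> A * exp (a * (\<bar>y\<bar> + c + \<bar>b\<bar>))"
    and B: "B \<ge> 0" "b' \<ge> 0" "\<And>y c b. 1 \<le> c \<Longrightarrow> \<bar>ev q y c b\<bar> \<le> B * exp (b' * (\<bar>y\<bar> + c + \<bar>b\<bar>))" by metis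
  have "\<bar>ev (Mul p q) y c b\<bar> \<le> (A * B) * exp ((a + b') * (\<bar>y\<bar> + c + \<bar>b\<bar>))" if c: "1 \<le> c" for y c b
  proof -
    let ?r = "\<bar>y\<bar> + c + \<bar>b\<bar>"
    have "\<bar>ev p y c b\<bar> * \<bar>ev q y c b\<bar> \<le> (A * exp (a * ?r)) * (B * exp (b' * ?r))"
      using A B c by (intro mult_mono) auto
    then show ?thesis by (simp add: abs_mult exp_add distrib_right algebra_simps)
  qed
  then show ?case using A B by (intro exI[of _ "A * B"] exI[of _ "a + b'"] conjI) auto
qed

lemma continuous_on_ev [continuous_intros]:
  assumes "continuous_on S f" "continuous_on S g" "continuous_on S h"
  shows "continuous_on S (\<lambda>x. ev p (f x) (g x) (h x))"
proof (induction p)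
  case (H n)
  have "continuous_on UNIV (cosh_sqrt_deriv n)"
    by (rule DERIV_continuous_on) (rule cosh_sqrt_deriv_has_derivative)
  then have "continuous_on S (\<lambda>x. cosh_sqrt_deriv n ((exp (f x))\<^sup>2 * ((g x)\<^sup>2 - 1) * (sinh (h x))\<^sup>2))"
    by (rule continuous_on_compose2) (auto intro!: continuous_intros assms)
  then show ?case
    by (auto intro!: continuous_intros assms)
qed (auto intro!: continuous_intros assms)

section \<open>Gaussian means and their evolution equation\<close>

text \<open>
  The mean of an expression at \<open>b = B\<^sub>s\<close>.  Writing \<open>B\<^sub>s\<close> as \<open>sqrt s\<close> times a standard normal variable
  includes \<open>s = 0\<close> and moves the dependence on \<open>s\<close> from the density into the smooth integrand.
\<close>

definition gauss_mean :: "hyp_expr \<Rightarrow> real \<Rightarrow> real \<Rightarrow> real \<Rightarrow> real" where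
  "gauss_mean p s y c = (LINT z|lborel. std_normal_density z * ev p y c (sqrt s * z))"

lemma ev_measurable [measurable]: "(\<lambda>z. ev p y c (r * z)) \<in> borel_measurable borel"
  by (intro borel_measurable_continuous_onI continuous_intros)

text \<open>
  One dominating function serves for all \<open>s\<close> and \<open>c\<close> in a bounded range; this feeds every exchange of
  limits and integrals below.
\<close>

lemma ev_scaled_bound:
  "\<exists>A\<ge>0. \<exists>a\<ge>0. \<forall>s y c z. 0 \<le> s \<longrightarrow> s \<le> T \<longrightarrow> 1 \<le> c \<longrightarrow> c \<le> C \<longrightarrow>
     \<bar>ev p y c (sqrt s * z)\<bar> \<le> A * exp (a * \<bar>y\<bar>) * exp (a * sqrt T * \<bar>z\<bar>)"
proof -
  obtain A a where A: "A \<ge> 0" "a \<ge> 0" "\<And>y c b. 1 \<le> c \<Longrightarrow> \<bar>ev p y c b\<bar> \<le> A * exp (a * (\<bar>y\<bar> + c + \<bar>b\<bar>))"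
    using ev_bound[of p] by metis
  have "\<bar>ev p y c (sqrt s * z)\<bar> \<le> (A * exp (a * C)) * exp (a * \<bar>y\<bar>) * exp (a * sqrt T * \<bar>z\<bar>)"
    if *: "0 \<le> s" "s \<le> T" "1 \<le> c" "c \<le> C" for s y c z
  proof -
    have "\<bar>sqrt s * z\<bar> \<le> sqrt T * \<bar>z\<bar>"
      using * by (simp add: abs_mult mult_right_mono)
    then have "a * (\<bar>y\<bar> + c + \<bar>sqrt s * z\<bar>) \<le> a * (C + \<bar>y\<bar> + sqrt T * \<bar>z\<bar>)"
      using * A(2) by (intro mult_left_mono) auto
    then have "A * exp (a * (\<bar>y\<bar> + c + \<bar>sqrt s * z\<bar>)) \<le> A * exp (a * (C + \<bar>y\<bar> + sqrt T * \<bar>z\<bar>))"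
      using A(1) by (intro mult_left_mono) auto
    with A(3)[OF *(3), of y "sqrt s * z"] show ?thesis
      by (simp add: distrib_left exp_add mult.assoc)
  qed
  then show ?thesis using A by (intro exI[of _ "A * exp (a * C)"] exI[of _ a] conjI) auto
qed

lemma gauss_mean_integrable:
  assumes "0 \<le> s" "1 \<le> c"
  shows "integrable lborel (\<lambda>z. std_normal_density z * ev p y c (sqrt s * z))"
proof -
  obtain A a where "\<And>s' y c' z. 0 \<le> s' \<Longrightarrow> s' \<le> s \<Longrightarrow> 1 \<le> c' \<Longrightarrow> c' \<le> c \<Longrightarrow>
     \<bar>ev p y c' (sqrt s' * z)\<bar> \<le> A * exp (a * \<bar>y\<bar>) * exp (a * sqrt s * \<bar>z\<bar>)"
    using ev_scaled_bound[of s c p] by metis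
  then show ?thesis using assms
    by (intro integrable_std_normal_exp_bound[where A="A * exp (a * \<bar>y\<bar>)" and a="a * sqrt s"]) auto
qed

lemma std_normal_dominate:
  assumes "\<bar>v\<bar> \<le> A * exp (a * \<bar>z\<bar>)"
  shows "\<bar>std_normal_density z * v\<bar> \<le> A * (std_normal_density z * exp (a * \<bar>z\<bar>))"
  using mult_left_mono[OF assms normal_density_nonneg[of 0 1 z]]
  by (simp add: abs_mult mult.left_commute)

lemma gauss_mean_has_derivative_c:
  assumes s: "0 \<le> s" and c: "1 \<le> c"
  shows "((\<lambda>c. gauss_mean p s y c) has_real_derivative gauss_mean (dC p) s y c) (at c within {1..})"
proof -
  obtain A a where A: "\<And>s' y c' z. 0 \<le> s' \<Longrightarrow> s' \<le> s \<Longrightarrow> 1 \<le> c' \<Longrightarrow> c' \<le> c + 1 \<Longrightarrow>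
     \<bar>ev (dC p) y c' (sqrt s' * z)\<bar> \<le> A * exp (a * \<bar>y\<bar>) * exp (a * sqrt s * \<bar>z\<bar>)"
    using ev_scaled_bound[of s "c + 1" "dC p"] by metis
  have "((\<lambda>c. gauss_mean p s y c) has_real_derivative gauss_mean (dC p) s y c) (at c within {1..<c + 1})"
    unfolding gauss_mean_def
  proof (rule has_real_derivative_integral_dominated[where
        g="\<lambda>z. (A * exp (a * \<bar>y\<bar>)) * (std_normal_density z * exp ((a * sqrt s) * \<bar>z\<bar>))"])
    show "\<bar>std_normal_density z * ev (dC p) y c' (sqrt s * z)\<bar>
        \<le> A * exp (a * \<bar>y\<bar>) * (std_normal_density z * exp (a * sqrt s * \<bar>z\<bar>))"
      if "c' \<in> {1..<c + 1}" for z c'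
      by (rule std_normal_dominate) (use A[of s c' y z] s that in auto)
  qed (use s c in \<open>auto intro!: gauss_mean_integrable DERIV_cmult has_field_derivative_at_within[OF dC_correct]
      integrable_std_normal_exp_abs integrable_mult_right\<close>)
  moreover have "at c within {1..<c + 1} = at c within {1..}"
    by (rule at_within_nhd[where S="{..<c + 1}"]) auto
  ultimately show ?thesis by simp
qed

lemma gauss_mean_has_derivative_y:
  assumes s: "0 \<le> s" and c: "1 \<le> c"
  shows "((\<lambda>y. gauss_mean p s y c) has_real_derivative gauss_mean (dY p) s y c) (at y)"
proof -
  obtain A a where A: "A \<ge> 0" "a \<ge> 0" "\<And>s' y c' z. 0 \<le> s' \<Longrightarrow> s' \<le> s \<Longrightarrow> 1 \<le> c' \<Longrightarrow> c' \<le> c \<Longrightarrow>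
     \<bar>ev (dY p) y c' (sqrt s' * z)\<bar> \<le> A * exp (a * \<bar>y\<bar>) * exp (a * sqrt s * \<bar>z\<bar>)"
    using ev_scaled_bound[of s c "dY p"] by metis
  have "((\<lambda>y. gauss_mean p s y c) has_real_derivative gauss_mean (dY p) s y c) (at y within {y - 1<..<y + 1})"
    unfolding gauss_mean_def
  proof (rule has_real_derivative_integral_dominated[where
        g="\<lambda>z. (A * exp (a * (\<bar>y\<bar> + 1))) * (std_normal_density z * exp ((a * sqrt s) * \<bar>z\<bar>))"])
    show "\<bar>std_normal_density z * ev (dY p) y' c (sqrt s * z)\<bar>
        \<le> A * exp (a * (\<bar>y\<bar> + 1)) * (std_normal_density z * exp (a * sqrt s * \<bar>z\<bar>))"
      if "y' \<in> {y - 1<..<y + 1}" for z y'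
    proof (rule std_normal_dominate)
      have "A * exp (a * \<bar>y'\<bar>) * exp (a * sqrt s * \<bar>z\<bar>) \<le> A * exp (a * (\<bar>y\<bar> + 1)) * exp (a * sqrt s * \<bar>z\<bar>)"
        using that A(1,2) by (intro mult_right_mono mult_left_mono iffD2[OF exp_le_cancel_iff]) auto
      then show "\<bar>ev (dY p) y' c (sqrt s * z)\<bar> \<le> A * exp (a * (\<bar>y\<bar> + 1)) * exp (a * sqrt s * \<bar>z\<bar>)"
        using A(3)[of s c y' z] s c by linarith
    qed
  qed (use s c in \<open>auto intro!: gauss_mean_integrable DERIV_cmult has_field_derivative_at_within[OF dY_correct]
      integrable_std_normal_exp_abs integrable_mult_right\<close>)
  then show ?thesis using at_within_open[of y "{y - 1<..<y + 1}"] by simp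
qed

text \<open>
  The chain rule produces the factor \<open>z / (2 sqrt s)\<close>, and Gaussian integration by parts trades the
  factor \<open>z\<close> for \<open>sqrt s\<close> and one more \<open>b\<close>-derivative: the heat equation.
\<close>

lemma gauss_mean_has_derivative_s:
  assumes s: "0 < s" and c: "1 \<le> c"
  shows "((\<lambda>s. gauss_mean p s y c) has_real_derivative gauss_mean (dB (dB p)) s y c / 2) (at s)"
proof -
  obtain A a where A: "A \<ge> 0" "a \<ge> 0" "\<And>s' y c' z. 0 \<le> s' \<Longrightarrow> s' \<le> 2 * s \<Longrightarrow> 1 \<le> c' \<Longrightarrow> c' \<le> c \<Longrightarrow>
     \<bar>ev (dB p) y c' (sqrt s' * z)\<bar> \<le> A * exp (a * \<bar>y\<bar>) * exp (a * sqrt (2 * s) * \<bar>z\<bar>)"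
    using ev_scaled_bound[of "2 * s" c "dB p"] by metis
  obtain A2 a2 where A2: "A2 \<ge> 0" "a2 \<ge> 0" "\<And>s' y c' z. 0 \<le> s' \<Longrightarrow> s' \<le> s \<Longrightarrow> 1 \<le> c' \<Longrightarrow> c' \<le> c \<Longrightarrow>
     \<bar>ev (dB (dB p)) y c' (sqrt s' * z)\<bar> \<le> A2 * exp (a2 * \<bar>y\<bar>) * exp (a2 * sqrt s * \<bar>z\<bar>)"
    using ev_scaled_bound[of s c "dB (dB p)"] by metis
  \<comment> \<open>Upper bound of \<open>1 / (2 sqrt s')\<close> for \<open>s' > s / 2\<close>; staying away from \<open>0\<close> keeps this factor bounded.\<close>
  define K where "K = 1 / (2 * sqrt (s / 2))"
  define E where "E = A * exp (a * \<bar>y\<bar>)"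
  define h where "h = a * sqrt (2 * s)"
  have E0: "0 \<le> E" unfolding E_def using A by simp
  have Ev: "\<bar>ev (dB p) y c (sqrt s' * z)\<bar> \<le> E * exp (h * \<bar>z\<bar>)" if "0 \<le> s'" "s' \<le> 2 * s" for s' z
    using A(3)[of s' c y z] that c by (simp add: E_def h_def)
  have "((\<lambda>s. gauss_mean p s y c) has_real_derivative
      (LINT z|lborel. std_normal_density z * (z * ev (dB p) y c (sqrt s * z) / (2 * sqrt s))))
      (at s within {s / 2<..<2 * s})"
    unfolding gauss_mean_def
  proof (rule has_real_derivative_integral_dominated[where
        g="\<lambda>z. (K * E) * (std_normal_density z * exp ((h + 1) * \<bar>z\<bar>))"])
    fix z s' :: real assume s': "s' \<in> {s / 2<..<2 * s}"
    show "\<bar>std_normal_density z * (z * ev (dB p) y c (sqrt s' * z) / (2 * sqrt s'))\<bar>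
        \<le> (K * E) * (std_normal_density z * exp ((h + 1) * \<bar>z\<bar>))"
    proof (rule std_normal_dominate)
      have "1 / (2 * sqrt s') \<le> K"
        unfolding K_def using s s' by (intro divide_left_mono) auto
      moreover have "\<bar>z\<bar> \<le> exp \<bar>z\<bar>" using exp_ge_add_one_self[of "\<bar>z\<bar>"] by linarith
      ultimately have "(1 / (2 * sqrt s')) * (\<bar>z\<bar> * \<bar>ev (dB p) y c (sqrt s' * z)\<bar>)
          \<le> K * (exp \<bar>z\<bar> * (E * exp (h * \<bar>z\<bar>)))"
        using s s' E0 by (intro mult_mono Ev) (auto simp: K_def)
      moreover have "K * (exp \<bar>z\<bar> * (E * exp (h * \<bar>z\<bar>))) = K * E * exp ((h + 1) * \<bar>z\<bar>)"
        by (simp add: exp_add distrib_right)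
      moreover have "\<bar>z * ev (dB p) y c (sqrt s' * z) / (2 * sqrt s')\<bar> =
          (1 / (2 * sqrt s')) * (\<bar>z\<bar> * \<bar>ev (dB p) y c (sqrt s' * z)\<bar>)"
        using s s' by (simp add: abs_mult)
      ultimately show "\<bar>z * ev (dB p) y c (sqrt s' * z) / (2 * sqrt s')\<bar> \<le> K * E * exp ((h + 1) * \<bar>z\<bar>)"
        by linarith
    qed
    have "((\<lambda>s. ev p y c (sqrt s * z)) has_real_derivative
        ev (dB p) y c (sqrt s' * z) * (inverse (sqrt s') / 2 * z)) (at s')"
      using s s' by (intro DERIV_chain2[OF dB_correct] DERIV_cmult_right DERIV_real_sqrt) auto
    moreover have "v * (inverse r / 2 * z) = z * v / (2 * r)" for v r :: real
      by (simp add: inverse_eq_divide mult.commute)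
    ultimately have "((\<lambda>s. ev p y c (sqrt s * z)) has_real_derivative
        z * ev (dB p) y c (sqrt s' * z) / (2 * sqrt s')) (at s')"
      by (simp only:)
    from DERIV_cmult[OF has_field_derivative_at_within[OF this]]
    show "((\<lambda>s. std_normal_density z * ev p y c (sqrt s * z)) has_real_derivative
        std_normal_density z * (z * ev (dB p) y c (sqrt s' * z) / (2 * sqrt s'))) (at s' within {s / 2<..<2 * s})" .
  qed (use s c in \<open>auto intro!: gauss_mean_integrable integrable_std_normal_exp_abs integrable_mult_right\<close>)
  moreover have "at s within {s / 2<..<2 * s} = at s" using s by (intro at_within_open) auto
  moreover have "(LINT z|lborel. std_normal_density z * (z * ev (dB p) y c (sqrt s * z) / (2 * sqrt s)))
      = gauss_mean (dB (dB p)) s y c / 2"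
  proof -
    have "(LINT z|lborel. std_normal_density z * (z * ev (dB p) y c (sqrt s * z))) =
       (LINT z|lborel. std_normal_density z * (sqrt s * ev (dB (dB p)) y c (sqrt s * z)))"
    proof (rule std_normal_integration_by_parts[where A=E and a=h
          and A'="sqrt s * (A2 * exp (a2 * \<bar>y\<bar>))" and a'="a2 * sqrt s"])
      show "((\<lambda>z. ev (dB p) y c (sqrt s * z)) has_real_derivative sqrt s * ev (dB (dB p)) y c (sqrt s * z)) (at z)" for z
      proof -
        have "((\<lambda>z. sqrt s * z) has_real_derivative sqrt s) (at z)"
          using DERIV_cmult_Id[of "sqrt s"] .
        from DERIV_chain2[OF dB_correct this, of "dB p" y c] show ?thesis by (simp add: mult.commute)
      qed
      show "\<bar>ev (dB p) y c (sqrt s * z)\<bar> \<le> E * exp (h * \<bar>z\<bar>)" for z using Ev[of s z] s by simp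
      show "\<bar>sqrt s * ev (dB (dB p)) y c (sqrt s * z)\<bar> \<le> sqrt s * (A2 * exp (a2 * \<bar>y\<bar>)) * exp (a2 * sqrt s * \<bar>z\<bar>)" for z
        using A2(3)[of s c y z] s c by (simp add: abs_mult mult.assoc)
    qed (intro continuous_intros)
    also have "\<dots> = sqrt s * gauss_mean (dB (dB p)) s y c"
      unfolding gauss_mean_def by (simp add: mult.left_commute[of _ "sqrt s"])
    finally have "(LINT z|lborel. std_normal_density z * (z * ev (dB p) y c (sqrt s * z))) / (2 * sqrt s)
       = gauss_mean (dB (dB p)) s y c / 2" using s by simp
    then show ?thesis by (simp only: times_divide_eq_right integral_divide_zero)
  qed
  ultimately show ?thesis by (simp only:)
qed

lemma gauss_mean_continuous:
  assumes c: "1 \<le> c"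
  shows "continuous_on ({0..T} \<times> {-Y..Y}) (\<lambda>(s, y). gauss_mean p s y c)"
proof -
  obtain A a where A: "A \<ge> 0" "a \<ge> 0" "\<And>s y c' z. 0 \<le> s \<Longrightarrow> s \<le> T \<Longrightarrow> 1 \<le> c' \<Longrightarrow> c' \<le> c \<Longrightarrow>
     \<bar>ev p y c' (sqrt s * z)\<bar> \<le> A * exp (a * \<bar>y\<bar>) * exp (a * sqrt T * \<bar>z\<bar>)"
    using ev_scaled_bound[of T c p] by metis
  have "continuous_on ({0..T} \<times> {-Y..Y})
     (\<lambda>x. LINT z|lborel. std_normal_density z * ev p (snd x) c (sqrt (fst x) * z))"
  proof (rule continuous_on_integral_dominated[where
        g="\<lambda>z. (A * exp (a * Y)) * (std_normal_density z * exp ((a * sqrt T) * \<bar>z\<bar>))"])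
    show "AE z in lborel. \<bar>std_normal_density z * ev p (snd x) c (sqrt (fst x) * z)\<bar>
        \<le> (A * exp (a * Y)) * (std_normal_density z * exp ((a * sqrt T) * \<bar>z\<bar>))"
      if "x \<in> {0..T} \<times> {-Y..Y}" for x
    proof (intro AE_I2 std_normal_dominate)
      fix z :: real
      have "A * exp (a * \<bar>snd x\<bar>) * exp (a * sqrt T * \<bar>z\<bar>) \<le> A * exp (a * Y) * exp (a * sqrt T * \<bar>z\<bar>)"
        using that A(1,2) by (intro mult_right_mono mult_left_mono iffD2[OF exp_le_cancel_iff]) auto
      then show "\<bar>ev p (snd x) c (sqrt (fst x) * z)\<bar> \<le> A * exp (a * Y) * exp (a * sqrt T * \<bar>z\<bar>)"
        using A(3)[of "fst x" c "snd x" z] that c by auto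
    qed
  qed (auto intro!: AE_I2 continuous_intros integrable_std_normal_exp_abs integrable_mult_right)
  then show ?thesis by (simp add: gauss_mean_def case_prod_beta')
qed

lemma gauss_mean_growth:
  assumes c: "1 \<le> c"
  shows "\<exists>A a. \<forall>s y. 0 \<le> s \<longrightarrow> s \<le> T \<longrightarrow> \<bar>gauss_mean p s y c\<bar> \<le> A * exp (a * \<bar>y\<bar>)"
proof -
  obtain A a where A: "A \<ge> 0" "a \<ge> 0" "\<And>s y c' z. 0 \<le> s \<Longrightarrow> s \<le> T \<Longrightarrow> 1 \<le> c' \<Longrightarrow> c' \<le> c \<Longrightarrow>
     \<bar>ev p y c' (sqrt s * z)\<bar> \<le> A * exp (a * \<bar>y\<bar>) * exp (a * sqrt T * \<bar>z\<bar>)"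
    using ev_scaled_bound[of T c p] by metis
  define I where "I = (LINT z|lborel. std_normal_density z * exp ((a * sqrt T) * \<bar>z\<bar>))"
  have "\<bar>gauss_mean p s y c\<bar> \<le> A * I * exp (a * \<bar>y\<bar>)" if s: "0 \<le> s" "s \<le> T" for s y
  proof -
    have "norm (gauss_mean p s y c) \<le> (LINT z|lborel. (A * exp (a * \<bar>y\<bar>)) * (std_normal_density z * exp ((a * sqrt T) * \<bar>z\<bar>)))"
      unfolding gauss_mean_def
    proof (rule Bochner_Integration.integral_norm_bound_integral)
      fix z :: real
      show "norm (std_normal_density z * ev p y c (sqrt s * z))
          \<le> (A * exp (a * \<bar>y\<bar>)) * (std_normal_density z * exp ((a * sqrt T) * \<bar>z\<bar>))"
        unfolding real_norm_def by (rule std_normal_dominate) (use A(3)[of s c y z] s c in auto)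
    qed (use s c in \<open>auto intro!: gauss_mean_integrable integrable_std_normal_exp_abs integrable_mult_right\<close>)
    also have "\<dots> = (A * exp (a * \<bar>y\<bar>)) * I" unfolding I_def by (rule integral_mult_right_zero)
    finally show ?thesis by (simp add: mult_ac)
  qed
  then show ?thesis by blast
qed

text \<open>
  At \<open>b = 0\<close> the function \<open>H 0\<close> is \<open>exp (- lam c)\<close>, which is differentiated in \<open>c\<close>.
\<close>

lemma ev_dC_H0_at_0: "ev ((dC ^^ k) (H 0)) y c 0 = (- exp y) ^ k * exp (- (exp y * c))"
proof (induction k arbitrary: c)
  case 0
  have "cosh_sqrt_deriv 0 0 = 1" using cosh_sqrt_deriv_0_square[of 0] by simp
  then show ?case by simp
next
  case (Suc k)
  have "((\<lambda>c. ev ((dC ^^ k) (H 0)) y c 0) has_real_derivative (- exp y) ^ Suc k * exp (- (exp y * c))) (at c)"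
    unfolding Suc by (auto intro!: derivative_eq_intros)
  from DERIV_unique[OF dC_correct this] show ?case by simp
qed

lemma gauss_mean_initial: "gauss_mean ((dC ^^ k) (H 0)) 0 y c = (- exp y) ^ k * exp (- (exp y * c))"
  using integral_std_normal_moment_even[of 0]
  by (simp add: gauss_mean_def ev_dC_H0_at_0)

lemma gauss_mean_equation:
  assumes "0 < s" "1 \<le> c"
  shows "((\<lambda>s. gauss_mean ((dC ^^ k) (H 0)) s y c) has_real_derivative
    (gauss_mean (dY (dY ((dC ^^ k) (H 0)))) s y c - (exp y)\<^sup>2 * gauss_mean ((dC ^^ k) (H 0)) s y c) / 2) (at s)"
proof -
  let ?p = "(dC ^^ k) (H 0)"
  have "gauss_mean (dB (dB ?p)) s y c = (LINT z|lborel. std_normal_density z * ev (dY (dY ?p)) y c (sqrt s * z)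
      - (exp y)\<^sup>2 * (std_normal_density z * ev ?p y c (sqrt s * z)))"
    unfolding gauss_mean_def dC_H0_equation
    by (intro Bochner_Integration.integral_cong refl) (simp add: algebra_simps power2_eq_square)
  also have "\<dots> = gauss_mean (dY (dY ?p)) s y c - (exp y)\<^sup>2 * gauss_mean ?p s y c"
    unfolding gauss_mean_def using assms
    by (subst Bochner_Integration.integral_diff) (auto intro!: gauss_mean_integrable integrable_mult_right)
  finally show ?thesis using gauss_mean_has_derivative_s[OF assms, of ?p y] by simp
qed

section \<open>Uniqueness for the evolution equation\<close>

lemma second_derivative_nonpos_at_max:
  fixes f f' :: "real \<Rightarrow> real"
  assumes f: "\<And>y. (f has_real_derivative f' y) (at y)"
    and f': "(f' has_real_derivative f'') (at x)"
    and "0 < \<delta>" and max: "\<And>y. \<bar>x - y\<bar> < \<delta> \<Longrightarrow> f y \<le> f x"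
  shows "f'' \<le> 0"
proof (rule ccontr)
  assume "\<not> f'' \<le> 0"
  then obtain e where e: "0 < e" "\<And>h. 0 < h \<Longrightarrow> h < e \<Longrightarrow> f' x < f' (x + h)"
    using DERIV_pos_inc_right[OF f'] by force
  have f'x: "f' x = 0"
    using DERIV_local_max[OF f \<open>0 < \<delta>\<close>] max by blast
  define h where "h = min e \<delta> / 2"
  have h: "0 < h" "h < e" "h < \<delta>" using e(1) \<open>0 < \<delta>\<close> unfolding h_def by linarith+
  obtain z where z: "x < z" "z < x + h" "f (x + h) - f x = (x + h - x) * f' z"
    using MVT2[of x "x + h" f f'] h(1) f by auto
  have "0 < f' z" using e(2)[of "z - x"] z h f'x by simp
  then have "f x < f (x + h)" using z(3) mult_pos_pos[OF h(1), of "f' z"] by (simp add: algebra_simps)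
  moreover have "f (x + h) \<le> f x" using max[of "x + h"] h by simp
  ultimately show False by simp
qed

text \<open>
  The barrier \<open>exp (M\<^sup>2 s) cosh (M y)\<close> grows faster in \<open>y\<close> than \<open>d\<close> does and is a strict supersolution.
  Subtracting a small multiple of it forces a positive maximum to be attained in the interior of a
  bounded rectangle or at its final time, where the equation is violated.
\<close>

lemma schroedinger_maximum_principle:
  fixes d dy dyy :: "real \<Rightarrow> real \<Rightarrow> real"
  assumes cont: "\<And>Y. continuous_on ({0..T} \<times> {-Y..Y}) (\<lambda>(s, y). d s y)"
    and init: "\<And>y. d 0 y = 0"
    and dy: "\<And>s y. 0 < s \<Longrightarrow> ((\<lambda>y. d s y) has_real_derivative dy s y) (at y)"
    and dyy: "\<And>s y. 0 < s \<Longrightarrow> ((\<lambda>y. dy s y) has_real_derivative dyy s y) (at y)"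
    and eq: "\<And>s y. 0 < s \<Longrightarrow> ((\<lambda>s. d s y) has_real_derivative (dyy s y - (exp y)\<^sup>2 * d s y) / 2) (at s)"
    and growth: "\<And>s y. 0 \<le> s \<Longrightarrow> s \<le> T \<Longrightarrow> \<bar>d s y\<bar> \<le> A * exp (a * \<bar>y\<bar>)"
    and s1: "0 \<le> s1" "s1 \<le> T"
  shows "d s1 y1 \<le> 0"
proof (rule ccontr)
  assume "\<not> d s1 y1 \<le> 0"
  then have pos: "0 < d s1 y1" by simp
  have A: "0 \<le> A" using growth[OF s1, of 0] by simp
  \<comment> \<open>The rate exceeds the growth rate of \<open>d\<close>.  In time the barrier grows at rate \<open>M\<^sup>2\<close>,
      twice the rate \<open>M\<^sup>2 / 2\<close> that \<open>1/2 \<partial>\<^sub>y\<^sup>2\<close> assigns to \<open>cosh (M y)\<close>.\<close>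
  define M where "M = \<bar>a\<bar> + 1"
  define W where "W s y = exp (M\<^sup>2 * s) * cosh (M * y)" for s y :: real
  have W_pos: "0 < W s y" for s y by (simp add: W_def)
  define \<epsilon> where "\<epsilon> = d s1 y1 / (2 * W s1 y1)"
  have \<epsilon>: "0 < \<epsilon>" using pos W_pos[of s1 y1] by (simp add: \<epsilon>_def)
  define v where "v s y = d s y - \<epsilon> * W s y" for s y
  have v1: "0 < v s1 y1" using pos W_pos[of s1 y1] by (simp add: v_def \<epsilon>_def)
  \<comment> \<open>For \<open>\<bar>y\<bar> \<ge> Y\<close> the barrier beats the growth bound, since \<open>cosh (M y) \<ge> exp (\<bar>a\<bar> \<bar>y\<bar>) exp \<bar>y\<bar> / 2\<close>
      and \<open>exp \<bar>y\<bar> > 2 A / \<epsilon>\<close>.\<close>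
  define Y where "Y = max \<bar>y1\<bar> (2 * A / \<epsilon>)"
  have out: "v s y < 0" if s: "0 \<le> s" "s \<le> T" and y: "Y \<le> \<bar>y\<bar>" for s y
  proof -
    have "2 * A / \<epsilon> < exp \<bar>y\<bar>"
      using y exp_ge_add_one_self[of "\<bar>y\<bar>"] unfolding Y_def by linarith
    then have "A < \<epsilon> * (exp \<bar>y\<bar> / 2)" using \<epsilon> by (simp add: field_simps)
    then have "A * exp (\<bar>a\<bar> * \<bar>y\<bar>) < \<epsilon> * (exp \<bar>y\<bar> / 2) * exp (\<bar>a\<bar> * \<bar>y\<bar>)" by simp
    also have "\<dots> = \<epsilon> * (exp (M * \<bar>y\<bar>) / 2)" by (simp add: M_def distrib_right exp_add)
    also have "\<dots> \<le> \<epsilon> * cosh (M * y)"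
    proof -
      have "exp (M * \<bar>y\<bar>) / 2 \<le> cosh (M * \<bar>y\<bar>)" by (simp add: cosh_def)
      also have "\<dots> = cosh (M * y)" by (simp add: abs_if)
      finally show ?thesis using \<epsilon> by (intro mult_left_mono) auto
    qed
    also have "\<dots> \<le> \<epsilon> * W s y"
    proof -
      have "1 * cosh (M * y) \<le> W s y" unfolding W_def using s by (intro mult_right_mono) auto
      then show ?thesis using \<epsilon> by (intro mult_left_mono) auto
    qed
    finally have "A * exp (\<bar>a\<bar> * \<bar>y\<bar>) < \<epsilon> * W s y" .
    moreover have "A * exp (a * \<bar>y\<bar>) \<le> A * exp (\<bar>a\<bar> * \<bar>y\<bar>)"
      using A by (intro mult_left_mono) (auto intro!: mult_right_mono)
    ultimately show ?thesis using growth[OF s, of y] unfolding v_def by linarith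
  qed
  have "continuous_on ({0..T} \<times> {-Y..Y}) (\<lambda>x. \<epsilon> * W (fst x) (snd x))"
    unfolding W_def by (intro continuous_intros)
  from continuous_on_diff[OF cont[of Y] this]
  have contv: "continuous_on ({0..T} \<times> {-Y..Y}) (\<lambda>(s, y). v s y)"
    by (simp add: v_def case_prod_beta')
  have in1: "(s1, y1) \<in> {0..T} \<times> {-Y..Y}" using s1 by (auto simp: Y_def)
  obtain s0 y0 where 0: "(s0, y0) \<in> {0..T} \<times> {-Y..Y}"
    and max: "\<And>s y. (s, y) \<in> {0..T} \<times> {-Y..Y} \<Longrightarrow> v s y \<le> v s0 y0"
    using continuous_attains_sup[OF _ _ contv] in1 by (fastforce intro: compact_Times)
  have v0: "0 < v s0 y0" using max[OF in1] v1 by simp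
  have s0: "0 < s0" "s0 \<le> T"
  proof -
    have "s0 \<noteq> 0"
    proof
      assume "s0 = 0"
      then have "v s0 y0 < 0" using \<epsilon> W_pos[of 0 y0] by (simp add: v_def init)
      with v0 show False by simp
    qed
    then show "0 < s0" "s0 \<le> T" using 0 by auto
  qed
  have y0: "\<bar>y0\<bar> < Y" using out[of s0 y0] s0 v0 by (meson less_asym' less_imp_le not_le)
  \<comment> \<open>At the maximum, \<open>\<partial>\<^sub>y\<^sup>2 v \<le> 0\<close> while \<open>v > 0\<close>; the equation then makes the time
      derivative \<open>D\<close> negative, so \<open>v\<close> was larger just before.\<close>
  have "dyy s0 y0 - \<epsilon> * (exp (M\<^sup>2 * s0) * (cosh (M * y0) * M * M)) \<le> 0"
  proof (rule second_derivative_nonpos_at_max[where f="v s0" and x=y0 and \<delta>="Y - \<bar>y0\<bar>"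
        and f'="\<lambda>y. dy s0 y - \<epsilon> * (exp (M\<^sup>2 * s0) * (sinh (M * y) * M))"])
    show "(v s0 has_real_derivative dy s0 y - \<epsilon> * (exp (M\<^sup>2 * s0) * (sinh (M * y) * M))) (at y)" for y
      unfolding v_def W_def by (auto intro!: derivative_eq_intros dy s0)
    show "((\<lambda>y. dy s0 y - \<epsilon> * (exp (M\<^sup>2 * s0) * (sinh (M * y) * M))) has_real_derivative
       dyy s0 y0 - \<epsilon> * (exp (M\<^sup>2 * s0) * (cosh (M * y0) * M * M))) (at y0)"
      by (auto intro!: derivative_eq_intros dyy s0)
    show "v s0 y \<le> v s0 y0" if "\<bar>y0 - y\<bar> < Y - \<bar>y0\<bar>" for y
      using that s0 by (intro max) auto
  qed (use y0 in auto)
  then have "dyy s0 y0 \<le> \<epsilon> * M\<^sup>2 * W s0 y0" by (simp add: W_def power2_eq_square mult_ac)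
  define D where "D = (dyy s0 y0 - (exp y0)\<^sup>2 * d s0 y0) / 2 - \<epsilon> * M\<^sup>2 * W s0 y0"
  have "0 < (exp y0)\<^sup>2 * d s0 y0"
    using v0 mult_pos_pos[OF \<epsilon> W_pos[of s0 y0]] by (intro mult_pos_pos) (auto simp: v_def)
  moreover have "0 < \<epsilon> * M\<^sup>2 * W s0 y0" using \<epsilon> W_pos by (auto simp: M_def intro!: mult_pos_pos)
  moreover have "(u - q) / 2 - r < 0" if "0 < q" "0 < r" "u \<le> r" for u q r :: real
    using that by (simp add: field_simps)
  ultimately have "D < 0" using \<open>dyy s0 y0 \<le> _\<close> unfolding D_def by blast
  moreover have "((\<lambda>s. v s y0) has_real_derivative D) (at s0)"
    unfolding v_def W_def D_def by (auto intro!: derivative_eq_intros eq s0 simp: mult_ac)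
  ultimately obtain e where e: "0 < e" "\<And>h. 0 < h \<Longrightarrow> h < e \<Longrightarrow> v s0 y0 < v (s0 - h) y0"
    using DERIV_neg_dec_left by blast
  have "v s0 y0 < v (s0 - min e s0 / 2) y0" using e s0 by (intro e(2)) linarith+
  moreover have "v (s0 - min e s0 / 2) y0 \<le> v s0 y0"
    using 0 s0 e(1) by (intro max) auto
  ultimately show False by simp
qed

lemma schroedinger_unique:
  fixes d dy dyy :: "real \<Rightarrow> real \<Rightarrow> real"
  assumes cont: "\<And>Y. continuous_on ({0..T} \<times> {-Y..Y}) (\<lambda>(s, y). d s y)"
    and init: "\<And>y. d 0 y = 0"
    and dy: "\<And>s y. 0 < s \<Longrightarrow> ((\<lambda>y. d s y) has_real_derivative dy s y) (at y)"
    and dyy: "\<And>s y. 0 < s \<Longrightarrow> ((\<lambda>y. dy s y) has_real_derivative dyy s y) (at y)"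
    and eq: "\<And>s y. 0 < s \<Longrightarrow> ((\<lambda>s. d s y) has_real_derivative (dyy s y - (exp y)\<^sup>2 * d s y) / 2) (at s)"
    and growth: "\<And>s y. 0 \<le> s \<Longrightarrow> s \<le> T \<Longrightarrow> \<bar>d s y\<bar> \<le> A * exp (a * \<bar>y\<bar>)"
    and s: "0 \<le> s" "s \<le> T"
  shows "d s y = 0"
proof (rule antisym)
  show "d s y \<le> 0" using assms by (rule schroedinger_maximum_principle)
  have "- d s y \<le> 0"
  proof (rule schroedinger_maximum_principle[where d="\<lambda>s y. - d s y" and dy="\<lambda>s y. - dy s y"
        and dyy="\<lambda>s y. - dyy s y" and T=T and A=A and a=a])
    show "continuous_on ({0..T} \<times> {-Y..Y}) (\<lambda>(s, y). - d s y)" for Y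
      using continuous_on_minus[OF cont[of Y]] by (simp add: case_prod_beta')
    show "((\<lambda>s. - d s y) has_real_derivative (- dyy s y - (exp y)\<^sup>2 * - d s y) / 2) (at s)" if "0 < s" for s y
      using DERIV_minus[OF eq[OF that, of y]] by (simp add: diff_divide_distrib)
  qed (use assms in \<open>auto intro!: DERIV_minus\<close>)
  then show "0 \<le> d s y" by simp
qed

section \<open>Limits of Riemann and Stieltjes sums\<close>

lemma set_integral_Icc_self [simp]: "(LINT u:{p..p}|lborel. h u) = (0 :: real)" for p :: real
proof -
  have "AE u in lborel. indicator {p..p} u *\<^sub>R h u = 0"
    using AE_lborel_singleton[of p] by eventually_elim simp
  then show ?thesis unfolding set_lebesgue_integral_def by (rule integral_eq_zero_AE)
qed

lemma set_integral_diff_Icc: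
  fixes h :: "real \<Rightarrow> real"
  assumes "set_integrable lborel {0..t} h" "0 \<le> p" "p \<le> q" "q \<le> t"
  shows "(LINT u:{0..q}|lborel. h u) - (LINT u:{0..p}|lborel. h u) = (LINT u:{p<..q}|lborel. h u)"
    and "set_integrable lborel {p<..q} h"
proof -
  have i: "set_integrable lborel {0..p} h" "set_integrable lborel {p<..q} h"
    by (rule set_integrable_subset[OF assms(1)]; use assms in auto)+
  have "{0..q} = {0..p} \<union> {p<..q}" using assms by auto
  then have "(LINT u:{0..q}|lborel. h u) = (LINT u:{0..p}|lborel. h u) + (LINT u:{p<..q}|lborel. h u)"
    using set_integral_Un[OF _ i] by force
  then show "(LINT u:{0..q}|lborel. h u) - (LINT u:{0..p}|lborel. h u) = (LINT u:{p<..q}|lborel. h u)" by simp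
  show "set_integrable lborel {p<..q} h" by (rule i)
qed

lemma grid_bounds:
  assumes "0 < t" "i < n"
  shows "0 \<le> real i * t / real n" "real i * t / real n \<le> real (Suc i) * t / real n" "real (Suc i) * t / real n \<le> t"
proof -
  have "0 < real n" using assms by simp
  then show "real (Suc i) * t / real n \<le> t"
    using assms mult_right_mono[of "real (Suc i)" "real n" t] by (simp add: divide_le_eq mult.commute)
  show "0 \<le> real i * t / real n" "real i * t / real n \<le> real (Suc i) * t / real n"
    using assms by (auto intro!: divide_right_mono mult_right_mono)
qed

text \<open>
  On the grid with mesh \<open>t / n\<close>, a sum \<open>\<Sum> c\<^sub>i \<Delta>A\<^sub>i\<close> against an absolutely continuous nondecreasing \<open>A\<close>
  converges to \<open>\<integral> \<phi> dA\<close> as soon as \<open>c\<^sub>i\<close> is uniformly close to \<open>\<phi>\<close> on the \<open>i\<close>-th cell.  In this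
  generality \<open>c\<^sub>i\<close> may be a derivative at a nearby point supplied by the mean value theorem.
\<close>

lemma stieltjes_sum_tendsto:
  fixes \<phi> \<alpha> A :: "real \<Rightarrow> real" and c :: "nat \<Rightarrow> nat \<Rightarrow> real"
  assumes t: "0 < t" and \<alpha>0: "\<And>u. u \<in> {0..t} \<Longrightarrow> 0 \<le> \<alpha> u"
    and int\<alpha>: "set_integrable lborel {0..t} \<alpha>"
    and A: "\<And>s. s \<in> {0..t} \<Longrightarrow> A s = (LINT u:{0..s}|lborel. \<alpha> u)"
    and int\<phi>: "set_integrable lborel {0..t} (\<lambda>u. \<phi> u * \<alpha> u)"
    and close: "\<And>\<epsilon>. 0 < \<epsilon> \<Longrightarrow> \<exists>N. \<forall>n\<ge>N. \<forall>i<n. \<forall>u\<in>{real i * t / real n..real (Suc i) * t / real n}. \<bar>c n i - \<phi> u\<bar> \<le> \<epsilon>"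
  shows "(\<lambda>n. \<Sum>i<n. c n i * (A (real (Suc i) * t / real n) - A (real i * t / real n)))
    \<longlonglongrightarrow> (LINT u:{0..t}|lborel. \<phi> u * \<alpha> u)"
proof (rule LIMSEQ_I)
  fix \<epsilon> :: real assume \<epsilon>: "0 < \<epsilon>"
  define G where "G s = (LINT u:{0..s}|lborel. \<phi> u * \<alpha> u)" for s
  have A0: "A 0 = 0" using A[of 0] t by (simp del: atLeastAtMost_singleton)
  have G0: "G 0 = 0" by (simp add: G_def del: atLeastAtMost_singleton)
  have At: "0 \<le> A t"
    using A[of t] t \<alpha>0 unfolding set_lebesgue_integral_def
    by (auto intro!: Bochner_Integration.integral_nonneg simp: indicator_def)
  define e where "e = \<epsilon> / (2 * (A t + 1))"
  have e: "0 < e" using \<epsilon> At by (simp add: e_def)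
  obtain N where N: "\<And>n i u. N \<le> n \<Longrightarrow> i < n \<Longrightarrow> u \<in> {real i * t / real n..real (Suc i) * t / real n} \<Longrightarrow> \<bar>c n i - \<phi> u\<bar> \<le> e"
    using close[OF e] by blast
  have piece: "\<bar>k * (A q - A p) - (G q - G p)\<bar> \<le> e * (A q - A p)"
    if pq: "0 \<le> p" "p \<le> q" "q \<le> t" and k: "\<And>u. u \<in> {p..q} \<Longrightarrow> \<bar>k - \<phi> u\<bar> \<le> e" for p q k
  proof -
    note dA = set_integral_diff_Icc[OF int\<alpha> pq]
    note dG = set_integral_diff_Icc[OF int\<phi> pq]
    have Aqp: "A q - A p = (LINT u:{p<..q}|lborel. \<alpha> u)" using A[of p] A[of q] pq dA by auto
    have "k * (A q - A p) - (G q - G p) = (LINT u:{p<..q}|lborel. k * \<alpha> u) - (LINT u:{p<..q}|lborel. \<phi> u * \<alpha> u)"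
      unfolding Aqp using dG by (simp add: G_def)
    also have "\<dots> = (LINT u:{p<..q}|lborel. k * \<alpha> u - \<phi> u * \<alpha> u)"
      using dA dG by (intro set_integral_diff(2)[symmetric]) auto
    finally have eq: "k * (A q - A p) - (G q - G p) = (LINT u:{p<..q}|lborel. k * \<alpha> u - \<phi> u * \<alpha> u)" .
    have "norm (LINT u:{p<..q}|lborel. k * \<alpha> u - \<phi> u * \<alpha> u) \<le> (LINT u|lborel. indicator {p<..q} u *\<^sub>R (e * \<alpha> u))"
      unfolding set_lebesgue_integral_def
    proof (rule Bochner_Integration.integral_norm_bound_integral)
      show "integrable lborel (\<lambda>u. indicator {p<..q} u *\<^sub>R (k * \<alpha> u - \<phi> u * \<alpha> u))"
        using set_integral_diff(1)[OF set_integrable_mult_right[of k] , of lborel "{p<..q}" \<alpha> "\<lambda>u. \<phi> u * \<alpha> u"] dA(2) dG(2)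
        by (simp add: set_integrable_def)
      show "integrable lborel (\<lambda>u. indicator {p<..q} u *\<^sub>R (e * \<alpha> u))"
        using set_integrable_mult_right[of e lborel "{p<..q}" \<alpha>] dA(2) by (simp add: set_integrable_def)
      fix u :: real
      show "norm (indicator {p<..q} u *\<^sub>R (k * \<alpha> u - \<phi> u * \<alpha> u)) \<le> indicator {p<..q} u *\<^sub>R (e * \<alpha> u)"
      proof (cases "u \<in> {p<..q}")
        case True
        then have "\<bar>k - \<phi> u\<bar> * \<alpha> u \<le> e * \<alpha> u" "0 \<le> \<alpha> u" using k[of u] \<alpha>0[of u] pq by (auto intro!: mult_right_mono)
        then show ?thesis using True by (simp add: abs_mult flip: left_diff_distrib)
      qed simp
    qed
    also have "\<dots> = e * (A q - A p)"
      unfolding Aqp set_lebesgue_integral_def by (simp add: mult.left_commute)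
    finally show ?thesis by (simp add: eq)
  qed
  show "\<exists>no. \<forall>n\<ge>no. norm ((\<Sum>i<n. c n i * (A (real (Suc i) * t / real n) - A (real i * t / real n)))
       - (LINT u:{0..t}|lborel. \<phi> u * \<alpha> u)) < \<epsilon>"
  proof (intro exI[of _ "Suc N"] allI impI)
    fix n assume n: "Suc N \<le> n"
    define s where "s i = real i * t / real n" for i
    have s0: "s 0 = 0" and sn: "s n = t" using n by (auto simp: s_def)
    have "(LINT u:{0..t}|lborel. \<phi> u * \<alpha> u) = (\<Sum>i<n. G (s (Suc i)) - G (s i))"
      unfolding sum_lessThan_telescope[of "\<lambda>i. G (s i)" n] s0 sn G0 by (simp add: G_def)
    then have "(\<Sum>i<n. c n i * (A (s (Suc i)) - A (s i))) - (LINT u:{0..t}|lborel. \<phi> u * \<alpha> u)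
        = (\<Sum>i<n. c n i * (A (s (Suc i)) - A (s i)) - (G (s (Suc i)) - G (s i)))"
      by (simp add: sum_subtractf)
    also have "norm \<dots> \<le> (\<Sum>i<n. e * (A (s (Suc i)) - A (s i)))"
    proof (rule sum_norm_le)
      fix i assume i: "i \<in> {..<n}"
      show "norm (c n i * (A (s (Suc i)) - A (s i)) - (G (s (Suc i)) - G (s i))) \<le> e * (A (s (Suc i)) - A (s i))"
        unfolding real_norm_def
        by (rule piece) (use i n grid_bounds[OF t, of i n] N[of n i] in \<open>auto simp: s_def\<close>)
    qed
    also have "\<dots> = e * (\<Sum>i<n. A (s (Suc i)) - A (s i))" by (simp add: sum_distrib_left)
    also have "\<dots> = e * A t"
      unfolding sum_lessThan_telescope[of "\<lambda>i. A (s i)" n] by (simp add: s0 sn A0)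
    also have "\<dots> < \<epsilon>"
    proof -
      have "e * A t = \<epsilon> * (A t / (2 * (A t + 1)))" by (simp add: e_def)
      also have "\<dots> < \<epsilon> * 1" using \<epsilon> At by (intro mult_strict_left_mono) (auto simp: divide_less_eq)
      finally show ?thesis by simp
    qed
    finally show "norm ((\<Sum>i<n. c n i * (A (real (Suc i) * t / real n) - A (real i * t / real n)))
       - (LINT u:{0..t}|lborel. \<phi> u * \<alpha> u)) < \<epsilon>" by (simp only: s_def)
  qed
qed

lemma uniformly_close_on_grid:
  fixes \<psi> :: "real \<Rightarrow> real"
  assumes t: "0 < t" and cont: "continuous_on {0..t} \<psi>" and \<epsilon>: "0 < \<epsilon>"
  shows "\<exists>N. \<forall>n\<ge>N. \<forall>i<n. \<forall>u\<in>{real i * t / real n..real (Suc i) * t / real n}.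
     \<forall>v\<in>{real i * t / real n..real (Suc i) * t / real n}. \<bar>\<psi> u - \<psi> v\<bar> \<le> \<epsilon>"
proof -
  have "uniformly_continuous_on {0..t} \<psi>"
    using cont by (intro compact_uniformly_continuous) auto
  then obtain \<delta> where \<delta>: "0 < \<delta>" "\<And>u v. u \<in> {0..t} \<Longrightarrow> v \<in> {0..t} \<Longrightarrow> dist v u < \<delta> \<Longrightarrow> dist (\<psi> v) (\<psi> u) < \<epsilon>"
    using \<epsilon> unfolding uniformly_continuous_on_def by metis
  obtain N :: nat where N: "t / \<delta> < real N" using reals_Archimedean2 by blast
  have "\<bar>\<psi> u - \<psi> v\<bar> \<le> \<epsilon>" if n: "N \<le> n" "i < n"
    and uv: "u \<in> {real i * t / real n..real (Suc i) * t / real n}" "v \<in> {real i * t / real n..real (Suc i) * t / real n}" for n i u v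
  proof -
    have n0: "0 < real n" using n by simp
    have "t / \<delta> < real n" using N n(1) by simp
    then have "t / real n < \<delta>" using \<delta>(1) n0 by (simp add: field_simps)
    moreover have "real (Suc i) * t / real n - real i * t / real n = t / real n"
      by (simp add: distrib_right add_divide_distrib)
    ultimately have "dist u v < \<delta>" using uv by (auto simp: dist_real_def abs_less_iff)
    moreover have "u \<in> {0..t}" "v \<in> {0..t}" using uv grid_bounds[OF t n(2)] by auto
    ultimately show ?thesis using \<delta>(2)[of v u] by (simp add: dist_real_def)
  qed
  then show ?thesis by blast
qed

lemma riemann_sum_tendsto:
  fixes \<psi> :: "real \<Rightarrow> real"
  assumes t: "0 < t" and cont: "continuous_on {0..t} \<psi>"
  shows "(\<lambda>n. \<Sum>i<n. t / real n * \<psi> (real i * t / real n)) \<longlonglongrightarrow> (LINT u:{0..t}|lborel. \<psi> u)"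
proof -
  have "(\<lambda>n. \<Sum>i<n. \<psi> (real i * t / real n) * (real (Suc i) * t / real n - real i * t / real n))
     \<longlonglongrightarrow> (LINT u:{0..t}|lborel. \<psi> u * 1)"
  proof (rule stieltjes_sum_tendsto[OF t, where A="\<lambda>s. s"])
    show "set_integrable lborel {0..t} (\<lambda>u. \<psi> u * 1)"
      using borel_integrable_atLeastAtMost'[OF cont] by simp
    show "\<exists>N. \<forall>n\<ge>N. \<forall>i<n. \<forall>u\<in>{real i * t / real n..real (Suc i) * t / real n}.
        \<bar>\<psi> (real i * t / real n) - \<psi> u\<bar> \<le> \<epsilon>" if "0 < \<epsilon>" for \<epsilon>
      using uniformly_close_on_grid[OF t cont that] grid_bounds(2)[OF t]
      by (metis atLeastAtMost_iff order_refl)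
    show "set_integrable lborel {0..t} (\<lambda>u. 1 :: real)"
      by (rule borel_integrable_atLeastAtMost') (rule continuous_on_const)
  qed (auto simp: set_lebesgue_integral_def)
  moreover have "\<psi> (real i * t / real n) * (real (Suc i) * t / real n - real i * t / real n) =
      t / real n * \<psi> (real i * t / real n)" for i n
  proof -
    have "real (Suc i) * t / real n - real i * t / real n = t / real n"
      by (simp add: distrib_right add_divide_distrib)
    then show ?thesis by (simp only: mult.commute)
  qed
  ultimately show ?thesis by simp
qed

lemma lipschitz_of_derivative_bound:
  fixes f f' :: "real \<Rightarrow> real"
  assumes "\<And>y. (f has_real_derivative f' y) (at y)" "\<And>y. \<bar>f' y\<bar> \<le> C"
  shows "\<bar>f u - f v\<bar> \<le> C * \<bar>u - v\<bar>"
  using field_differentiable_bound[of UNIV f f' C u v] assms by simp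

text \<open>
  The part of the change of \<open>f (y)\<close> that is due to the increments of the finite variation path \<open>a\<close>.  Each
  term is \<open>f' \<xi> \<Delta>a\<close> for some \<open>\<xi>\<close> within \<open>\<Delta>a\<close> of the right end value of \<open>y\<close>, so Stieltjes sums apply.
\<close>

lemma drift_sum_tendsto:
  fixes f f' f'' y a \<alpha> :: "real \<Rightarrow> real"
  assumes t: "0 < t"
    and f: "\<And>y. (f has_real_derivative f' y) (at y)" "\<And>y. (f' has_real_derivative f'' y) (at y)"
    and bounds: "\<And>y. \<bar>f' y\<bar> \<le> C" "\<And>y. \<bar>f'' y\<bar> \<le> C"
    and y: "continuous_on {0..t} y" and a: "continuous_on {0..t} a"
    and \<alpha>0: "\<And>u. u \<in> {0..t} \<Longrightarrow> 0 \<le> \<alpha> u"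
    and int\<alpha>: "set_integrable lborel {0..t} \<alpha>"
    and A: "\<And>s. s \<in> {0..t} \<Longrightarrow> a s = (LINT u:{0..s}|lborel. \<alpha> u)"
  shows "(\<lambda>n. \<Sum>i<n. f (y (real (Suc i) * t / real n))
      - f (y (real (Suc i) * t / real n) - (a (real (Suc i) * t / real n) - a (real i * t / real n))))
    \<longlonglongrightarrow> (LINT u:{0..t}|lborel. f' (y u) * \<alpha> u)"
proof -
  have C: "0 \<le> C" using bounds(1)[of 0] by linarith
  have contf': "continuous_on UNIV f'" by (rule DERIV_continuous_on) (rule f)
  have "\<exists>\<xi>. \<bar>\<xi> - v\<bar> \<le> \<bar>w\<bar> \<and> f v - f (v - w) = f' \<xi> * w" for v w
  proof -
    consider "w = 0" | "0 < w" | "w < 0" by linarith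
    then show ?thesis
    proof cases
      case 2
      then obtain z where "v - w < z" "z < v" "f v - f (v - w) = (v - (v - w)) * f' z"
        using MVT2[of "v - w" v f f'] f(1) by auto
      then show ?thesis by (intro exI[of _ z]) auto
    next
      case 3
      then obtain z where "v < z" "z < v - w" "f (v - w) - f v = (v - w - v) * f' z"
        using MVT2[of v "v - w" f f'] f(1) by auto
      then show ?thesis by (intro exI[of _ z]) (auto simp: algebra_simps)
    qed (auto intro: exI[of _ v])
  qed
  then obtain \<xi> where \<xi>: "\<And>v w. \<bar>\<xi> v w - v\<bar> \<le> \<bar>w\<bar>" "\<And>v w. f v - f (v - w) = f' (\<xi> v w) * w" by metis
  have "(\<lambda>n. \<Sum>i<n. f' (\<xi> (y (real (Suc i) * t / real n)) (a (real (Suc i) * t / real n) - a (real i * t / real n)))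
      * (a (real (Suc i) * t / real n) - a (real i * t / real n)))
    \<longlonglongrightarrow> (LINT u:{0..t}|lborel. f' (y u) * \<alpha> u)"
  proof (rule stieltjes_sum_tendsto[OF t \<alpha>0 int\<alpha> A])
    have c: "continuous_on {0..t} (\<lambda>u. f' (y u))"
      by (rule continuous_on_compose2[OF contf' y]) auto
    show "set_integrable lborel {0..t} (\<lambda>u. f' (y u) * \<alpha> u)"
      unfolding set_integrable_def
    proof (rule Bochner_Integration.integrable_bound)
      show "integrable lborel (\<lambda>u. C * (indicator {0..t} u *\<^sub>R \<alpha> u))"
        using int\<alpha> unfolding set_integrable_def by (rule integrable_mult_right)
      have "(\<lambda>u. indicator {0..t} u *\<^sub>R f' (y u)) \<in> borel_measurable lborel"
        using borel_integrable_atLeastAtMost'[OF c] by (auto simp: set_integrable_def intro: borel_measurable_integrable)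
      moreover have "(\<lambda>u. indicator {0..t} u *\<^sub>R \<alpha> u) \<in> borel_measurable lborel"
        using int\<alpha> unfolding set_integrable_def by (rule borel_measurable_integrable)
      ultimately have "(\<lambda>u. (indicator {0..t} u *\<^sub>R f' (y u)) * (indicator {0..t} u *\<^sub>R \<alpha> u)) \<in> borel_measurable lborel"
        by (rule borel_measurable_times)
      also have "(\<lambda>u. (indicator {0..t} u *\<^sub>R f' (y u)) * (indicator {0..t} u *\<^sub>R \<alpha> u)) =
          (\<lambda>u. indicator {0..t} u *\<^sub>R (f' (y u) * \<alpha> u))" by (auto simp: indicator_def)
      finally show "(\<lambda>u. indicator {0..t} u *\<^sub>R (f' (y u) * \<alpha> u)) \<in> borel_measurable lborel" .
      show "AE u in lborel. norm (indicator {0..t} u *\<^sub>R (f' (y u) * \<alpha> u)) \<le> norm (C * (indicator {0..t} u *\<^sub>R \<alpha> u))"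
        using bounds(1) C by (intro AE_I2) (auto simp: indicator_def abs_mult intro!: mult_right_mono)
    qed
    fix \<epsilon> :: real assume \<epsilon>: "0 < \<epsilon>"
    \<comment> \<open>The mean value point is off by at most \<open>2 e\<close>, and \<open>f'\<close> has Lipschitz constant \<open>C\<close>.\<close>
    define e where "e = \<epsilon> / (2 * (C + 1))"
    have e: "0 < e" using \<epsilon> C by (simp add: e_def)
    have eC: "C * (2 * e) \<le> \<epsilon>"
    proof -
      have "C * (2 * e) = \<epsilon> * (C / (C + 1))" using C by (simp add: e_def field_simps)
      also have "\<dots> \<le> \<epsilon> * 1" using C \<epsilon> by (intro mult_left_mono) auto
      finally show ?thesis by simp
    qed
    obtain N1 where N1: "\<And>n i u v. N1 \<le> n \<Longrightarrow> i < n \<Longrightarrow> u \<in> {real i * t / real n..real (Suc i) * t / real n} \<Longrightarrow>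
       v \<in> {real i * t / real n..real (Suc i) * t / real n} \<Longrightarrow> \<bar>y u - y v\<bar> \<le> e"
      using uniformly_close_on_grid[OF t y e] by blast
    obtain N2 where N2: "\<And>n i u v. N2 \<le> n \<Longrightarrow> i < n \<Longrightarrow> u \<in> {real i * t / real n..real (Suc i) * t / real n} \<Longrightarrow>
       v \<in> {real i * t / real n..real (Suc i) * t / real n} \<Longrightarrow> \<bar>a u - a v\<bar> \<le> e"
      using uniformly_close_on_grid[OF t a e] by blast
    show "\<exists>N. \<forall>n\<ge>N. \<forall>i<n. \<forall>u\<in>{real i * t / real n..real (Suc i) * t / real n}.
       \<bar>f' (\<xi> (y (real (Suc i) * t / real n)) (a (real (Suc i) * t / real n) - a (real i * t / real n))) - f' (y u)\<bar> \<le> \<epsilon>"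
    proof (intro exI[of _ "max N1 N2"] allI impI ballI)
      fix n i u assume n: "max N1 N2 \<le> n" and i: "i < n"
        and u: "u \<in> {real i * t / real n..real (Suc i) * t / real n}"
      let ?p = "real i * t / real n" and ?q = "real (Suc i) * t / real n"
      have pq: "?p \<in> {?p..?q}" "?q \<in> {?p..?q}" using grid_bounds[OF t i] by auto
      have "\<bar>\<xi> (y ?q) (a ?q - a ?p) - y u\<bar> \<le> \<bar>a ?q - a ?p\<bar> + \<bar>y ?q - y u\<bar>"
        using \<xi>(1)[of "y ?q" "a ?q - a ?p"] by linarith
      also have "\<dots> \<le> e + e" using n i u pq by (intro add_mono N1 N2) auto
      finally have "\<bar>\<xi> (y ?q) (a ?q - a ?p) - y u\<bar> \<le> 2 * e" by simp
      then have "C * \<bar>\<xi> (y ?q) (a ?q - a ?p) - y u\<bar> \<le> C * (2 * e)" using C by (rule mult_left_mono)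
      with lipschitz_of_derivative_bound[OF f(2) bounds(2), of "\<xi> (y ?q) (a ?q - a ?p)" "y u"] eC
      show "\<bar>f' (\<xi> (y ?q) (a ?q - a ?p)) - f' (y u)\<bar> \<le> \<epsilon>" by linarith
    qed
  qed
  then show ?thesis by (simp only: \<xi>(2))
qed

section \<open>A path with singular drift\<close>

lemma coth_nonneg: "0 \<le> r \<Longrightarrow> 0 \<le> coth r"
  unfolding coth_def by (intro divide_nonneg_nonneg) auto

text \<open>
  A single path \<open>r = x + b + d\<close> with drift \<open>d = \<kappa> \<integral> coth r\<close>, and its modification \<open>y = x + b + min d K\<close>.
  As \<open>d\<close> is nondecreasing, \<open>min d K\<close> is \<open>d\<close> stopped at the time \<open>\<sigma>\<close> at which \<open>d\<close> reaches \<open>K\<close>.  Up to \<open>\<sigma>\<close>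
  the paths agree and the drift term is \<open>f' r \<kappa> coth r = g r\<close>; after \<open>\<sigma>\<close> there is no drift.  The
  discretisation error of Dynkin's formula therefore converges to \<open>0\<close> if \<open>d\<close> does not exceed \<open>K\<close>, and to
  a limit bounded by \<open>2 C t\<close> otherwise.
\<close>

lemma
  fixes b r d a y f f' f'' g :: "real \<Rightarrow> real"
  assumes t: "0 < t" and \<kappa>: "0 < \<kappa>" and K: "0 \<le> K"
    and b: "continuous_on {0..} b" and r: "continuous_on {0..} r"
    and r_nonneg: "\<And>s. 0 \<le> s \<Longrightarrow> 0 \<le> r s"
    and r_nz: "AE u in lborel. 0 \<le> u \<longrightarrow> r u \<noteq> 0"
    and coth_int: "\<And>s. 0 \<le> s \<Longrightarrow> set_integrable lborel {0..s} (\<lambda>u. coth (r u))"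
    and r_eq: "\<And>s. 0 \<le> s \<Longrightarrow> r s = x + b s + \<kappa> * (LINT u:{0..s}|lborel. coth (r u))"
    and d: "\<And>s. d s = r s - x - b s"
    and a: "\<And>s. a s = min (d s) K"
    and y: "\<And>s. y s = x + b s + a s"
  shows truncated_drift_mono: "\<And>p q. 0 \<le> p \<Longrightarrow> p \<le> q \<Longrightarrow> a p \<le> a q"
    and truncated_drift_0: "a 0 = 0"
    and truncated_drift_error_tendsto:
      "\<lbrakk>\<And>v. (f has_real_derivative f' v) (at v); \<And>v. (f' has_real_derivative f'' v) (at v);
        continuous_on UNIV f''; continuous_on UNIV g;
        \<And>v. \<bar>f' v\<bar> \<le> C; \<And>v. \<bar>f'' v\<bar> \<le> C; \<And>v. \<bar>g v\<bar> \<le> C;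
        \<And>v. 0 < v \<Longrightarrow> g v = f' v * (\<kappa> * coth v)\<rbrakk> \<Longrightarrow>
      \<exists>u. (\<lambda>n. \<Sum>i<n. (f (y (real (Suc i) * t / real n))
               - f (y (real i * t / real n) + (b (real (Suc i) * t / real n) - b (real i * t / real n))))
             + t / real n * (f'' (y (real i * t / real n)) / 2)
             - t / real n * (f'' (r (real i * t / real n)) / 2 + g (r (real i * t / real n)))) \<longlonglongrightarrow> u
        \<and> \<bar>u\<bar> \<le> (if K < d t then 2 * C * t else 0)"
proof -
  have d_eq: "d s = \<kappa> * (LINT u:{0..s}|lborel. coth (r u))" if "0 \<le> s" for s
    using r_eq[OF that] by (simp add: d)
  have d0: "d 0 = 0" using d_eq[of 0] set_integral_Icc_self[of 0] by (simp del: atLeastAtMost_singleton)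
  have d_mono: "d p \<le> d q" if "0 \<le> p" "p \<le> q" for p q
  proof -
    have "0 \<le> (LINT u:{p<..q}|lborel. coth (r u))"
      unfolding set_lebesgue_integral_def
    proof (rule Bochner_Integration.integral_nonneg)
      show "0 \<le> indicator {p<..q} u *\<^sub>R coth (r u)" for u
        using that coth_nonneg[OF r_nonneg[of u]] by (cases "u \<in> {p<..q}") auto
    qed
    then have "(LINT u:{0..p}|lborel. coth (r u)) \<le> (LINT u:{0..q}|lborel. coth (r u))"
      using set_integral_diff_Icc(1)[OF coth_int[of q] that] that by auto
    then have "\<kappa> * (LINT u:{0..p}|lborel. coth (r u)) \<le> \<kappa> * (LINT u:{0..q}|lborel. coth (r u))"
      using \<kappa> by (intro mult_left_mono) auto
    then show ?thesis using d_eq[of p] d_eq[of q] that by linarith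
  qed
  show a_mono: "a p \<le> a q" if "0 \<le> p" "p \<le> q" for p q
    using d_mono[OF that] by (auto simp: a)
  show a0: "a 0 = 0" using K by (simp add: a d0)
  have sub: "{0..t} \<subseteq> {0..}" by auto
  have cb: "continuous_on {0..t} b" and cr: "continuous_on {0..t} r"
    using continuous_on_subset[OF b sub] continuous_on_subset[OF r sub] .
  have cd: "continuous_on {0..t} d" unfolding d[abs_def] by (intro continuous_intros cb cr)
  have ca: "continuous_on {0..t} a" unfolding a[abs_def] by (intro continuous_intros cd)
  have cy: "continuous_on {0..t} y" unfolding y[abs_def] by (intro continuous_intros cb ca)
  \<comment> \<open>The time at which the drift reaches the cap, or \<open>t\<close> if it does not exceed it.\<close>
  obtain \<sigma> where \<sigma>: "0 \<le> \<sigma>" "\<sigma> \<le> t" and \<sigma>_end: "\<not> K < d t \<Longrightarrow> \<sigma> = t"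
    and a_\<sigma>: "\<And>s. s \<in> {0..t} \<Longrightarrow> a s = d (min s \<sigma>)"
  proof (cases "K < d t")
    case True
    then obtain \<sigma> where "0 \<le> \<sigma>" "\<sigma> \<le> t" "d \<sigma> = K"
      using IVT'[of d 0 K t] cd K d0 t by auto
    moreover from this have "a s = d (min s \<sigma>)" if "s \<in> {0..t}" for s
      using d_mono[of s \<sigma>] d_mono[of \<sigma> s] that by (auto simp: a min_def)
    ultimately show ?thesis using that True by blast
  next
    case False
    have "a s = d (min s t)" if "s \<in> {0..t}" for s
      using d_mono[of s t] that False by (auto simp: a min_def)
    then show ?thesis using that[of t] t by auto
  qed
  define \<alpha> where "\<alpha> u = \<kappa> * (indicator {..\<sigma>} u * coth (r u))" for u
  have \<alpha>_int: "set_integrable lborel {0..s} \<alpha>" and a_eq: "a s = (LINT u:{0..s}|lborel. \<alpha> u)"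
    if "s \<in> {0..t}" for s
  proof -
    have ind: "indicator {0..s} u *\<^sub>R \<alpha> u = \<kappa> * (indicator {0..min s \<sigma>} u *\<^sub>R coth (r u))" for u
      by (auto simp: \<alpha>_def indicator_def)
    have "set_integrable lborel {0..min s \<sigma>} (\<lambda>u. coth (r u))" using that \<sigma> by (intro coth_int) auto
    then show "set_integrable lborel {0..s} \<alpha>"
      unfolding set_integrable_def ind by (rule integrable_mult_right)
    have "a s = \<kappa> * (LINT u:{0..min s \<sigma>}|lborel. coth (r u))"
      using a_\<sigma>[OF that] d_eq[of "min s \<sigma>"] that \<sigma> by auto
    then show "a s = (LINT u:{0..s}|lborel. \<alpha> u)"
      unfolding set_lebesgue_integral_def ind by simp
  qed
  assume f: "\<And>v. (f has_real_derivative f' v) (at v)" "\<And>v. (f' has_real_derivative f'' v) (at v)"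
    and cf'': "continuous_on UNIV f''" and cg: "continuous_on UNIV g"
    and bounds: "\<And>v. \<bar>f' v\<bar> \<le> C" "\<And>v. \<bar>f'' v\<bar> \<le> C" "\<And>v. \<bar>g v\<bar> \<le> C"
    and g: "\<And>v. 0 < v \<Longrightarrow> g v = f' v * (\<kappa> * coth v)"
  have C: "0 \<le> C" using bounds(1)[of 0] by linarith
  have cfy: "continuous_on {0..t} (\<lambda>u. f'' (y u) / 2)"
    by (intro continuous_intros continuous_on_compose2[OF cf'' cy]) auto
  have cfr: "continuous_on {0..t} (\<lambda>u. f'' (r u) / 2)"
    by (intro continuous_intros continuous_on_compose2[OF cf'' cr]) auto
  have cgr: "continuous_on {0..t} (\<lambda>u. g (r u))"
    by (intro continuous_on_compose2[OF cg cr]) auto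
  define I1 where "I1 = (LINT u:{0..t}|lborel. f' (y u) * \<alpha> u)"
  define I2 where "I2 = (LINT u:{0..t}|lborel. f'' (y u) / 2)"
  define I3 where "I3 = (LINT u:{0..t}|lborel. f'' (r u) / 2)"
  define I4 where "I4 = (LINT u:{0..t}|lborel. g (r u))"
  have "(\<lambda>n. \<Sum>i<n. f (y (real (Suc i) * t / real n))
      - f (y (real (Suc i) * t / real n) - (a (real (Suc i) * t / real n) - a (real i * t / real n))))
    \<longlonglongrightarrow> I1"
    unfolding I1_def
  proof (rule drift_sum_tendsto[OF t f bounds(1,2) cy ca _ _ a_eq])
    show "0 \<le> \<alpha> u" if "u \<in> {0..t}" for u
      using that coth_nonneg[OF r_nonneg[of u]] \<kappa> by (simp add: \<alpha>_def)
    show "set_integrable lborel {0..t} \<alpha>" using \<alpha>_int[of t] t by simp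
  qed
  moreover have "y q - (a q - a p) = y p + (b q - b p)" for p q
    by (simp add: y)
  ultimately have l1: "(\<lambda>n. \<Sum>i<n. f (y (real (Suc i) * t / real n))
      - f (y (real i * t / real n) + (b (real (Suc i) * t / real n) - b (real i * t / real n))))
    \<longlonglongrightarrow> I1" by simp
  have l2: "(\<lambda>n. \<Sum>i<n. t / real n * (f'' (y (real i * t / real n)) / 2)) \<longlonglongrightarrow> I2"
    unfolding I2_def by (rule riemann_sum_tendsto[OF t cfy])
  have l3: "(\<lambda>n. \<Sum>i<n. t / real n * (f'' (r (real i * t / real n)) / 2)) \<longlonglongrightarrow> I3"
    unfolding I3_def by (rule riemann_sum_tendsto[OF t cfr])
  have l4: "(\<lambda>n. \<Sum>i<n. t / real n * g (r (real i * t / real n))) \<longlonglongrightarrow> I4"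
    unfolding I4_def by (rule riemann_sum_tendsto[OF t cgr])
  have lim: "(\<lambda>n. \<Sum>i<n. (f (y (real (Suc i) * t / real n))
               - f (y (real i * t / real n) + (b (real (Suc i) * t / real n) - b (real i * t / real n))))
             + t / real n * (f'' (y (real i * t / real n)) / 2)
             - t / real n * (f'' (r (real i * t / real n)) / 2 + g (r (real i * t / real n))))
          \<longlonglongrightarrow> I1 + I2 - (I3 + I4)"
    using tendsto_diff[OF tendsto_add[OF l1 l2] tendsto_add[OF l3 l4]]
    by (simp only: sum.distrib sum_subtractf distrib_left)
  \<comment> \<open>At the zeros of the path, a null set, \<open>coth\<close> has the conventional value \<open>0\<close>; elsewhere the integrands agree.\<close>
  have I1: "I1 = (LINT u|lborel. indicator {0..t} u *\<^sub>R (indicator {..\<sigma>} u * g (r u)))"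
    unfolding I1_def set_lebesgue_integral_def
  proof (rule integral_cong_AE)
    show "(\<lambda>u. indicator {0..t} u *\<^sub>R (indicator {..\<sigma>} u * g (r u))) \<in> borel_measurable lborel"
    proof -
      have "(\<lambda>u. indicator {0..t} u *\<^sub>R g (r u)) \<in> borel_measurable lborel"
        using borel_integrable_atLeastAtMost'[OF cgr] by (auto simp: set_integrable_def intro: borel_measurable_integrable)
      moreover have "(indicator {..\<sigma>} :: real \<Rightarrow> real) \<in> borel_measurable lborel" by simp
      ultimately have "(\<lambda>u. indicator {..\<sigma>} u * (indicator {0..t} u *\<^sub>R g (r u))) \<in> borel_measurable lborel"
        by (rule borel_measurable_times[rotated])
      then show ?thesis by (simp only: real_scaleR_def mult.left_commute[of "indicator {..\<sigma>} _"])
    qed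
    show "(\<lambda>u. indicator {0..t} u *\<^sub>R (f' (y u) * \<alpha> u)) \<in> borel_measurable lborel"
    proof -
      have "continuous_on {0..t} (\<lambda>u. f' (y u))"
        by (rule continuous_on_compose2[OF _ cy, of UNIV]) (auto intro: DERIV_continuous_on f(2))
      then have "(\<lambda>u. indicator {0..t} u *\<^sub>R f' (y u)) \<in> borel_measurable lborel"
        by (auto dest!: borel_integrable_atLeastAtMost' simp: set_integrable_def intro: borel_measurable_integrable)
      moreover have "(\<lambda>u. indicator {0..t} u *\<^sub>R \<alpha> u) \<in> borel_measurable lborel"
        using \<alpha>_int[of t] t unfolding set_integrable_def by (auto intro: borel_measurable_integrable)
      ultimately have "(\<lambda>u. (indicator {0..t} u *\<^sub>R f' (y u)) * (indicator {0..t} u *\<^sub>R \<alpha> u)) \<in> borel_measurable lborel"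
        by (rule borel_measurable_times)
      also have "(\<lambda>u. (indicator {0..t} u *\<^sub>R f' (y u)) * (indicator {0..t} u *\<^sub>R \<alpha> u)) =
          (\<lambda>u. indicator {0..t} u *\<^sub>R (f' (y u) * \<alpha> u))" by (auto simp: indicator_def)
      finally show ?thesis .
    qed
    show "AE u in lborel. indicator {0..t} u *\<^sub>R (f' (y u) * \<alpha> u) = indicator {0..t} u *\<^sub>R (indicator {..\<sigma>} u * g (r u))"
      using r_nz
    proof eventually_elim
      case (elim u)
      show ?case
      proof (cases "0 \<le> u \<and> u \<le> \<sigma>")
        case True
        then have u: "u \<in> {0..t}" "min u \<sigma> = u" using \<sigma> by auto
        have "y u = r u" using a_\<sigma>[OF u(1)] unfolding y u(2) by (simp add: d)
        moreover have "0 < r u" using True elim r_nonneg[of u] by force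
        ultimately show ?thesis using True g[of "r u"] by (simp add: \<alpha>_def)
      qed (auto simp: \<alpha>_def indicator_def)
    qed
  qed
  have "\<bar>I1 + I2 - (I3 + I4)\<bar> \<le> (if K < d t then 2 * C * t else 0)"
  proof (cases "K < d t")
    case True
    have bnd: "\<bar>(LINT u:{0..t}|lborel. h u)\<bar> \<le> C * t"
      if "\<And>u. u \<in> {0..t} \<Longrightarrow> \<bar>h u\<bar> \<le> C" "set_integrable lborel {0..t} h" for h :: "real \<Rightarrow> real"
    proof -
      have "norm (LINT u:{0..t}|lborel. h u) \<le> (LINT u|lborel. C * indicator {0..t} u)"
        unfolding set_lebesgue_integral_def
      proof (rule Bochner_Integration.integral_norm_bound_integral)
        show "integrable lborel (\<lambda>u. C * indicator {0..t} u)"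
          using borel_integrable_atLeastAtMost'[of 0 t "\<lambda>_. C"] by (simp add: set_integrable_def mult.commute)
      qed (use that in \<open>auto simp: set_integrable_def indicator_def\<close>)
      also have "\<dots> = C * t" using t by simp
      finally show ?thesis by simp
    qed
    have intg: "set_integrable lborel {0..t} (\<lambda>u. g (r u))" by (rule borel_integrable_atLeastAtMost'[OF cgr])
    have intg\<sigma>: "set_integrable lborel {0..t} (\<lambda>u. indicator {..\<sigma>} u * g (r u))"
    proof -
      have "set_integrable lborel {0..\<sigma>} (\<lambda>u. g (r u))"
        by (rule set_integrable_subset[OF intg]) (use \<sigma> in auto)
      moreover have "indicator {0..t} u *\<^sub>R (indicator {..\<sigma>} u * g (r u)) = indicator {0..\<sigma>} u *\<^sub>R g (r u)" for u
        using \<sigma> by (auto simp: indicator_def)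
      ultimately show ?thesis by (simp only: set_integrable_def)
    qed
    have "I1 - I4 = (LINT u:{0..t}|lborel. indicator {..\<sigma>} u * g (r u) - g (r u))"
      using set_integral_diff(2)[OF intg\<sigma> intg] by (simp add: I1 I4_def set_lebesgue_integral_def)
    also have "\<bar>\<dots>\<bar> \<le> C * t"
      using bounds(3) C by (intro bnd set_integral_diff(1) intg\<sigma> intg) (auto simp: indicator_def)
    finally have 1: "\<bar>I1 - I4\<bar> \<le> C * t" .
    have "I2 - I3 = (LINT u:{0..t}|lborel. f'' (y u) / 2 - f'' (r u) / 2)"
      unfolding I2_def I3_def
      by (rule set_integral_diff(2)[symmetric]; rule borel_integrable_atLeastAtMost'; fact)
    also have "\<bar>\<dots>\<bar> \<le> C * t"
    proof (rule bnd)
      show "\<bar>f'' (y u) / 2 - f'' (r u) / 2\<bar> \<le> C" for u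
        using bounds(2)[of "y u"] bounds(2)[of "r u"] by (simp add: abs_le_iff)
      show "set_integrable lborel {0..t} (\<lambda>u. f'' (y u) / 2 - f'' (r u) / 2)"
        by (rule set_integral_diff(1); rule borel_integrable_atLeastAtMost'; fact)
    qed
    finally show ?thesis using 1 True by simp
  next
    case False
    then have "\<sigma> = t" by (rule \<sigma>_end)
    have "y u = r u" if "u \<in> {0..t}" for u
      using a_\<sigma>[OF that] that by (simp add: y d \<open>\<sigma> = t\<close>)
    then have "I2 = I3" unfolding I2_def I3_def by (intro set_lebesgue_integral_cong) auto
    moreover have "I1 = I4" unfolding I1 I4_def set_lebesgue_integral_def \<open>\<sigma> = t\<close>
      by (intro Bochner_Integration.integral_cong) (auto simp: indicator_def)
    ultimately show ?thesis using False by simp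
  qed
  with lim show "\<exists>u. (\<lambda>n. \<Sum>i<n. (f (y (real (Suc i) * t / real n))
               - f (y (real i * t / real n) + (b (real (Suc i) * t / real n) - b (real i * t / real n))))
             + t / real n * (f'' (y (real i * t / real n)) / 2)
             - t / real n * (f'' (r (real i * t / real n)) / 2 + g (r (real i * t / real n)))) \<longlonglongrightarrow> u
        \<and> \<bar>u\<bar> \<le> (if K < d t then 2 * C * t else 0)" by blast
qed

section \<open>Brownian increments\<close>

lemma bm_increment_indep:
  assumes fp: "filtered_prob_space M F" and bm: "standard_brownian_motion M F B"
    and s: "0 \<le> s" "s < q" and Z: "Z \<in> borel_measurable (F s)"
  shows "prob_space.indep_var M borel Z borel (\<lambda>\<omega>. B q \<omega> - B s \<omega>)"
proof -
  interpret prob_space M using fp by (simp add: filtered_prob_space_def)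
  have sub: "subalgebra M (F s)" using fp s by (simp add: filtered_prob_space_def)
  then have sp: "space (F s) = space M" and ss: "sets (F s) \<subseteq> sets M" by (auto simp: subalgebra_def)
  have ZM: "Z \<in> borel_measurable M" by (rule measurable_from_subalg[OF sub Z])
  have dist: "distributed M lborel (\<lambda>\<omega>. B q \<omega> - B s \<omega>) (normal_density 0 (sqrt (q - s)))"
    and ind: "indep_set (sets (F s)) (sets (vimage_algebra (space M) (\<lambda>\<omega>. B q \<omega> - B s \<omega>) borel))"
    using bm s unfolding standard_brownian_motion_def by auto
  have \<Delta>M: "(\<lambda>\<omega>. B q \<omega> - B s \<omega>) \<in> borel_measurable M"
    using distributed_measurable[OF dist] by simp
  have "indep_set (sigma_sets (space M) {Z -` A \<inter> space M |A. A \<in> sets borel})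
     (sigma_sets (space M) {(\<lambda>\<omega>. B q \<omega> - B s \<omega>) -` A \<inter> space M |A. A \<in> sets borel})"
    using ind unfolding indep_set_def
  proof (rule indep_sets_mono_sets)
    fix i :: bool
    have "sigma_sets (space M) {Z -` A \<inter> space M |A. A \<in> sets borel} \<subseteq> sets (F s)"
      unfolding sp[symmetric] using measurable_sets[OF Z] by (intro sets.sigma_sets_subset) auto
    moreover have "sigma_sets (space M) {(\<lambda>\<omega>. B q \<omega> - B s \<omega>) -` A \<inter> space M |A. A \<in> sets borel} =
      sets (vimage_algebra (space M) (\<lambda>\<omega>. B q \<omega> - B s \<omega>) borel)"
      by (simp add: vimage_algebra_def sets_measure_of_conv) auto
    ultimately show "(case i of True \<Rightarrow> sigma_sets (space M) {Z -` A \<inter> space M |A. A \<in> sets borel}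
         | False \<Rightarrow> sigma_sets (space M) {(\<lambda>\<omega>. B q \<omega> - B s \<omega>) -` A \<inter> space M |A. A \<in> sets borel})
       \<subseteq> (case i of True \<Rightarrow> sets (F s) | False \<Rightarrow> sets (vimage_algebra (space M) (\<lambda>\<omega>. B q \<omega> - B s \<omega>) borel))"
      by (cases i) auto
  qed
  then show ?thesis unfolding indep_var_eq using ZM \<Delta>M by blast
qed

lemma bm_increment_product:
  fixes Z :: "'a \<Rightarrow> real" and \<phi> \<psi> :: "real \<Rightarrow> real"
  assumes fp: "filtered_prob_space M F" and bm: "standard_brownian_motion M F B"
    and s: "0 \<le> s" "s < q" and Z: "Z \<in> borel_measurable (F s)"
    and \<phi>: "\<phi> \<in> borel_measurable borel" "\<And>v. \<bar>\<phi> v\<bar> \<le> C"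
    and \<psi>: "\<psi> \<in> borel_measurable borel" "has_bochner_integral M (\<lambda>\<omega>. \<psi> (B q \<omega> - B s \<omega>)) m"
  shows "has_bochner_integral M (\<lambda>\<omega>. \<phi> (Z \<omega>) * \<psi> (B q \<omega> - B s \<omega>)) ((LINT \<omega>|M. \<phi> (Z \<omega>)) * m)"
proof -
  interpret prob_space M using fp by (simp add: filtered_prob_space_def)
  have sub: "subalgebra M (F s)" using fp s by (simp add: filtered_prob_space_def)
  have ZM[measurable]: "Z \<in> borel_measurable M" by (rule measurable_from_subalg[OF sub Z])
  note \<phi>(1)[measurable] \<psi>(1)[measurable]
  have "indep_var borel (\<phi> \<circ> Z) borel (\<psi> \<circ> (\<lambda>\<omega>. B q \<omega> - B s \<omega>))"
    by (rule indep_var_compose[OF bm_increment_indep[OF fp bm s Z]]) measurable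
  then have iv: "indep_var borel (\<lambda>\<omega>. \<phi> (Z \<omega>)) borel (\<lambda>\<omega>. \<psi> (B q \<omega> - B s \<omega>))"
    by (simp add: comp_def)
  have i1: "integrable M (\<lambda>\<omega>. \<phi> (Z \<omega>))"
    by (rule integrable_const_bound[where B=C]) (use \<phi>(2) in auto)
  have i2: "integrable M (\<lambda>\<omega>. \<psi> (B q \<omega> - B s \<omega>))" and m: "(LINT \<omega>|M. \<psi> (B q \<omega> - B s \<omega>)) = m"
    using \<psi>(2) by (auto simp: has_bochner_integral_iff)
  show ?thesis
    using indep_var_lebesgue_integral[OF iv i1 i2] indep_var_integrable[OF iv i1 i2] m
    by (simp add: has_bochner_integral_iff)
qed

text \<open>
  The third absolute moment of the standard normal distribution.
\<close>

definition cubic_moment :: real where "cubic_moment = sqrt (2 / pi) * 2"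

lemma bm_increment_moments:
  assumes fp: "filtered_prob_space M F" and bm: "standard_brownian_motion M F B"
    and s: "0 \<le> s" "s < q"
  shows "has_bochner_integral M (\<lambda>\<omega>. B q \<omega> - B s \<omega>) 0"
    and "has_bochner_integral M (\<lambda>\<omega>. (B q \<omega> - B s \<omega>)\<^sup>2) (q - s)"
    and "has_bochner_integral M (\<lambda>\<omega>. \<bar>B q \<omega> - B s \<omega>\<bar> ^ 3) (cubic_moment * sqrt (q - s) ^ 3)"
proof -
  have dist: "distributed M lborel (\<lambda>\<omega>. B q \<omega> - B s \<omega>) (normal_density 0 (sqrt (q - s)))"
    using bm s unfolding standard_brownian_motion_def by auto
  have conv: "has_bochner_integral M (\<lambda>\<omega>. \<psi> (B q \<omega> - B s \<omega>)) m"
    if "has_bochner_integral lborel (\<lambda>z. normal_density 0 (sqrt (q - s)) z * \<psi> z) m"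
       "\<psi> \<in> borel_measurable borel" for \<psi> m
    using that distributed_integrable[OF dist, of \<psi>] distributed_integral[OF dist, of \<psi>]
    by (simp add: has_bochner_integral_iff)
  have pos: "0 < sqrt (q - s)" using s by simp
  show "has_bochner_integral M (\<lambda>\<omega>. B q \<omega> - B s \<omega>) 0"
    by (rule conv) (use normal_moment_odd[OF pos, of 0 0] in simp_all)
  show "has_bochner_integral M (\<lambda>\<omega>. (B q \<omega> - B s \<omega>)\<^sup>2) (q - s)"
    by (rule conv) (use normal_moment_even[OF pos, of 0 1] s in \<open>simp_all add: power2_eq_square diff_divide_distrib\<close>)
  show "has_bochner_integral M (\<lambda>\<omega>. \<bar>B q \<omega> - B s \<omega>\<bar> ^ 3) (cubic_moment * sqrt (q - s) ^ 3)"
    by (rule conv) (use normal_moment_abs_odd[OF pos, of 0 1] in \<open>simp_all add: cubic_moment_def numeral_3_eq_3 mult_ac\<close>)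
qed

lemma taylor_cubic_bound:
  fixes f f' f'' f''' :: "real \<Rightarrow> real"
  assumes f: "\<And>v. (f has_real_derivative f' v) (at v)" "\<And>v. (f' has_real_derivative f'' v) (at v)"
     "\<And>v. (f'' has_real_derivative f''' v) (at v)"
    and bound: "\<And>v. \<bar>f''' v\<bar> \<le> C"
  shows "\<bar>f (z + h) - f z - f' z * h - f'' z / 2 * h\<^sup>2\<bar> \<le> C * \<bar>h\<bar> ^ 3"
proof (cases "h = 0")
  case False
  define df where "df m = (if m = 0 then f else if m = 1 then f' else if m = 2 then f'' else f''')" for m :: nat
  have "\<forall>m v. m < 3 \<and> z - \<bar>h\<bar> \<le> v \<and> v \<le> z + \<bar>h\<bar> \<longrightarrow> (df m has_real_derivative df (Suc m) v) (at v)"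
    using f by (auto simp: df_def numeral_3_eq_3 less_Suc_eq)
  moreover have "z - \<bar>h\<bar> \<le> z + h" "z + h \<le> z + \<bar>h\<bar>" "df 0 = f" by (auto simp: df_def)
  ultimately obtain w where "f (z + h) = (\<Sum>m<3. df m z / fact m * (z + h - z) ^ m) + df 3 w / fact 3 * (z + h - z) ^ 3"
    using Taylor[of 3 df f "z - \<bar>h\<bar>" "z + \<bar>h\<bar>" z "z + h"] False by auto
  then have "f (z + h) - f z - f' z * h - f'' z / 2 * h\<^sup>2 = f''' w / 6 * h ^ 3"
    by (simp add: df_def numeral_3_eq_3 numeral_2_eq_2)
  moreover have "\<bar>f''' w / 6 * h ^ 3\<bar> \<le> C * \<bar>h\<bar> ^ 3"
    unfolding abs_mult power_abs using bound[of w] by (intro mult_right_mono) auto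
  ultimately show ?thesis by simp
qed simp

text \<open>
  By independence, the linear term of the Taylor expansion has mean zero and the square of the
  increment contributes the factor \<open>q - s\<close>.  The remainder is of order \<open>(q - s)\<close> to the power \<open>3/2\<close>, so that the
  errors over a grid with mesh \<open>t / n\<close> add up to something that vanishes.
\<close>

lemma bm_increment_expansion:
  fixes f f' f'' f''' :: "real \<Rightarrow> real"
  assumes fp: "filtered_prob_space M F" and bm: "standard_brownian_motion M F B"
    and s: "0 \<le> s" "s < q" and Z: "Z \<in> borel_measurable (F s)"
    and f: "\<And>v. (f has_real_derivative f' v) (at v)" "\<And>v. (f' has_real_derivative f'' v) (at v)"
     "\<And>v. (f'' has_real_derivative f''' v) (at v)"
    and bounds: "\<And>v. \<bar>f v\<bar> \<le> C" "\<And>v. \<bar>f' v\<bar> \<le> C" "\<And>v. \<bar>f'' v\<bar> \<le> C" "\<And>v. \<bar>f''' v\<bar> \<le> C"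
  shows "\<bar>(LINT \<omega>|M. f (Z \<omega> + (B q \<omega> - B s \<omega>)) - f (Z \<omega>)) - (q - s) * (LINT \<omega>|M. f'' (Z \<omega>) / 2)\<bar>
    \<le> C * (cubic_moment * sqrt (q - s) ^ 3)"
proof -
  interpret prob_space M using fp by (simp add: filtered_prob_space_def)
  have sub: "subalgebra M (F s)" using fp s by (simp add: filtered_prob_space_def)
  have ZM[measurable]: "Z \<in> borel_measurable M" by (rule measurable_from_subalg[OF sub Z])
  have [measurable]: "f \<in> borel_measurable borel" "f' \<in> borel_measurable borel" "f'' \<in> borel_measurable borel"
    using DERIV_continuous_on[OF f(1)] DERIV_continuous_on[OF f(2)] DERIV_continuous_on[OF f(3)]
    by (auto intro!: borel_measurable_continuous_onI)
  let ?\<Delta> = "\<lambda>\<omega>. B q \<omega> - B s \<omega>"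
  note mom = bm_increment_moments[OF fp bm s]
  have \<Delta>M[measurable]: "?\<Delta> \<in> borel_measurable M"
    using mom(1) by (auto simp: has_bochner_integral_iff)
  have e1: "has_bochner_integral M (\<lambda>\<omega>. f' (Z \<omega>) * ?\<Delta> \<omega>) ((LINT \<omega>|M. f' (Z \<omega>)) * 0)"
    by (rule bm_increment_product[OF fp bm s Z _ bounds(2), where \<psi>="\<lambda>v. v"]) (use mom(1) in auto)
  have e2: "has_bochner_integral M (\<lambda>\<omega>. f'' (Z \<omega>) * (?\<Delta> \<omega>)\<^sup>2) ((LINT \<omega>|M. f'' (Z \<omega>)) * (q - s))"
    by (rule bm_increment_product[OF fp bm s Z _ bounds(3), where \<psi>="\<lambda>v. v\<^sup>2"]) (use mom(2) in auto)
  have i0: "integrable M (\<lambda>\<omega>. f (Z \<omega> + ?\<Delta> \<omega>) - f (Z \<omega>))"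
    by (intro Bochner_Integration.integrable_diff; rule integrable_const_bound[where B=C]; use bounds in auto)
  define e where "e \<omega> = f (Z \<omega> + ?\<Delta> \<omega>) - f (Z \<omega>) - f' (Z \<omega>) * ?\<Delta> \<omega> - f'' (Z \<omega>) * (?\<Delta> \<omega>)\<^sup>2 / 2" for \<omega>
  have "has_bochner_integral M e ((LINT \<omega>|M. f (Z \<omega> + ?\<Delta> \<omega>) - f (Z \<omega>))
     - (LINT \<omega>|M. f' (Z \<omega>)) * 0 - (LINT \<omega>|M. f'' (Z \<omega>)) * (q - s) / 2)"
    unfolding e_def by (intro has_bochner_integral_diff has_bochner_integral_divide_zero e1 e2 has_bochner_integral_integrable i0)
  then have ie: "integrable M e" and eq: "(LINT \<omega>|M. e \<omega>) =
     (LINT \<omega>|M. f (Z \<omega> + ?\<Delta> \<omega>) - f (Z \<omega>)) - (q - s) * (LINT \<omega>|M. f'' (Z \<omega>) / 2)"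
    by (auto simp: has_bochner_integral_iff mult.commute)
  have i3: "has_bochner_integral M (\<lambda>\<omega>. C * \<bar>?\<Delta> \<omega>\<bar> ^ 3) (C * (cubic_moment * sqrt (q - s) ^ 3))"
    by (intro has_bochner_integral_mult_right mom(3))
  have "norm (LINT \<omega>|M. e \<omega>) \<le> (LINT \<omega>|M. C * \<bar>?\<Delta> \<omega>\<bar> ^ 3)"
  proof (rule order_trans[OF integral_norm_bound integral_mono])
    show "integrable M (\<lambda>\<omega>. norm (e \<omega>))" using ie by (rule integrable_norm)
    show "integrable M (\<lambda>\<omega>. C * \<bar>?\<Delta> \<omega>\<bar> ^ 3)" using i3 by (simp only: has_bochner_integral_iff)
    show "norm (e \<omega>) \<le> C * \<bar>?\<Delta> \<omega>\<bar> ^ 3" for \<omega>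
      using taylor_cubic_bound[OF f bounds(4), of "Z \<omega>" "?\<Delta> \<omega>"] by (simp add: e_def)
  qed
  also have "\<dots> = C * (cubic_moment * sqrt (q - s) ^ 3)" using i3 by (simp only: has_bochner_integral_iff)
  finally show ?thesis by (simp add: eq)
qed

lemma bm_start: "standard_brownian_motion M F B \<Longrightarrow> AE \<omega> in M. B 0 \<omega> = 0"
  by (simp add: standard_brownian_motion_def)

lemma bm_expectation_gaussian:
  fixes \<phi> :: "real \<Rightarrow> real"
  assumes fp: "filtered_prob_space M F" and bm: "standard_brownian_motion M F B" and t: "0 \<le> t"
    and \<phi>: "\<phi> \<in> borel_measurable borel"
  shows "(LINT \<omega>|M. \<phi> (B t \<omega>)) = (LINT z|lborel. std_normal_density z * \<phi> (sqrt t * z))"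
proof -
  interpret prob_space M using fp by (simp add: filtered_prob_space_def)
  have BM: "B s \<in> borel_measurable M" if "0 \<le> s" for s
    using bm fp that unfolding standard_brownian_motion_def filtered_prob_space_def
    by (meson measurable_from_subalg)
  note BM[OF t, measurable] \<phi>[measurable] BM[OF order_refl, measurable]
  show ?thesis
  proof (cases "t = 0")
    case True
    have "(LINT \<omega>|M. \<phi> (B 0 \<omega>)) = (LINT \<omega>|M. \<phi> 0)"
      by (rule integral_cong_AE) (use bm_start[OF bm] in auto)
    then show ?thesis using True integral_std_normal_moment_even[of 0] by (simp add: prob_space)
  next
    case False
    then have t0: "0 < t" using t by simp
    then have dist: "distributed M lborel (\<lambda>\<omega>. B t \<omega> - B 0 \<omega>) (normal_density 0 (sqrt (t - 0)))"
      using bm unfolding standard_brownian_motion_def by blast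
    have "(LINT \<omega>|M. \<phi> (B t \<omega>)) = (LINT \<omega>|M. \<phi> (B t \<omega> - B 0 \<omega>))"
      by (rule integral_cong_AE) (use bm_start[OF bm] in auto)
    also have "\<dots> = (LINT z|lborel. normal_density 0 (sqrt t) z * \<phi> z)"
      using distributed_integral[OF dist, of \<phi>] by simp
    also have "\<dots> = sqrt t * (LINT z|lborel. normal_density 0 (sqrt t) (0 + sqrt t * z) * \<phi> (0 + sqrt t * z))"
      using t0 by (subst lborel_integral_real_affine[where c="sqrt t" and t=0]) auto
    also have "\<dots> = (LINT z|lborel. sqrt t * (normal_density 0 (sqrt t) (0 + sqrt t * z) * \<phi> (0 + sqrt t * z)))"
      by simp
    also have "\<dots> = (LINT z|lborel. std_normal_density z * \<phi> (sqrt t * z))"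
    proof (intro Bochner_Integration.integral_cong refl)
      fix z :: real
      have "sqrt t * normal_density 0 (sqrt t) (0 + sqrt t * z) = std_normal_density z"
        using t0 by (simp add: normal_density_def power_mult_distrib real_sqrt_mult)
      then show "sqrt t * (normal_density 0 (sqrt t) (0 + sqrt t * z) * \<phi> (0 + sqrt t * z)) = std_normal_density z * \<phi> (sqrt t * z)"
        by (simp flip: mult.assoc)
    qed
    finally show ?thesis .
  qed
qed

section \<open>Dynkin's formula\<close>

text \<open>
  A process with drift \<open>\<kappa> coth R\<close> and a test function \<open>f\<close> with bounded derivatives.  The function \<open>g\<close> is
  the drift part \<open>f' r \<kappa> coth r\<close> of the generator, assumed to extend continuously to the origin, where
  \<open>coth\<close> is singular.
\<close>

locale dynkin_setting =
  fixes M :: "'a measure" and F :: "real \<Rightarrow> 'a measure" and B R :: "real \<Rightarrow> 'a \<Rightarrow> real"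
    and \<kappa> x :: real and f f' f'' f''' g :: "real \<Rightarrow> real" and C :: real
  assumes fp: "filtered_prob_space M F" and bm: "standard_brownian_motion M F B"
    and \<kappa>: "0 < \<kappa>"
    and R_adapted: "\<And>s. 0 \<le> s \<Longrightarrow> R s \<in> borel_measurable (F s)"
    and R_cont: "AE \<omega> in M. continuous_on {0..} (\<lambda>s. R s \<omega>)"
    and R_nonneg: "AE \<omega> in M. \<forall>s\<ge>0. 0 \<le> R s \<omega>"
    and R_nz: "AE \<omega> in M. AE u in lborel. 0 \<le> u \<longrightarrow> R u \<omega> \<noteq> 0"
    and R_eq: "AE \<omega> in M. \<forall>s\<ge>0. set_integrable lborel {0..s} (\<lambda>u. coth (R u \<omega>)) \<and>
       R s \<omega> = x + B s \<omega> + \<kappa> * (LINT u:{0..s}|lborel. coth (R u \<omega>))"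
    and f: "\<And>v. (f has_real_derivative f' v) (at v)" "\<And>v. (f' has_real_derivative f'' v) (at v)"
     "\<And>v. (f'' has_real_derivative f''' v) (at v)"
    and bounds: "\<And>v. \<bar>f v\<bar> \<le> C" "\<And>v. \<bar>f' v\<bar> \<le> C" "\<And>v. \<bar>f'' v\<bar> \<le> C" "\<And>v. \<bar>f''' v\<bar> \<le> C"
    and g_cont: "continuous_on UNIV g" and g_bound: "\<And>v. \<bar>g v\<bar> \<le> C"
    and g: "\<And>v. 0 < v \<Longrightarrow> g v = f' v * (\<kappa> * coth v)"
begin

sublocale prob_space M using fp by (simp add: filtered_prob_space_def)

definition drift :: "real \<Rightarrow> 'a \<Rightarrow> real" where "drift s \<omega> = R s \<omega> - x - B s \<omega>"

definition capped :: "real \<Rightarrow> real \<Rightarrow> 'a \<Rightarrow> real" where "capped K s \<omega> = x + B s \<omega> + min (drift s \<omega>) K"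

lemma C_nonneg: "0 \<le> C" using bounds(1)[of 0] by linarith

lemma sub: "0 \<le> s \<Longrightarrow> subalgebra M (F s)"
  using fp by (simp add: filtered_prob_space_def)

lemma B_adapted: "0 \<le> s \<Longrightarrow> B s \<in> borel_measurable (F s)"
  using bm by (simp add: standard_brownian_motion_def)

lemma drift_adapted: "0 \<le> s \<Longrightarrow> drift s \<in> borel_measurable (F s)"
  unfolding drift_def[abs_def] by (intro borel_measurable_diff R_adapted B_adapted borel_measurable_const)

lemma capped_adapted: "0 \<le> s \<Longrightarrow> capped K s \<in> borel_measurable (F s)"
  unfolding capped_def[abs_def]
  by (intro borel_measurable_add borel_measurable_min drift_adapted B_adapted borel_measurable_const)

lemma measurable_M:
  assumes "0 \<le> s"
  shows "R s \<in> borel_measurable M" "B s \<in> borel_measurable M" "drift s \<in> borel_measurable M" "capped K s \<in> borel_measurable M"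
  using assms by (auto intro: measurable_from_subalg[OF sub] R_adapted B_adapted drift_adapted capped_adapted)

lemma f_measurable: "f \<in> borel_measurable borel" "f' \<in> borel_measurable borel" "f'' \<in> borel_measurable borel"
  "g \<in> borel_measurable borel"
  using DERIV_continuous_on[OF f(1)] DERIV_continuous_on[OF f(2)] DERIV_continuous_on[OF f(3)] g_cont
  by (auto intro!: borel_measurable_continuous_onI)

lemma integrable_bounded_comp:
  assumes "h \<in> borel_measurable borel" "\<And>v :: real. \<bar>h v\<bar> \<le> c" "Z \<in> borel_measurable M"
  shows "integrable M (\<lambda>\<omega>. h (Z \<omega>) :: real)"
  by (rule integrable_const_bound[where B=c]) (use assms in auto)

definition generator_mean :: "real \<Rightarrow> real" where
  "generator_mean s = (LINT \<omega>|M. f'' (R s \<omega>) / 2 + g (R s \<omega>))"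

lemma integrable_generator: "0 \<le> s \<Longrightarrow> integrable M (\<lambda>\<omega>. f'' (R s \<omega>) / 2 + g (R s \<omega>))"
  by (intro Bochner_Integration.integrable_add integrable_divide_zero
      integrable_bounded_comp[OF f_measurable(3) bounds(3)]
      integrable_bounded_comp[OF f_measurable(4) g_bound] measurable_M)

lemma generator_mean_continuous: "continuous_on {0..} generator_mean"
  unfolding generator_mean_def[abs_def]
proof (rule continuous_on_integral_dominated[where g="\<lambda>_. C + C"])
  show "AE \<omega> in M. continuous_on {0..} (\<lambda>s. f'' (R s \<omega>) / 2 + g (R s \<omega>))"
    using R_cont
  proof eventually_elim
    case (elim \<omega>)
    show ?case
      by (intro continuous_intros continuous_on_compose2[OF DERIV_continuous_on[OF f(3)] elim]
          continuous_on_compose2[OF g_cont elim]) auto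
  qed
  show "AE \<omega> in M. \<bar>f'' (R s \<omega>) / 2 + g (R s \<omega>)\<bar> \<le> C + C" for s
  proof (rule AE_I2)
    fix \<omega>
    have "\<bar>f'' (R s \<omega>) / 2\<bar> \<le> C" using bounds(3)[of "R s \<omega>"] by simp
    then show "\<bar>f'' (R s \<omega>) / 2 + g (R s \<omega>)\<bar> \<le> C + C" using g_bound[of "R s \<omega>"] by linarith
  qed
qed (auto intro: borel_measurable_integrable integrable_generator)

lemma R_start: "AE \<omega> in M. R 0 \<omega> = x"
  using R_eq bm_start[OF bm]
proof eventually_elim
  case (elim \<omega>)
  then show ?case using set_integral_Icc_self[of 0] by (auto simp del: atLeastAtMost_singleton)
qed

lemma paths:
  assumes t: "0 < t" and K: "0 \<le> K"
  shows "AE \<omega> in M. (\<forall>p q. 0 \<le> p \<longrightarrow> p \<le> q \<longrightarrow> min (drift p \<omega>) K \<le> min (drift q \<omega>) K) \<and>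
     min (drift 0 \<omega>) K = 0 \<and>
     (\<exists>u. (\<lambda>n. \<Sum>i<n. (f (capped K (real (Suc i) * t / real n) \<omega>)
               - f (capped K (real i * t / real n) \<omega> + (B (real (Suc i) * t / real n) \<omega> - B (real i * t / real n) \<omega>)))
             + t / real n * (f'' (capped K (real i * t / real n) \<omega>) / 2)
             - t / real n * (f'' (R (real i * t / real n) \<omega>) / 2 + g (R (real i * t / real n) \<omega>))) \<longlonglongrightarrow> u
        \<and> \<bar>u\<bar> \<le> (if K < drift t \<omega> then 2 * C * t else 0))"
proof -
  have "AE \<omega> in M. continuous_on {0..} (\<lambda>s. B s \<omega>)"
    using bm by (simp add: standard_brownian_motion_def)
  then show ?thesis using R_cont R_nonneg R_nz R_eq
  proof eventually_elim
    case (elim \<omega>)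
    have r0: "0 \<le> R s \<omega>" and ri: "set_integrable lborel {0..s} (\<lambda>u. coth (R u \<omega>))"
      and re: "R s \<omega> = x + B s \<omega> + \<kappa> * (LINT u:{0..s}|lborel. coth (R u \<omega>))" if "0 \<le> s" for s
      using elim that by auto
    note P = t \<kappa> K elim(1,2) r0 elim(4) ri re
    show ?case
    proof (intro conjI allI impI)
      show "min (drift p \<omega>) K \<le> min (drift q \<omega>) K" if "0 \<le> p" "p \<le> q" for p q
        by (rule truncated_drift_mono[where d="\<lambda>s. drift s \<omega>" and a="\<lambda>s. min (drift s \<omega>) K"
              and y="\<lambda>s. capped K s \<omega>" and b="\<lambda>s. B s \<omega>" and r="\<lambda>s. R s \<omega>", OF P])
          (use that in \<open>auto simp: drift_def capped_def\<close>)
      show "min (drift 0 \<omega>) K = 0"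
        by (rule truncated_drift_0[where d="\<lambda>s. drift s \<omega>" and a="\<lambda>s. min (drift s \<omega>) K"
              and y="\<lambda>s. capped K s \<omega>" and b="\<lambda>s. B s \<omega>" and r="\<lambda>s. R s \<omega>", OF P])
          (auto simp: drift_def capped_def)
      show "\<exists>u. (\<lambda>n. \<Sum>i<n. (f (capped K (real (Suc i) * t / real n) \<omega>)
               - f (capped K (real i * t / real n) \<omega> + (B (real (Suc i) * t / real n) \<omega> - B (real i * t / real n) \<omega>)))
             + t / real n * (f'' (capped K (real i * t / real n) \<omega>) / 2)
             - t / real n * (f'' (R (real i * t / real n) \<omega>) / 2 + g (R (real i * t / real n) \<omega>))) \<longlonglongrightarrow> u
        \<and> \<bar>u\<bar> \<le> (if K < drift t \<omega> then 2 * C * t else 0)"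
        by (rule truncated_drift_error_tendsto[where d="\<lambda>s. drift s \<omega>" and a="\<lambda>s. min (drift s \<omega>) K"
              and y="\<lambda>s. capped K s \<omega>" and b="\<lambda>s. B s \<omega>" and r="\<lambda>s. R s \<omega>", OF P _ _ _ f(1,2)
              DERIV_continuous_on[OF f(3)] g_cont bounds(2,3) g_bound g])
          (auto simp: drift_def capped_def)
    qed
  qed
qed

definition overshoot :: "real \<Rightarrow> real \<Rightarrow> real" where
  "overshoot K t = (LINT \<omega>|M. (if K < drift t \<omega> then 1 else 0))"

text \<open>
  The mean of the discretisation error \<open>U n\<close> converges to the left-hand side without the absolute
  value, by telescoping and the expansion for Brownian increments.  On the other hand, path by path
  the limit of \<open>\<bar>U n\<bar>\<close> is at most \<open>2 C t\<close> times the indicator of \<open>D\<^sub>t > K\<close>, and the cap \<open>K\<close> makes \<open>U n\<close>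
  bounded uniformly in \<open>n\<close>, so that dominated convergence applies.
\<close>

lemma truncated_dynkin:
  assumes t: "0 < t" and K: "0 \<le> K"
  shows "\<bar>(LINT \<omega>|M. f (capped K t \<omega>)) - f x - (LINT s:{0..t}|lborel. generator_mean s)\<bar> \<le> 2 * C * t * overshoot K t"
proof -
  define s where "s n i = real i * t / real n" for n i :: nat
  have s0: "s n 0 = 0" and sn: "0 < n \<Longrightarrow> s n n = t" for n by (auto simp: s_def)
  have s_nonneg: "0 \<le> s n i" for n i using t by (simp add: s_def)
  have s_diff: "s n (Suc i) - s n i = t / real n" for n i
    by (simp add: s_def distrib_right add_divide_distrib)
  define D where "D n i \<omega> = B (s n (Suc i)) \<omega> - B (s n i) \<omega>" for n i \<omega>
  define U where "U n \<omega> = (\<Sum>i<n. (f (capped K (s n (Suc i)) \<omega>) - f (capped K (s n i) \<omega> + D n i \<omega>))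
             + t / real n * (f'' (capped K (s n i) \<omega>) / 2)
             - t / real n * (f'' (R (s n i) \<omega>) / 2 + g (R (s n i) \<omega>)))" for n \<omega>
  \<comment> \<open>The pathwise bound for the limit of \<open>\<bar>U n\<bar>\<close>.\<close>
  define h where "h \<omega> = 2 * C * t * (if K < drift t \<omega> then 1 else 0)" for \<omega>
  note paths' = paths[OF t K, folded s_def, folded D_def, folded U_def]
  have [measurable]: "f \<in> borel_measurable borel" "f'' \<in> borel_measurable borel" "g \<in> borel_measurable borel"
    using f_measurable by auto
  have [measurable]: "R (s n i) \<in> borel_measurable M" "B (s n i) \<in> borel_measurable M" "capped K (s n i) \<in> borel_measurable M" for n i
    using measurable_M[OF s_nonneg] by auto
  have D_meas[measurable]: "D n i \<in> borel_measurable M" for n i unfolding D_def[abs_def] by measurable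
  have [measurable]: "drift t \<in> borel_measurable M" using measurable_M(3)[of t] t by simp
  have h_meas[measurable]: "h \<in> borel_measurable M" unfolding h_def[abs_def] by measurable
  have U_meas[measurable]: "U n \<in> borel_measurable M" for n unfolding U_def[abs_def] by measurable
  have h_nonneg: "0 \<le> h \<omega>" for \<omega> using C_nonneg t by (simp add: h_def)
  have h_int: "integrable M h"
    by (rule integrable_const_bound[where B="2 * C * t"]) (use C_nonneg t in \<open>auto simp: h_def\<close>)
  have h_mean: "(LINT \<omega>|M. h \<omega>) = 2 * C * t * overshoot K t" by (simp add: h_def overshoot_def)

  have U_bound: "AE \<omega> in M. \<bar>U n \<omega>\<bar> \<le> C * K + 2 * C * t" for n
    using paths'
  proof eventually_elim
    case (elim \<omega>)
    show ?case
    proof (cases "n = 0")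
      case True
      then show ?thesis using C_nonneg K t by (simp add: U_def)
    next
      case False
      then have n: "0 < real n" "s n n = t" using sn by auto
      define a where "a i = min (drift (s n i) \<omega>) K" for i
      have a_mono: "a i \<le> a (Suc i)" for i
        using elim s_nonneg[of n i] s_diff[of n i] n t unfolding a_def
        by (metis diff_ge_0_iff_ge divide_nonneg_pos less_imp_le)
      have piece: "\<bar>(f (capped K (s n (Suc i)) \<omega>) - f (capped K (s n i) \<omega> + D n i \<omega>))
             + t / real n * (f'' (capped K (s n i) \<omega>) / 2)
             - t / real n * (f'' (R (s n i) \<omega>) / 2 + g (R (s n i) \<omega>))\<bar>
          \<le> C * (a (Suc i) - a i) + t / real n * (2 * C)" for i
      proof -
        have "capped K (s n (Suc i)) \<omega> - (capped K (s n i) \<omega> + D n i \<omega>) = a (Suc i) - a i"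
          by (simp add: capped_def D_def a_def)
        then have "\<bar>f (capped K (s n (Suc i)) \<omega>) - f (capped K (s n i) \<omega> + D n i \<omega>)\<bar> \<le> C * (a (Suc i) - a i)"
          using lipschitz_of_derivative_bound[OF f(1) bounds(2), of "capped K (s n (Suc i)) \<omega>" "capped K (s n i) \<omega> + D n i \<omega>"] a_mono[of i]
          by simp
        moreover have "\<bar>t / real n * (f'' (capped K (s n i) \<omega>) / 2 - (f'' (R (s n i) \<omega>) / 2 + g (R (s n i) \<omega>)))\<bar> \<le> t / real n * (2 * C)"
        proof -
          have "\<bar>f'' (capped K (s n i) \<omega>) / 2 - (f'' (R (s n i) \<omega>) / 2 + g (R (s n i) \<omega>))\<bar> \<le> 2 * C"
            using bounds(3)[of "capped K (s n i) \<omega>"] bounds(3)[of "R (s n i) \<omega>"] g_bound[of "R (s n i) \<omega>"] by linarith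
          then show ?thesis using t n by (simp only: abs_mult abs_of_nonneg divide_nonneg_pos less_imp_le mult_left_mono)
        qed
        ultimately show ?thesis unfolding right_diff_distrib by linarith
      qed
      have "\<bar>U n \<omega>\<bar> \<le> (\<Sum>i<n. C * (a (Suc i) - a i) + t / real n * (2 * C))"
        unfolding U_def by (rule order_trans[OF sum_abs]) (intro sum_mono piece)
      also have "\<dots> = C * (a n - a 0) + 2 * C * t"
        using n sum_lessThan_telescope[of a n] by (simp add: sum.distrib flip: sum_distrib_left)
      also have "\<dots> \<le> C * K + 2 * C * t"
        using elim C_nonneg by (simp add: a_def s0 mult_left_mono)
      finally show ?thesis .
    qed
  qed
  have U_int: "integrable M (U n)" for n
    by (rule integrable_const_bound[where B="C * K + 2 * C * t"]) (use U_bound in auto)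

  \<comment> \<open>The limit of \<open>U n \<omega>\<close> is known only to be bounded by \<open>h \<omega>\<close>, so the excess over \<open>h\<close> is what vanishes.\<close>
  have "(\<lambda>n. LINT \<omega>|M. max (\<bar>U n \<omega>\<bar> - h \<omega>) 0) \<longlonglongrightarrow> (LINT \<omega>|M. 0)"
  proof (rule integral_dominated_convergence[where w="\<lambda>_. C * K + 2 * C * t"])
    show "AE \<omega> in M. (\<lambda>n. max (\<bar>U n \<omega>\<bar> - h \<omega>) 0) \<longlonglongrightarrow> 0"
      using paths'
    proof eventually_elim
      case (elim \<omega>)
      then obtain u where u: "(\<lambda>n. U n \<omega>) \<longlonglongrightarrow> u" "\<bar>u\<bar> \<le> (if K < drift t \<omega> then 2 * C * t else 0)" by blast
      have "h \<omega> = (if K < drift t \<omega> then 2 * C * t else 0)" by (simp add: h_def)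
      with u have u: "(\<lambda>n. U n \<omega>) \<longlonglongrightarrow> u" "\<bar>u\<bar> \<le> h \<omega>" by auto
      have "(\<lambda>n. max (\<bar>U n \<omega>\<bar> - h \<omega>) 0) \<longlonglongrightarrow> max (\<bar>u\<bar> - h \<omega>) 0"
        by (intro tendsto_intros u(1))
      moreover have "max (\<bar>u\<bar> - h \<omega>) 0 = 0" using u(2) by simp
      ultimately show ?case by simp
    qed
    show "AE \<omega> in M. norm (max (\<bar>U n \<omega>\<bar> - h \<omega>) 0) \<le> C * K + 2 * C * t" for n
      using U_bound[of n]
    proof eventually_elim
      case (elim \<omega>)
      then show ?case using h_nonneg[of \<omega>] by simp
    qed
  qed auto
  then have V: "(\<lambda>n. (LINT \<omega>|M. max (\<bar>U n \<omega>\<bar> - h \<omega>) 0) + 2 * C * t * overshoot K t) \<longlonglongrightarrow> 0 + 2 * C * t * overshoot K t"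
    by (intro tendsto_add tendsto_const) simp
  have U_le: "\<bar>LINT \<omega>|M. U n \<omega>\<bar> \<le> (LINT \<omega>|M. max (\<bar>U n \<omega>\<bar> - h \<omega>) 0) + 2 * C * t * overshoot K t" for n
  proof -
    have im: "integrable M (\<lambda>\<omega>. max (\<bar>U n \<omega>\<bar> - h \<omega>) 0)"
      by (intro integrable_max Bochner_Integration.integrable_diff integrable_abs U_int h_int) simp
    have "\<bar>LINT \<omega>|M. U n \<omega>\<bar> \<le> (LINT \<omega>|M. \<bar>U n \<omega>\<bar>)" by (rule integral_abs_bound)
    also have "\<dots> \<le> (LINT \<omega>|M. max (\<bar>U n \<omega>\<bar> - h \<omega>) 0 + h \<omega>)"
      by (intro integral_mono integrable_abs U_int Bochner_Integration.integrable_add im h_int) auto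
    also have "\<dots> = (LINT \<omega>|M. max (\<bar>U n \<omega>\<bar> - h \<omega>) 0) + 2 * C * t * overshoot K t"
      using im h_int by (simp add: h_mean)
    finally show ?thesis .
  qed

  define err where "err n = (\<Sum>i<n. (LINT \<omega>|M. f (capped K (s n i) \<omega> + D n i \<omega>) - f (capped K (s n i) \<omega>))
      - t / real n * (LINT \<omega>|M. f'' (capped K (s n i) \<omega>) / 2))" for n
  have err_bound: "norm (err n) \<le> real n * (C * (cubic_moment * sqrt (t / real n) ^ 3))" if n: "0 < n" for n
  proof -
    have "norm (err n) \<le> (\<Sum>i<n. C * (cubic_moment * sqrt (t / real n) ^ 3))"
      unfolding err_def
    proof (rule sum_norm_le)
      fix i
      have "s n i < s n (Suc i)" using s_diff[of n i] t n by (metis diff_gt_0_iff_gt divide_pos_pos of_nat_0_less_iff)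
      from bm_increment_expansion[OF fp bm s_nonneg this capped_adapted[OF s_nonneg] f bounds]
      show "norm ((LINT \<omega>|M. f (capped K (s n i) \<omega> + D n i \<omega>) - f (capped K (s n i) \<omega>))
           - t / real n * (LINT \<omega>|M. f'' (capped K (s n i) \<omega>) / 2)) \<le> C * (cubic_moment * sqrt (t / real n) ^ 3)"
        unfolding s_diff D_def real_norm_def .
    qed
    then show ?thesis by simp
  qed
  have "(\<lambda>n. real n * (C * (cubic_moment * sqrt (t / real n) ^ 3))) \<longlonglongrightarrow> 0"
    using t by real_asymp
  then have err: "err \<longlonglongrightarrow> 0"
    by (rule Lim_null_comparison[rotated]) (use eventually_gt_at_top[of 0] in eventually_elim, rule err_bound)

  have mean: "(LINT \<omega>|M. U n \<omega>) = (LINT \<omega>|M. f (capped K t \<omega>)) - f x - err n - (\<Sum>i<n. t / real n * generator_mean (s n i))"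
    if n: "0 < n" for n
  proof -
    have i1: "integrable M (\<lambda>\<omega>. f (capped K (s n i) \<omega>))" for i
      by (rule integrable_bounded_comp[OF _ bounds(1)]) auto
    have i2: "integrable M (\<lambda>\<omega>. f (capped K (s n i) \<omega> + D n i \<omega>))" for i
      by (rule integrable_bounded_comp[OF _ bounds(1)]) auto
    have i3: "integrable M (\<lambda>\<omega>. f'' (capped K (s n i) \<omega>) / 2)" for i
      by (intro integrable_divide_zero integrable_bounded_comp[OF _ bounds(3)]) auto
    have i4: "integrable M (\<lambda>\<omega>. f'' (R (s n i) \<omega>) / 2 + g (R (s n i) \<omega>))" for i
      by (rule integrable_generator[OF s_nonneg])
    have "(LINT \<omega>|M. U n \<omega>) = (\<Sum>i<n. ((LINT \<omega>|M. f (capped K (s n (Suc i)) \<omega>)) - (LINT \<omega>|M. f (capped K (s n i) \<omega> + D n i \<omega>)))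
             + t / real n * (LINT \<omega>|M. f'' (capped K (s n i) \<omega>) / 2) - t / real n * generator_mean (s n i))"
      unfolding U_def generator_mean_def
      by (intro has_bochner_integral_integral_eq has_bochner_integral_sum has_bochner_integral_diff
          has_bochner_integral_add has_bochner_integral_mult_right has_bochner_integral_integrable i1 i2 i3 i4)
    also have "\<dots> = (\<Sum>i<n. (LINT \<omega>|M. f (capped K (s n (Suc i)) \<omega>)) - (LINT \<omega>|M. f (capped K (s n i) \<omega>))) - err n
       - (\<Sum>i<n. t / real n * generator_mean (s n i))"
      unfolding err_def sum_subtractf[symmetric]
      by (intro sum.cong refl) (simp add: i1 i2)
    also have "(\<Sum>i<n. (LINT \<omega>|M. f (capped K (s n (Suc i)) \<omega>)) - (LINT \<omega>|M. f (capped K (s n i) \<omega>)))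
       = (LINT \<omega>|M. f (capped K t \<omega>)) - (LINT \<omega>|M. f (capped K 0 \<omega>))"
      using sum_lessThan_telescope[of "\<lambda>i. LINT \<omega>|M. f (capped K (s n i) \<omega>)" n] by (simp add: s0 sn n)
    also have "(LINT \<omega>|M. f (capped K 0 \<omega>)) = (LINT \<omega>|M. f x)"
    proof (rule integral_cong_AE)
      show "AE \<omega> in M. f (capped K 0 \<omega>) = f x"
        using paths' bm_start[OF bm] by eventually_elim (simp add: capped_def)
    qed (use measurable_M[of 0] in auto)
    finally show ?thesis by (simp add: prob_space)
  qed
  have "(\<lambda>n. \<Sum>i<n. t / real n * generator_mean (s n i)) \<longlonglongrightarrow> (LINT u:{0..t}|lborel. generator_mean u)"
    unfolding s_def
    by (rule riemann_sum_tendsto[OF t continuous_on_subset[OF generator_mean_continuous]]) auto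
  from tendsto_diff[OF tendsto_diff[OF tendsto_const err] this]
  have lim: "(\<lambda>n. LINT \<omega>|M. U n \<omega>) \<longlonglongrightarrow> (LINT \<omega>|M. f (capped K t \<omega>)) - f x - 0 - (LINT u:{0..t}|lborel. generator_mean u)"
    by (rule Lim_transform_eventually) (use eventually_gt_at_top[of 0] in eventually_elim, rule mean[symmetric])
  show ?thesis
    using LIMSEQ_le[OF tendsto_rabs[OF lim] V] U_le by auto
qed

lemma overshoot_tendsto: "0 < t \<Longrightarrow> (\<lambda>K. overshoot (real K) t) \<longlonglongrightarrow> 0"
proof -
  assume "0 < t"
  then have [measurable]: "drift t \<in> borel_measurable M" using measurable_M(3)[of t] by simp
  have "(\<lambda>K. LINT \<omega>|M. (if real K < drift t \<omega> then 1 else 0)) \<longlonglongrightarrow> (LINT \<omega>|M. (0 :: real))"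
  proof (rule integral_dominated_convergence[where w="\<lambda>_. 1"])
    show "AE \<omega> in M. (\<lambda>K. (if real K < drift t \<omega> then 1 else 0)) \<longlonglongrightarrow> (0 :: real)"
    proof (rule AE_I2)
      fix \<omega>
      obtain N :: nat where "drift t \<omega> < real N" using reals_Archimedean2 by blast
      then have "eventually (\<lambda>K. (if real K < drift t \<omega> then 1 else 0) = (0 :: real)) sequentially"
        by (intro eventually_sequentiallyI[of N]) auto
      then show "(\<lambda>K. (if real K < drift t \<omega> then 1 else 0)) \<longlonglongrightarrow> (0 :: real)" by (rule tendsto_eventually)
    qed
  qed auto
  then show ?thesis by (simp add: overshoot_def)
qed

theorem dynkin:
  assumes "0 \<le> t"
  shows "(LINT \<omega>|M. f (R t \<omega>)) = f x + (LINT s:{0..t}|lborel. generator_mean s)"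
proof (cases "t = 0")
  case True
  have "(LINT \<omega>|M. f (R 0 \<omega>)) = (LINT \<omega>|M. f x)"
    by (rule integral_cong_AE) (use R_start measurable_M[of 0] f_measurable in auto)
  then show ?thesis using True set_integral_Icc_self[of 0]
    by (simp add: prob_space del: atLeastAtMost_singleton)
next
  case False
  then have t: "0 < t" using assms by simp
  let ?e = "(LINT \<omega>|M. f (R t \<omega>)) - f x - (LINT s:{0..t}|lborel. generator_mean s)"
  have [measurable]: "drift t \<in> borel_measurable M" "R t \<in> borel_measurable M" "capped K t \<in> borel_measurable M" for K
    using measurable_M[of t] t by auto
  have le: "\<bar>?e\<bar> \<le> (2 * C + 2 * C * t) * overshoot (real K) t" for K
  proof -
    have i1: "integrable M (\<lambda>\<omega>. f (R t \<omega>))" "integrable M (\<lambda>\<omega>. f (capped (real K) t \<omega>))"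
      by (rule integrable_bounded_comp[OF f_measurable(1) bounds(1)]; simp)+
    have i2: "integrable M (\<lambda>\<omega>. 2 * C * (if real K < drift t \<omega> then 1 else 0))"
      by (rule integrable_const_bound[where B="2 * C"]) (use C_nonneg in auto)
    have "\<bar>(LINT \<omega>|M. f (R t \<omega>)) - (LINT \<omega>|M. f (capped (real K) t \<omega>))\<bar> = \<bar>LINT \<omega>|M. f (R t \<omega>) - f (capped (real K) t \<omega>)\<bar>"
      using i1 by simp
    also have "\<dots> \<le> (LINT \<omega>|M. \<bar>f (R t \<omega>) - f (capped (real K) t \<omega>)\<bar>)" by (rule integral_abs_bound)
    also have "\<dots> \<le> (LINT \<omega>|M. 2 * C * (if real K < drift t \<omega> then 1 else 0))"
    proof (rule integral_mono)
      fix \<omega>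
      show "\<bar>f (R t \<omega>) - f (capped (real K) t \<omega>)\<bar> \<le> 2 * C * (if real K < drift t \<omega> then 1 else 0)"
      proof (cases "real K < drift t \<omega>")
        case True
        then show ?thesis using bounds(1)[of "R t \<omega>"] bounds(1)[of "capped (real K) t \<omega>"] by simp
      next
        case False
        then have "capped (real K) t \<omega> = R t \<omega>" by (simp add: capped_def drift_def)
        then show ?thesis using False by simp
      qed
    qed (use i1 i2 in auto)
    also have "\<dots> = 2 * C * overshoot (real K) t" by (simp add: overshoot_def)
    finally have "\<bar>(LINT \<omega>|M. f (R t \<omega>)) - (LINT \<omega>|M. f (capped (real K) t \<omega>))\<bar> \<le> 2 * C * overshoot (real K) t" .
    with truncated_dynkin[OF t, of "real K"] show ?thesis
      by (simp add: distrib_right)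
  qed
  have "(\<lambda>K. (2 * C + 2 * C * t) * overshoot (real K) t) \<longlonglongrightarrow> (2 * C + 2 * C * t) * 0"
    by (intro tendsto_mult_left overshoot_tendsto t)
  then have "\<bar>?e\<bar> \<le> (2 * C + 2 * C * t) * 0"
    by (rule LIMSEQ_le_const) (use le in blast)
  then show ?thesis by simp
qed

end

section \<open>The Laplace transform of the hyperbolic cosine of the process\<close>

text \<open>
  The second and third bounds come from the first one, applied to \<open>w / 2\<close> and \<open>w / 3\<close>.
\<close>

lemma mult_exp_minus_le:
  fixes w :: real
  assumes "0 \<le> w"
  shows "w * exp (- w) \<le> 1" "w\<^sup>2 * exp (- w) \<le> 4" "w ^ 3 * exp (- w) \<le> 27"
proof -
  have 1: "u * exp (- u) \<le> 1" for u :: real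
  proof -
    have "u \<le> exp u" using exp_ge_add_one_self[of u] by linarith
    then have "u * exp (- u) \<le> exp u * exp (- u)" by (intro mult_right_mono) auto
    then show ?thesis by (simp add: mult_exp_exp)
  qed
  show "w * exp (- w) \<le> 1" by (rule 1)
  have e2: "exp (- w) = exp (- (w / 2)) ^ 2" and e3: "exp (- w) = exp (- (w / 3)) ^ 3"
    by (simp_all flip: exp_of_nat_mult)
  have "(w / 2 * exp (- (w / 2))) ^ 2 \<le> 1 ^ 2" by (intro power_mono 1) (use assms in auto)
  then show "w\<^sup>2 * exp (- w) \<le> 4" by (simp add: e2 power_mult_distrib power_divide)
  have "(w / 3 * exp (- (w / 3))) ^ 3 \<le> 1 ^ 3" by (intro power_mono 1) (use assms in auto)
  then show "w ^ 3 * exp (- w) \<le> 27" by (simp add: e3 power_mult_distrib power_divide)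
qed

text \<open>
  The functions \<open>exp (- w)\<close> with \<open>w = l cosh v\<close> and its first three derivatives in \<open>v\<close>.  Powers of \<open>w\<close> are
  absorbed by \<open>exp (- w)\<close>, so one constant serves for all \<open>l\<close>.
\<close>

lemma exp_cosh_derivative_bounds:
  fixes l v :: real
  assumes l: "0 < l"
  defines "w \<equiv> l * cosh v" and "S \<equiv> l * sinh v"
  shows "\<bar>exp (- w)\<bar> \<le> 40" "\<bar>- S * exp (- w)\<bar> \<le> 40" "\<bar>(S\<^sup>2 - w) * exp (- w)\<bar> \<le> 40"
    "\<bar>(- (S ^ 3) + 3 * S * w - S) * exp (- w)\<bar> \<le> 40" "\<bar>w * exp (- w)\<bar> \<le> 1"
proof -
  have w: "0 \<le> w" using l by (simp add: w_def)
  have Sw: "\<bar>S\<bar> \<le> w" unfolding w_def S_def abs_mult using l abs_sinh_le_cosh[of v] by (intro mult_mono) auto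
  \<comment> \<open>The constant \<open>40\<close> is \<open>27 + 3 \<cdot> 4 + 1\<close>, from the three bounds on \<open>w\<^sup>j exp (- w)\<close>.\<close>
  note W = mult_exp_minus_le[OF w]
  show "\<bar>exp (- w)\<bar> \<le> 40" using w by simp (meson exp_le_one_iff le_numeral_extra(4) neg_le_0_iff_le one_le_numeral order_trans)
  show "\<bar>w * exp (- w)\<bar> \<le> 1" using W(1) w by simp
  have le: "\<bar>q * exp (- w)\<bar> \<le> 40" if "\<bar>q\<bar> * exp (- w) \<le> 40" for q using that by (simp add: abs_mult)
  have S2: "S\<^sup>2 \<le> w\<^sup>2" using power_mono[OF Sw, of 2] by simp
  have S3: "\<bar>S\<bar> ^ 3 \<le> w ^ 3" using power_mono[OF Sw, of 3] by simp
  show "\<bar>- S * exp (- w)\<bar> \<le> 40"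
  proof (rule le)
    have "\<bar>- S\<bar> * exp (- w) \<le> w * exp (- w)" using Sw by (intro mult_right_mono) auto
    then show "\<bar>- S\<bar> * exp (- w) \<le> 40" using W(1) by linarith
  qed
  show "\<bar>(S\<^sup>2 - w) * exp (- w)\<bar> \<le> 40"
  proof (rule le)
    have "\<bar>S\<^sup>2 - w\<bar> * exp (- w) \<le> (w\<^sup>2 + w) * exp (- w)"
      using S2 w by (intro mult_right_mono) (auto simp: abs_le_iff add_increasing)
    then show "\<bar>S\<^sup>2 - w\<bar> * exp (- w) \<le> 40" using W(1,2) by (simp add: distrib_right)
  qed
  show "\<bar>(- (S ^ 3) + 3 * S * w - S) * exp (- w)\<bar> \<le> 40"
  proof (rule le)
    have "\<bar>- (S ^ 3) + 3 * S * w - S\<bar> \<le> \<bar>S\<bar> ^ 3 + 3 * (\<bar>S\<bar> * w) + \<bar>S\<bar>"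
    proof -
      have "\<bar>S * w\<bar> = \<bar>S\<bar> * w" using w by (simp add: abs_mult)
      then show ?thesis unfolding power_abs[symmetric] by linarith
    qed
    also have "\<dots> \<le> w ^ 3 + 3 * (w * w) + w"
      using S3 Sw w mult_right_mono[OF Sw w] by linarith
    finally have "\<bar>- (S ^ 3) + 3 * S * w - S\<bar> * exp (- w) \<le> (w ^ 3 + 3 * w\<^sup>2 + w) * exp (- w)"
      by (intro mult_right_mono) (auto simp: power2_eq_square)
    also have "\<dots> = w ^ 3 * exp (- w) + 3 * (w\<^sup>2 * exp (- w)) + w * exp (- w)"
      by (simp add: distrib_right)
    finally show "\<bar>- (S ^ 3) + 3 * S * w - S\<bar> * exp (- w) \<le> 40" using W by linarith
  qed
qed

locale hyperbolic_bessel =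
  fixes M :: "'a measure" and F :: "real \<Rightarrow> 'a measure" and B R :: "real \<Rightarrow> 'a \<Rightarrow> real"
    and k :: nat and x :: real
  assumes fp: "filtered_prob_space M F" and bm: "standard_brownian_motion M F B"
    and k: "0 < k"
    and hb: "hyperbolic_bessel_process M F B (real k - 1 / 2) x R"
begin

sublocale prob_space M using fp by (simp add: filtered_prob_space_def)

lemma R_measurable: "0 \<le> s \<Longrightarrow> R s \<in> borel_measurable M"
  using hb fp unfolding hyperbolic_bessel_process_def filtered_prob_space_def
  by (meson measurable_from_subalg)

lemma R_cont: "AE \<omega> in M. continuous_on {0..} (\<lambda>s. R s \<omega>)"
  using hb by (simp add: hyperbolic_bessel_process_def)

text \<open>
  With \<open>w = lam cosh R\<^sub>s\<close>, the means of \<open>w\<^sup>j exp (- w)\<close>.  The case \<open>j = 0\<close> is the expectation in question;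
  starting from it, two differentiations in \<open>y = ln lam\<close> and the generator both lead to combinations of
  the moments with \<open>j \<le> 2\<close>.
\<close>

definition moment :: "nat \<Rightarrow> real \<Rightarrow> real \<Rightarrow> real" where
  "moment j s y = (LINT \<omega>|M. (exp y * cosh (R s \<omega>)) ^ j * exp (- (exp y * cosh (R s \<omega>))))"

lemma moment_integrand_bound:
  assumes "j \<le> 3"
  shows "\<bar>(exp y * cosh (r :: real)) ^ j * exp (- (exp y * cosh r))\<bar> \<le> 27"
proof -
  define w where "w = exp y * cosh r"
  have w: "0 \<le> w" by (simp add: w_def)
  consider "j = 0" | "j = 1" | "j = 2" | "j = 3" using assms by linarith
  then have "w ^ j * exp (- w) \<le> 27"
    using mult_exp_minus_le[OF w] w by cases (auto intro: order_trans[of _ 1])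
  then show ?thesis using w unfolding w_def[symmetric] by (simp add: abs_mult)
qed

lemma moment_integrable:
  assumes "0 \<le> s" "j \<le> 3"
  shows "integrable M (\<lambda>\<omega>. (exp y * cosh (R s \<omega>)) ^ j * exp (- (exp y * cosh (R s \<omega>))))"
proof (rule integrable_const_bound[where B=27])
  note R_measurable[OF assms(1), measurable]
  have [measurable]: "cosh \<in> borel_measurable (borel :: real measure)"
    by (intro borel_measurable_continuous_onI continuous_intros)
  show "(\<lambda>\<omega>. (exp y * cosh (R s \<omega>)) ^ j * exp (- (exp y * cosh (R s \<omega>)))) \<in> borel_measurable M" by measurable
qed (use moment_integrand_bound[OF assms(2)] in auto)

lemma moment_has_derivative:
  assumes s: "0 \<le> s" and j: "j \<le> 2"
  shows "((\<lambda>y. moment j s y) has_real_derivative real j * moment j s y - moment (Suc j) s y) (at y)"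
proof -
  let ?w = "\<lambda>y \<omega>. exp y * cosh (R s \<omega>)"
  have "((\<lambda>y. LINT \<omega>|M. ?w y \<omega> ^ j * exp (- ?w y \<omega>)) has_real_derivative
     (LINT \<omega>|M. real j * (?w y \<omega> ^ j * exp (- ?w y \<omega>)) - ?w y \<omega> ^ Suc j * exp (- ?w y \<omega>))) (at y within UNIV)"
  proof (rule has_real_derivative_integral_dominated[where g="\<lambda>_. real j * 27 + 27"])
    show "\<bar>real j * (?w y \<omega> ^ j * exp (- ?w y \<omega>)) - ?w y \<omega> ^ Suc j * exp (- ?w y \<omega>)\<bar> \<le> real j * 27 + 27" for y \<omega>
    proof -
      have "\<bar>real j * (?w y \<omega> ^ j * exp (- ?w y \<omega>))\<bar> \<le> real j * 27"
        unfolding abs_mult[of "real j"] using moment_integrand_bound[of j y "R s \<omega>"] j by (intro mult_mono) auto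
      moreover have "\<bar>?w y \<omega> ^ Suc j * exp (- ?w y \<omega>)\<bar> \<le> 27"
        using j by (intro moment_integrand_bound) auto
      ultimately show ?thesis by linarith
    qed
    show "((\<lambda>y. ?w y \<omega> ^ j * exp (- ?w y \<omega>)) has_real_derivative
       real j * (?w y \<omega> ^ j * exp (- ?w y \<omega>)) - ?w y \<omega> ^ Suc j * exp (- ?w y \<omega>)) (at y within UNIV)" for y \<omega>
    proof -
      consider "j = 0" | "j = 1" | "j = 2" using j by linarith
      then show ?thesis
        by cases (auto intro!: derivative_eq_intros simp: algebra_simps power2_eq_square numeral_2_eq_2)
    qed
    show "(\<lambda>\<omega>. real j * (?w y \<omega> ^ j * exp (- ?w y \<omega>)) - ?w y \<omega> ^ Suc j * exp (- ?w y \<omega>)) \<in> borel_measurable M"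
      using s j by (intro borel_measurable_integrable Bochner_Integration.integrable_diff integrable_mult_right moment_integrable) auto
  qed (use s j in \<open>auto intro!: moment_integrable\<close>)
  also have "(LINT \<omega>|M. real j * (?w y \<omega> ^ j * exp (- ?w y \<omega>)) - ?w y \<omega> ^ Suc j * exp (- ?w y \<omega>))
    = real j * moment j s y - moment (Suc j) s y"
    unfolding moment_def using moment_integrable[OF s, of j y] moment_integrable[OF s, of "Suc j" y] j
    by (subst Bochner_Integration.integral_diff) auto
  finally show ?thesis by (simp add: moment_def[abs_def])
qed

lemma moment_continuous: "continuous_on ({0..T} \<times> {-Y..Y}) (\<lambda>(s, y). moment 0 s y)"
proof -
  have "continuous_on ({0..T} \<times> {-Y..Y})
     (\<lambda>p. LINT \<omega>|M. (exp (snd p) * cosh (R (fst p) \<omega>)) ^ 0 * exp (- (exp (snd p) * cosh (R (fst p) \<omega>))))"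
  proof (rule continuous_on_integral_dominated[where g="\<lambda>_. 27"])
    show "AE \<omega> in M. continuous_on ({0..T} \<times> {-Y..Y})
       (\<lambda>p. (exp (snd p) * cosh (R (fst p) \<omega>)) ^ 0 * exp (- (exp (snd p) * cosh (R (fst p) \<omega>))))"
      using R_cont
    proof eventually_elim
      case (elim \<omega>)
      have "continuous_on ({0..T} \<times> {-Y..Y}) (\<lambda>p. R (fst p) \<omega>)"
        by (rule continuous_on_compose2[OF elim]) (auto intro!: continuous_intros)
      then show ?case by (intro continuous_intros)
    qed
    show "AE \<omega> in M. \<bar>(exp (snd p) * cosh (R (fst p) \<omega>)) ^ 0 * exp (- (exp (snd p) * cosh (R (fst p) \<omega>)))\<bar> \<le> 27" for p
      by (intro AE_I2 moment_integrand_bound) simp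
  qed (use moment_integrable[of _ 0] in \<open>auto intro!: borel_measurable_integrable\<close>)
  then show ?thesis by (simp add: moment_def case_prod_beta')
qed

lemma moment_0_bound: "\<bar>moment 0 s y\<bar> \<le> 1" if "0 \<le> s"
proof -
  have "0 \<le> moment 0 s y" unfolding moment_def by (intro Bochner_Integration.integral_nonneg) auto
  moreover have "moment 0 s y \<le> (LINT \<omega>|M. 1)"
    unfolding moment_def using moment_integrable[OF that, of 0 y] by (intro integral_mono) auto
  ultimately show ?thesis by (simp add: prob_space)
qed

text \<open>
  With \<open>f = exp (- w)\<close> one has \<open>f'' = (w\<^sup>2 - lam\<^sup>2 - w) f\<close> and \<open>f' coth = - w f\<close>, which gives the generator
  in terms of the moments.
\<close>

lemma moment_dynkin:
  defines "L \<equiv> \<lambda>s y. (moment 2 s y - (exp y)\<^sup>2 * moment 0 s y) / 2 - (1 / 2 + real k) * moment 1 s y"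
  shows "0 \<le> t \<Longrightarrow> moment 0 t y = exp (- (exp y * cosh x)) + (LINT s:{0..t}|lborel. L s y)"
    and "continuous_on {0..} (\<lambda>s. L s y)"
proof -
  define l where "l = exp y"
  have l: "0 < l" by (simp add: l_def)
  define f where "f v = exp (- (l * cosh v))" for v
  define f1 where "f1 v = - (l * sinh v) * exp (- (l * cosh v))" for v
  define f2 where "f2 v = ((l * sinh v)\<^sup>2 - l * cosh v) * exp (- (l * cosh v))" for v
  define f3 where "f3 v = (- ((l * sinh v) ^ 3) + 3 * (l * sinh v) * (l * cosh v) - l * sinh v) * exp (- (l * cosh v))" for v
  define g where "g v = - (real k * (l * cosh v * exp (- (l * cosh v))))" for v
  interpret dynkin_setting M F B R "real k" x f f1 f2 f3 g "40 + real k"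
  proof
    show "filtered_prob_space M F" "standard_brownian_motion M F B" by (fact fp bm)+
    show "0 < real k" using k by simp
    show "R s \<in> borel_measurable (F s)" if "0 \<le> s" for s
      using hb that by (simp add: hyperbolic_bessel_process_def)
    show "AE \<omega> in M. continuous_on {0..} (\<lambda>s. R s \<omega>)" by (rule R_cont)
    show "AE \<omega> in M. \<forall>s\<ge>0. 0 \<le> R s \<omega>"
      using hb by (simp add: hyperbolic_bessel_process_def)
    have sde: "AE \<omega> in M. (AE u in lborel. u \<ge> 0 \<longrightarrow> R u \<omega> \<noteq> 0) \<and>
        (\<forall>t\<ge>0. set_integrable lborel {0..t} (\<lambda>u. coth (R u \<omega>)) \<and>
               R t \<omega> = x + B t \<omega> + real k * (LINT u:{0..t}|lborel. coth (R u \<omega>)))"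
      using hb k by (simp add: hyperbolic_bessel_process_def)
    show "AE \<omega> in M. AE u in lborel. 0 \<le> u \<longrightarrow> R u \<omega> \<noteq> 0"
      using sde by eventually_elim (rule conjunct1)
    show "AE \<omega> in M. \<forall>s\<ge>0. set_integrable lborel {0..s} (\<lambda>u. coth (R u \<omega>)) \<and>
       R s \<omega> = x + B s \<omega> + real k * (LINT u:{0..s}|lborel. coth (R u \<omega>))"
      using sde by eventually_elim (rule conjunct2)
    show "(f has_real_derivative f1 v) (at v)" for v
      unfolding f_def f1_def by (auto intro!: derivative_eq_intros)
    show "(f1 has_real_derivative f2 v) (at v)" for v
      unfolding f1_def f2_def by (auto intro!: derivative_eq_intros simp: algebra_simps power2_eq_square)
    show "(f2 has_real_derivative f3 v) (at v)" for v
      unfolding f2_def f3_def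
      by (auto intro!: derivative_eq_intros simp: algebra_simps power2_eq_square power3_eq_cube)
    note bd = exp_cosh_derivative_bounds[OF l]
    show "\<bar>f v\<bar> \<le> 40 + real k" for v using bd(1)[of v] by (simp add: f_def)
    show "\<bar>f1 v\<bar> \<le> 40 + real k" for v using bd(2)[of v] unfolding f1_def by linarith
    show "\<bar>f2 v\<bar> \<le> 40 + real k" for v using bd(3)[of v] unfolding f2_def by linarith
    show "\<bar>f3 v\<bar> \<le> 40 + real k" for v using bd(4)[of v] unfolding f3_def by linarith
    show "continuous_on UNIV g" unfolding g_def by (intro continuous_intros)
    show "\<bar>g v\<bar> \<le> 40 + real k" for v
    proof -
      have "\<bar>g v\<bar> \<le> real k * 1"
        unfolding g_def abs_minus_cancel abs_mult[of "real k"] using bd(5)[of v] by (intro mult_mono) auto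
      then show ?thesis by simp
    qed
    show "g v = f1 v * (real k * coth v)" if "0 < v" for v
      using that by (simp add: g_def f1_def coth_def)
  qed
  have gm: "generator_mean s = L s y" if s: "0 \<le> s" for s
  proof -
    let ?w = "\<lambda>\<omega>. exp y * cosh (R s \<omega>)"
    have e: "f2 (R s \<omega>) / 2 + g (R s \<omega>) = (?w \<omega> ^ 2 * exp (- ?w \<omega>) - (exp y)\<^sup>2 * (?w \<omega> ^ 0 * exp (- ?w \<omega>))) / 2
         - (1 / 2 + real k) * (?w \<omega> ^ 1 * exp (- ?w \<omega>))" for \<omega>
      by (simp add: f2_def g_def l_def power_mult_distrib sinh_square_eq field_simps)
    show ?thesis
      unfolding generator_mean_def L_def moment_def e
      by (intro has_bochner_integral_integral_eq has_bochner_integral_diff has_bochner_integral_divide_zero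
          has_bochner_integral_mult_right has_bochner_integral_integrable moment_integrable s) auto
  qed
  show "moment 0 t y = exp (- (exp y * cosh x)) + (LINT s:{0..t}|lborel. L s y)" if "0 \<le> t"
  proof -
    have "(LINT s:{0..t}|lborel. generator_mean s) = (LINT s:{0..t}|lborel. L s y)"
      by (intro set_lebesgue_integral_cong) (auto simp: gm)
    then show ?thesis using dynkin[OF that] by (simp add: moment_def f_def l_def)
  qed
  show "continuous_on {0..} (\<lambda>s. L s y)"
    using generator_mean_continuous by (rule continuous_on_eq) (auto simp: gm)
qed

lemma moment_time_derivative:
  assumes s: "0 < s"
  shows "((\<lambda>s. moment 0 s y) has_real_derivative
    (moment 2 s y - (exp y)\<^sup>2 * moment 0 s y) / 2 - (1 / 2 + real k) * moment 1 s y) (at s)"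
proof -
  define L where "L s = (moment 2 s y - (exp y)\<^sup>2 * moment 0 s y) / 2 - (1 / 2 + real k) * moment 1 s y" for s
  have cont: "continuous_on {0..s + 1} L"
    using moment_dynkin(2)[of y] unfolding L_def[abs_def] by (rule continuous_on_subset) auto
  have "((\<lambda>u. integral {0..u} L) has_real_derivative L s) (at s within {0..s + 1})"
    using s by (intro integral_has_real_derivative cont) auto
  then have "((\<lambda>u. integral {0..u} L) has_real_derivative L s) (at s)"
    using s by (subst (asm) at_within_Icc_at) auto
  then have "((\<lambda>u. exp (- (exp y * cosh x)) + integral {0..u} L) has_real_derivative L s) (at s)"
    by (auto intro!: derivative_eq_intros)
  moreover have "\<forall>\<^sub>F u in nhds s. moment 0 u y = exp (- (exp y * cosh x)) + integral {0..u} L"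
  proof (rule eventually_mono[OF eventually_nhds_in_open[of "{0<..<s + 1}"]])
    fix u assume u: "u \<in> {0<..<s + 1}"
    have "set_integrable lborel {0..u} L"
      by (intro borel_integrable_atLeastAtMost' continuous_on_subset[OF cont]) (use u in auto)
    then have "(LINT s:{0..u}|lborel. L s) = integral {0..u} L" by (rule set_borel_integral_eq_integral)
    then show "moment 0 u y = exp (- (exp y * cosh x)) + integral {0..u} L"
      using moment_dynkin(1)[of u y] u unfolding L_def by simp
  qed (use s in auto)
  ultimately show ?thesis unfolding L_def[symmetric] by (subst DERIV_cong_ev[OF refl _ refl])
qed

text \<open>
  The factor \<open>exp (k\<^sup>2 s / 2) lam\<^sup>k\<close> removes the first order term: with \<open>\<partial> = \<partial>\<^sub>y\<close> the generator acts on the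
  Laplace transform as \<open>1/2 \<partial>\<^sup>2 + k \<partial> - 1/2 lam\<^sup>2\<close>, that is \<open>1/2 (\<partial> + k)\<^sup>2 - k\<^sup>2 / 2 - 1/2 lam\<^sup>2\<close>, and
  multiplication by \<open>lam\<^sup>k\<close> turns \<open>\<partial> + k\<close> into \<open>\<partial>\<close>.
\<close>

theorem laplace_transform_eq:
  assumes t: "0 \<le> t"
  shows "exp ((real k)\<^sup>2 / 2 * t) * exp (real k * y) * moment 0 t y = (- 1) ^ k * gauss_mean ((dC ^^ k) (H 0)) t y (cosh x)"
proof -
  let ?p = "(dC ^^ k) (H 0)"
  let ?c = "cosh x"
  let ?E = "\<lambda>s y. exp ((real k)\<^sup>2 / 2 * s) * exp (real k * y)"
  have c: "1 \<le> ?c" by (rule cosh_real_ge_1)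
  define d where "d s y = ?E s y * moment 0 s y - (- 1) ^ k * gauss_mean ?p s y ?c" for s y
  define dy where "dy s y = ?E s y * (real k * moment 0 s y - moment 1 s y) - (- 1) ^ k * gauss_mean (dY ?p) s y ?c" for s y
  define dyy where "dyy s y = ?E s y * ((real k)\<^sup>2 * moment 0 s y - (2 * real k + 1) * moment 1 s y + moment 2 s y)
     - (- 1) ^ k * gauss_mean (dY (dY ?p)) s y ?c" for s y
  obtain A a where A: "\<And>s y. 0 \<le> s \<Longrightarrow> s \<le> t \<Longrightarrow> \<bar>gauss_mean ?p s y ?c\<bar> \<le> A * exp (a * \<bar>y\<bar>)"
    using gauss_mean_growth[OF c, of t ?p] by blast
  have md0: "((\<lambda>y. moment 0 s y) has_real_derivative - moment 1 s y) (at y)"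
    and md1: "((\<lambda>y. moment 1 s y) has_real_derivative moment 1 s y - moment 2 s y) (at y)" if "0 < s" for s y
    using moment_has_derivative[of s 0 y] moment_has_derivative[of s 1 y] that by (simp_all add: numeral_2_eq_2)
  have "d t y = 0"
  proof (rule schroedinger_unique[where T=t and d=d and dy=dy and dyy=dyy
        and A="exp ((real k)\<^sup>2 / 2 * t) + \<bar>A\<bar>" and a="real k + \<bar>a\<bar>"])
    show "continuous_on ({0..t} \<times> {-Y..Y}) (\<lambda>(s, y). d s y)" for Y
      using moment_continuous[of t Y] gauss_mean_continuous[OF c, of t Y ?p]
      unfolding d_def case_prod_beta' by (intro continuous_intros)
    show "d 0 y = 0" for y
    proof -
      have "moment 0 0 y = exp (- (exp y * ?c))"
        using moment_dynkin(1)[of 0 y] set_integral_Icc_self[of 0] by (simp del: atLeastAtMost_singleton)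
      then show ?thesis
        by (simp add: d_def gauss_mean_initial exp_of_nat_mult power_mult_distrib[symmetric] flip: mult.assoc)
    qed
    show "((\<lambda>y. d s y) has_real_derivative dy s y) (at y)" if "0 < s" for s y
      unfolding d_def dy_def
      by (rule derivative_eq_intros gauss_mean_has_derivative_y md0 refl that less_imp_le c | simp add: algebra_simps)+
    show "((\<lambda>y. dy s y) has_real_derivative dyy s y) (at y)" if "0 < s" for s y
      unfolding dy_def dyy_def
      by (rule derivative_eq_intros gauss_mean_has_derivative_y md0 md1 refl that less_imp_le c | simp add: algebra_simps power2_eq_square)+
    show "((\<lambda>s. d s y) has_real_derivative (dyy s y - (exp y)\<^sup>2 * d s y) / 2) (at s)" if "0 < s" for s y
    proof -
      note gd = gauss_mean_equation[OF that c, of k y]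
      have "((\<lambda>s. d s y) has_real_derivative
         (exp ((real k)\<^sup>2 / 2 * s) * ((real k)\<^sup>2 / 2) * exp (real k * y)) * moment 0 s y
         + ((moment 2 s y - (exp y)\<^sup>2 * moment 0 s y) / 2 - (1 / 2 + real k) * moment 1 s y) * ?E s y
         - (- 1) ^ k * ((gauss_mean (dY (dY ?p)) s y ?c - (exp y)\<^sup>2 * gauss_mean ?p s y ?c) / 2)) (at s)"
        unfolding d_def
        by (intro DERIV_diff DERIV_mult DERIV_cmult gd moment_time_derivative[OF that] DERIV_cmult_right DERIV_fun_exp)
          (auto intro!: derivative_eq_intros)
      then show ?thesis
        by (rule DERIV_cong) (simp add: d_def dyy_def field_simps power2_eq_square)
    qed
    show "\<bar>d s y\<bar> \<le> (exp ((real k)\<^sup>2 / 2 * t) + \<bar>A\<bar>) * exp ((real k + \<bar>a\<bar>) * \<bar>y\<bar>)" if s: "0 \<le> s" "s \<le> t" for s y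
    proof -
      let ?X = "exp ((real k + \<bar>a\<bar>) * \<bar>y\<bar>)"
      have "real k * y \<le> (real k + \<bar>a\<bar>) * \<bar>y\<bar>"
        using mult_left_mono[OF abs_ge_self[of y] of_nat_0_le_iff[of k]] mult_nonneg_nonneg[OF abs_ge_zero[of a] abs_ge_zero[of y]]
        unfolding distrib_right by linarith
      then have "?E s y \<le> exp ((real k)\<^sup>2 / 2 * t) * ?X"
        using s by (intro mult_mono) (auto intro: mult_left_mono)
      moreover have "\<bar>?E s y * moment 0 s y\<bar> \<le> ?E s y * 1"
        unfolding abs_mult[of "?E s y"] using moment_0_bound[OF s(1), of y] by (intro mult_mono) auto
      moreover have "\<bar>(- 1) ^ k * gauss_mean ?p s y ?c\<bar> \<le> \<bar>A\<bar> * ?X"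
      proof -
        have "\<bar>(- 1) ^ k * gauss_mean ?p s y ?c\<bar> = \<bar>gauss_mean ?p s y ?c\<bar>" by (simp add: abs_mult)
        also have "\<dots> \<le> A * exp (a * \<bar>y\<bar>)" by (rule A[OF s])
        also have "\<dots> \<le> \<bar>A\<bar> * ?X"
        proof (rule mult_mono)
          have "a * \<bar>y\<bar> \<le> (real k + \<bar>a\<bar>) * \<bar>y\<bar>" by (rule mult_right_mono) auto
          then show "exp (a * \<bar>y\<bar>) \<le> ?X" by simp
        qed auto
        finally show ?thesis .
      qed
      ultimately show ?thesis unfolding d_def distrib_right[of "exp ((real k)\<^sup>2 / 2 * t)"] by linarith
    qed
  qed (use t in auto)
  then show ?thesis by (simp add: d_def)
qed

end

section \<open>The derivatives of p\<close>

text \<open>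
  Averaging over the sign of the Gaussian variable replaces \<open>exp (- lam cosh (\<xi> + b))\<close> by \<open>H 0\<close>.
\<close>

lemma gauss_mean_H0:
  assumes t: "0 \<le> t" and \<xi>: "0 \<le> \<xi>"
  shows "gauss_mean (H 0) t y (cosh \<xi>) = (LINT z|lborel. std_normal_density z * exp (- (exp y * cosh (\<xi> + sqrt t * z))))"
proof -
  define l where "l = exp y"
  let ?\<phi> = "\<lambda>b. exp (- (l * cosh (\<xi> + b)))"
  have H0: "ev (H 0) y (cosh \<xi>) b = (?\<phi> b + ?\<phi> (- b)) / 2" for b
  proof -
    have "(exp y)\<^sup>2 * ((cosh \<xi>)\<^sup>2 - 1) * (sinh b)\<^sup>2 = (l * sinh \<xi> * sinh b)\<^sup>2"
      by (simp add: l_def power_mult_distrib sinh_square_eq)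
    then have "ev (H 0) y (cosh \<xi>) b = exp (- (l * cosh \<xi> * cosh b)) * cosh (l * sinh \<xi> * sinh b)"
      by (simp add: cosh_sqrt_deriv_0_square l_def)
    moreover have "l * cosh (\<xi> + b) = l * cosh \<xi> * cosh b + l * sinh \<xi> * sinh b"
      "l * cosh (\<xi> + - b) = l * cosh \<xi> * cosh b - l * sinh \<xi> * sinh b"
      by (simp_all add: cosh_add distrib_left right_diff_distrib mult.assoc del: add_uminus_conv_diff)
    moreover have "exp (- u) * cosh v = (exp (- (u + v)) + exp (- (u - v))) / 2" for u v :: real
      by (simp add: cosh_field_def distrib_left mult_exp_exp add.commute)
    ultimately show ?thesis by (simp only:)
  qed
  have int: "integrable lborel (\<lambda>z. std_normal_density z * ?\<phi> (r * z))" for r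
  proof (rule integrable_std_normal_exp_bound[where A=1 and a=0])
    show "(\<lambda>z. ?\<phi> (r * z)) \<in> borel_measurable borel"
      by (intro borel_measurable_continuous_onI continuous_intros)
  qed (simp add: l_def)
  have sym: "(LINT z|lborel. std_normal_density z * ?\<phi> (- (sqrt t * z))) = (LINT z|lborel. std_normal_density z * ?\<phi> (sqrt t * z))"
    by (subst lborel_integral_real_affine[where c="-1" and t=0]) (auto simp: normal_density_def)
  have "gauss_mean (H 0) t y (cosh \<xi>) = (LINT z|lborel. (std_normal_density z * ?\<phi> (sqrt t * z) + std_normal_density z * ?\<phi> (- (sqrt t * z))) / 2)"
    unfolding gauss_mean_def H0 by (intro Bochner_Integration.integral_cong refl) (simp add: algebra_simps)
  also have "\<dots> = ((LINT z|lborel. std_normal_density z * ?\<phi> (sqrt t * z)) + (LINT z|lborel. std_normal_density z * ?\<phi> (- (sqrt t * z)))) / 2"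
    using int[of "sqrt t"] int[of "- sqrt t"] by simp
  finally show ?thesis unfolding sym by (simp add: l_def)
qed

lemma p_fun_eq_gauss_mean:
  assumes fp: "filtered_prob_space M F" and bm: "standard_brownian_motion M F B" and t: "0 \<le> t"
    and lam: "0 < lam" "lam \<le> g"
  shows "p_fun M (B t) g lam = gauss_mean (H 0) t (ln lam) (g / lam)"
proof -
  have c: "1 \<le> g / lam" using lam by simp
  have "p_fun M (B t) g lam = (LINT z|lborel. std_normal_density z * exp (- lam * cosh (arcosh (g / lam) + sqrt t * z)))"
    unfolding p_fun_def
    by (rule bm_expectation_gaussian[OF fp bm t]) (intro borel_measurable_continuous_onI continuous_intros)
  also have "\<dots> = gauss_mean (H 0) t (ln lam) (cosh (arcosh (g / lam)))"
    using gauss_mean_H0[OF t, of "arcosh (g / lam)" "ln lam"] c lam by simp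
  finally show ?thesis using c by simp
qed

lemma at_within_atLeast_nontrivial:
  assumes "lam \<le> (g :: real)"
  shows "at g within {lam..} \<noteq> bot"
proof
  assume bot: "at g within {lam..} = bot"
  have "{g<..} \<subseteq> {lam..}" using assms by auto
  then have "at_right g \<le> bot" unfolding bot[symmetric] by (rule at_le)
  then show False using trivial_limit_at_right_real[of g] by (simp add: bot_unique trivial_limit_def)
qed

text \<open>
  Since \<open>c = g / lam\<close>, each differentiation in \<open>g\<close> is a differentiation in \<open>c\<close> and a factor \<open>1 / lam\<close>.
\<close>

lemma nth_deriv_p_fun:
  assumes fp: "filtered_prob_space M F" and bm: "standard_brownian_motion M F B" and t: "0 \<le> t"
    and lam: "0 < lam" "lam \<le> g"
  shows "nth_deriv_on {lam..} j (\<lambda>g. p_fun M (B t) g lam) g = gauss_mean ((dC ^^ j) (H 0)) t (ln lam) (g / lam) / lam ^ j"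
    and "(nth_deriv_on {lam..} j (\<lambda>g. p_fun M (B t) g lam) has_real_derivative
       gauss_mean ((dC ^^ Suc j) (H 0)) t (ln lam) (g / lam) / lam ^ Suc j) (at g within {lam..})"
  using lam(2)
proof (induction j arbitrary: g)
  have der: "(u has_real_derivative gauss_mean ((dC ^^ Suc j) (H 0)) t (ln lam) (g / lam) / lam ^ Suc j) (at g within {lam..})"
    if u: "\<And>g. lam \<le> g \<Longrightarrow> u g = gauss_mean ((dC ^^ j) (H 0)) t (ln lam) (g / lam) / lam ^ j" and g: "lam \<le> g" for u j g
  proof -
    have "((\<lambda>c. gauss_mean ((dC ^^ j) (H 0)) t (ln lam) c) has_real_derivative
       gauss_mean (dC ((dC ^^ j) (H 0))) t (ln lam) (g / lam)) (at (g / lam) within (\<lambda>g. g / lam) ` {lam..})"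
      by (rule has_field_derivative_subset[OF gauss_mean_has_derivative_c[OF t]]) (use lam g in auto)
    moreover have "((\<lambda>g. g / lam) has_real_derivative 1 / lam) (at g within {lam..})"
      by (rule DERIV_cdivide[OF DERIV_ident])
    ultimately have "((\<lambda>g. gauss_mean ((dC ^^ j) (H 0)) t (ln lam) (g / lam)) has_real_derivative
       gauss_mean (dC ((dC ^^ j) (H 0))) t (ln lam) (g / lam) * (1 / lam)) (at g within {lam..})"
      using DERIV_image_chain by (fastforce simp: comp_def)
    from DERIV_cdivide[OF this, of "lam ^ j"]
    have "((\<lambda>g. gauss_mean ((dC ^^ j) (H 0)) t (ln lam) (g / lam) / lam ^ j) has_real_derivative
       gauss_mean ((dC ^^ Suc j) (H 0)) t (ln lam) (g / lam) / lam ^ Suc j) (at g within {lam..})"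
      by simp
    then show ?thesis
      by (rule has_field_derivative_transform_within[where d=1]) (use g u in auto)
  qed
  {
    case 0
    {
      case 1
      then show ?case using p_fun_eq_gauss_mean[OF fp bm t lam(1)] by simp
    next
      case 2
      then show ?case by (intro der) (use p_fun_eq_gauss_mean[OF fp bm t lam(1)] in simp_all)
    }
  next
    case (Suc j)
    have eq: "nth_deriv_on {lam..} (Suc j) (\<lambda>g. p_fun M (B t) g lam) g =
      gauss_mean ((dC ^^ Suc j) (H 0)) t (ln lam) (g / lam) / lam ^ Suc j" if "lam \<le> g" for g
      using vector_derivative_within[OF at_within_atLeast_nontrivial[OF that]
          Suc(2)[OF that, unfolded has_real_derivative_iff_has_vector_derivative]]
      by simp
    {
      case 1
      then show ?case by (rule eq)
    next
      case 2
      then show ?case by (intro der eq)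
    }
  }
qed

section \<open>The expectation as a derivative\<close>

theorem theorem2p6:
  fixes M :: "'a measure" and F :: "real \<Rightarrow> 'a measure"
    and B R :: "real \<Rightarrow> 'a \<Rightarrow> real"
    and k :: nat and \<gamma> lam t :: real
  assumes "filtered_prob_space M F"
    and "standard_brownian_motion M F B"
    and "\<gamma> > 0" and "lam > 0" and "\<gamma> \<ge> lam" and "t \<ge> 0"
    and "hyperbolic_bessel_process M F B (real k - 1 / 2) (arcosh (\<gamma> / lam)) R"
  shows "times_differentiable_on k (\<lambda>g. p_fun M (B t) g lam) {lam..} \<and>
         (LINT \<omega>|M. exp (- lam * cosh (R t \<omega>))) =
           (- 1) ^ k * exp (- ((real k)\<^sup>2 / 2) * t) * nth_deriv_on {lam..} k (\<lambda>g. p_fun M (B t) g lam) \<gamma>"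
proof
  note fp = assms(1) and bm = assms(2) and lam = assms(4) and \<gamma> = assms(5) and t = assms(6) and hb = assms(7)
  note nth = nth_deriv_p_fun[OF fp bm t lam]
  show "times_differentiable_on k (\<lambda>g. p_fun M (B t) g lam) {lam..}"
    unfolding times_differentiable_on_def differentiable_on_def real_differentiable_def
    using nth(2) by (meson atLeast_iff)
  have c: "1 \<le> \<gamma> / lam" using lam \<gamma> by simp
  show "(LINT \<omega>|M. exp (- lam * cosh (R t \<omega>))) =
           (- 1) ^ k * exp (- ((real k)\<^sup>2 / 2) * t) * nth_deriv_on {lam..} k (\<lambda>g. p_fun M (B t) g lam) \<gamma>"
  proof (cases "k = 0")
    case True
    interpret prob_space M using fp by (simp add: filtered_prob_space_def)
    have [measurable]: "R t \<in> borel_measurable M" "B t \<in> borel_measurable M"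
      using hb bm fp t unfolding hyperbolic_bessel_process_def standard_brownian_motion_def filtered_prob_space_def
      by (meson measurable_from_subalg)+
    have [measurable]: "cosh \<in> borel_measurable (borel :: real measure)"
      by (intro borel_measurable_continuous_onI continuous_intros)
    \<comment> \<open>For index \<open>-1/2\<close> the process is a reflected Brownian motion, and \<open>cosh\<close> is even.\<close>
    have "AE \<omega> in M. \<forall>t\<ge>0. R t \<omega> = \<bar>arcosh (\<gamma> / lam) + B t \<omega>\<bar>"
      using hb True by (simp add: hyperbolic_bessel_process_def)
    then have "AE \<omega> in M. exp (- lam * cosh (R t \<omega>)) = exp (- lam * cosh (arcosh (\<gamma> / lam) + B t \<omega>))"
    proof eventually_elim
      case (elim \<omega>)
      have "cosh \<bar>v\<bar> = cosh v" for v :: real by (simp add: abs_if)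
      then show ?case using elim t by simp
    qed
    then have "(LINT \<omega>|M. exp (- lam * cosh (R t \<omega>))) = (LINT \<omega>|M. exp (- lam * cosh (arcosh (\<gamma> / lam) + B t \<omega>)))"
      by (intro integral_cong_AE) auto
    then show ?thesis using True by (simp add: p_fun_def)
  next
    case False
    interpret hyperbolic_bessel M F B R k "arcosh (\<gamma> / lam)"
      by unfold_locales (use fp bm hb False in auto)
    define G where "G = gauss_mean ((dC ^^ k) (H 0)) t (ln lam) (\<gamma> / lam)"
    define e where "e = exp ((real k)\<^sup>2 / 2 * t)"
    have ek: "exp (real k * ln lam) = lam ^ k" using lam by (simp add: exp_of_nat_mult)
    have "e * lam ^ k * (LINT \<omega>|M. exp (- lam * cosh (R t \<omega>))) = (- 1) ^ k * G"
      using laplace_transform_eq[OF t, of "ln lam"] lam c unfolding ek by (simp add: moment_def G_def e_def)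
    moreover have "exp (- ((real k)\<^sup>2 / 2) * t) = 1 / e"
      unfolding e_def by (simp only: mult_minus_left exp_minus inverse_eq_divide)
    moreover have "0 < e" "0 < lam ^ k" using lam by (simp_all add: e_def)
    moreover have "I = \<sigma> * r * (h / m)" if "e * m * I = \<sigma> * h" "r = 1 / e" "0 < e" "0 < m"
      for e m I \<sigma> h r :: real
    proof -
      have "I = \<sigma> * h / (e * m)" using that(1,3,4) by (simp add: eq_divide_eq mult.commute)
      then show ?thesis by (simp add: that(2))
    qed
    ultimately show ?thesis unfolding nth(1)[OF \<gamma>] G_def[symmetric] by blast
  qed
qed

end
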